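(* Let $k$ be an uncountable field and let $R$ be an affine prime Goldie non-simple non-PI $k$-algebra with $\operatorname{GKdim}(R)<3$. Suppose $R$ has an element $x$, not algebraic over $k$, such that $x+P\in R/P$ is algebraic over $k$ for every prime ideal $P$ of $R$ with $\operatorname{GKdim}(R/P)=1$, and suppose also that for every such prime $P$ the center $Z(Q(R/P))$ of the classical (Goldie) ring of quotients $Q(R/P)$ of $R/P$ is isomorphic to the rational function field $k(X)$ in one indeterminate. Then $R$ is primitive.
   Context: All algebras are associative with 1; isomorphisms are of $k$-algebras. A $k$-algebra is affine if it is finitely generated as a $k$-algebra. $\operatorname{GKdim}$ is Gelfand--Kirillov dimension over $k$. PI means satisfying a (nontrivial) polynomial identity. An element is algebraic over $k$ if it is a root of a nonzero polynomial in $k[t]$. Primitive means left primitive (having a faithful simple left module). Goldie means left and right Goldie. For $P$ prime with $\operatorname{GKdim}(R/P)=1$, the algebra $R/P$ is prime PI, hence prime Goldie, so $Q(R/P)$ exists. *)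

theory Defs
  imports
    "Jordan_Normal_Form.Missing_VectorSpace"
    "HOL-Algebra.QuotRing"
    "HOL-Algebra.Subrings"
    "HOL-Algebra.UnivPoly"
    "HOL-Library.Countable_Set"
    "HOL-Library.Extended_Real"
    "HOL-Library.Liminf_Limsup"
    Complex_Main
begin

section \<open>Algebras over a field\<close>

text \<open>
  The library locale \<^locale>\<open>algebra\<close> is restricted to commutative rings; here the
  multiplication need not commute, so scalars have to be movable past either factor.
\<close>

locale k_algebra = vectorspace K A + ring A for K and A (structure) +
  assumes smult_mult_left:
      "\<lbrakk>c \<in> carrier K; x \<in> carrier A; y \<in> carrier A\<rbrakk> \<Longrightarrow>
        (c \<odot> x) \<otimes> y = c \<odot> (x \<otimes> y)"
    and smult_mult_right:
      "\<lbrakk>c \<in> carrier K; x \<in> carrier A; y \<in> carrier A\<rbrakk> \<Longrightarrow>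
        x \<otimes> (c \<odot> y) = c \<odot> (x \<otimes> y)"

lemma k_algebraI:
  assumes "field K" "ring A"
    and "\<And>c x. c \<in> carrier K \<Longrightarrow> x \<in> carrier A \<Longrightarrow> c \<odot>\<^bsub>A\<^esub> x \<in> carrier A"
    and "\<And>c d x. c \<in> carrier K \<Longrightarrow> d \<in> carrier K \<Longrightarrow> x \<in> carrier A \<Longrightarrow>
          (c \<oplus>\<^bsub>K\<^esub> d) \<odot>\<^bsub>A\<^esub> x = c \<odot>\<^bsub>A\<^esub> x \<oplus>\<^bsub>A\<^esub> d \<odot>\<^bsub>A\<^esub> x"
    and "\<And>c x y. c \<in> carrier K \<Longrightarrow> x \<in> carrier A \<Longrightarrow> y \<in> carrier A \<Longrightarrow>
          c \<odot>\<^bsub>A\<^esub> (x \<oplus>\<^bsub>A\<^esub> y) = c \<odot>\<^bsub>A\<^esub> x \<oplus>\<^bsub>A\<^esub> c \<odot>\<^bsub>A\<^esub> y"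
    and "\<And>c d x. c \<in> carrier K \<Longrightarrow> d \<in> carrier K \<Longrightarrow> x \<in> carrier A \<Longrightarrow>
          (c \<otimes>\<^bsub>K\<^esub> d) \<odot>\<^bsub>A\<^esub> x = c \<odot>\<^bsub>A\<^esub> (d \<odot>\<^bsub>A\<^esub> x)"
    and "\<And>x. x \<in> carrier A \<Longrightarrow> \<one>\<^bsub>K\<^esub> \<odot>\<^bsub>A\<^esub> x = x"
    and "\<And>c x y. c \<in> carrier K \<Longrightarrow> x \<in> carrier A \<Longrightarrow> y \<in> carrier A \<Longrightarrow>
          (c \<odot>\<^bsub>A\<^esub> x) \<otimes>\<^bsub>A\<^esub> y = c \<odot>\<^bsub>A\<^esub> (x \<otimes>\<^bsub>A\<^esub> y)"
    and "\<And>c x y. c \<in> carrier K \<Longrightarrow> x \<in> carrier A \<Longrightarrow> y \<in> carrier A \<Longrightarrow>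
          x \<otimes>\<^bsub>A\<^esub> (c \<odot>\<^bsub>A\<^esub> y) = c \<odot>\<^bsub>A\<^esub> (x \<otimes>\<^bsub>A\<^esub> y)"
  shows "k_algebra K A"
proof -
  interpret K: field K by fact
  interpret A: ring A by fact
  have "Module.module K A"
    by (rule Module.moduleI) (use assms K.cring_axioms A.abelian_group_axioms in auto)
  then show ?thesis
    using assms by (intro k_algebra.intro vectorspace.intro k_algebra_axioms.intro) auto
qed

definition k_algebra_hom ::
    "('k, 'c) ring_scheme \<Rightarrow> ('k, 'a, 'm) module_scheme \<Rightarrow> ('k, 'b, 'n) module_scheme \<Rightarrow> ('a \<Rightarrow> 'b) set"
  where "k_algebra_hom K A B =
    {h \<in> ring_hom A B. \<forall>c\<in>carrier K. \<forall>x\<in>carrier A. h (c \<odot>\<^bsub>A\<^esub> x) = c \<odot>\<^bsub>B\<^esub> h x}"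

definition k_algebra_isomorphic ::
    "('k, 'c) ring_scheme \<Rightarrow> ('k, 'a, 'm) module_scheme \<Rightarrow> ('k, 'b, 'n) module_scheme \<Rightarrow> bool"
  where "k_algebra_isomorphic K A B \<longleftrightarrow>
    (\<exists>h \<in> k_algebra_hom K A B. bij_betw h (carrier A) (carrier B))"

definition k_subalgebra ::
    "('k, 'c) ring_scheme \<Rightarrow> 'a set \<Rightarrow> ('k, 'a, 'm) module_scheme \<Rightarrow> bool"
  where "k_subalgebra K B A \<longleftrightarrow>
    subring B A \<and> (\<forall>c\<in>carrier K. \<forall>b\<in>B. c \<odot>\<^bsub>A\<^esub> b \<in> B)"

definition affine_algebra :: "('k, 'c) ring_scheme \<Rightarrow> ('k, 'a, 'm) module_scheme \<Rightarrow> bool"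
  where "affine_algebra K A \<longleftrightarrow>
    (\<exists>S. finite S \<and> S \<subseteq> carrier A \<and>
      \<Inter>{B. k_subalgebra K B A \<and> S \<subseteq> B} = carrier A)"

text \<open>The quotient ring \<open>R Quot P\<close> of the library, with the induced scalar multiplication.\<close>

definition quot_algebra :: "('k, 'a, 'm) module_scheme \<Rightarrow> 'a set \<Rightarrow> ('k, 'a set) module"
  where "quot_algebra R P =
    \<lparr>carrier = carrier (R Quot P), mult = mult (R Quot P), one = one (R Quot P),
     zero = zero (R Quot P), add = add (R Quot P),
     smult = (\<lambda>c X. \<Union>x\<in>X. P +>\<^bsub>R\<^esub> (c \<odot>\<^bsub>R\<^esub> x))\<rparr>"

lemma k_algebra_quot_algebra:
  assumes "k_algebra K R" "ideal P R"
  shows "k_algebra K (quot_algebra R P)"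
    and "c \<in> carrier K \<Longrightarrow> x \<in> carrier R \<Longrightarrow>
           c \<odot>\<^bsub>quot_algebra R P\<^esub> (P +>\<^bsub>R\<^esub> x) = P +>\<^bsub>R\<^esub> (c \<odot>\<^bsub>R\<^esub> x)"
proof -
  interpret R: k_algebra K R by fact
  interpret P: ideal P R by fact
  let ?Q = "quot_algebra R P"
  have sm: "c \<odot>\<^bsub>?Q\<^esub> (P +>\<^bsub>R\<^esub> x) = P +>\<^bsub>R\<^esub> (c \<odot>\<^bsub>R\<^esub> x)"
    if c: "c \<in> carrier K" and x: "x \<in> carrier R" for c x
  proof -
    have eq: "P +>\<^bsub>R\<^esub> (c \<odot>\<^bsub>R\<^esub> y) = P +>\<^bsub>R\<^esub> (c \<odot>\<^bsub>R\<^esub> x)" if "y \<in> P +>\<^bsub>R\<^esub> x" for y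
    proof -
      have "\<exists>p\<in>P. y = p \<oplus>\<^bsub>R\<^esub> x"
        using that by (simp only: a_r_coset_def' UN_iff singleton_iff)
      then obtain p where p: "p \<in> P" "y = p \<oplus>\<^bsub>R\<^esub> x" by (rule bexE)
      then have pc: "p \<in> carrier R" by (intro P.a_Hcarr)
      have "c \<odot>\<^bsub>R\<^esub> p = (c \<odot>\<^bsub>R\<^esub> \<one>\<^bsub>R\<^esub>) \<otimes>\<^bsub>R\<^esub> p"
        using c pc by (simp add: R.smult_mult_left)
      then have cp: "c \<odot>\<^bsub>R\<^esub> p \<in> P"
        using P.I_l_closed[OF p(1) R.smult_closed[OF c R.one_closed]] by simp
      have "c \<odot>\<^bsub>R\<^esub> y = c \<odot>\<^bsub>R\<^esub> p \<oplus>\<^bsub>R\<^esub> c \<odot>\<^bsub>R\<^esub> x"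
        unfolding p(2) using c pc x by (rule R.smult_r_distr)
      from this cp have "\<exists>h\<in>P. c \<odot>\<^bsub>R\<^esub> y = h \<oplus>\<^bsub>R\<^esub> c \<odot>\<^bsub>R\<^esub> x" by (rule bexI)
      then have "c \<odot>\<^bsub>R\<^esub> y \<in> P +>\<^bsub>R\<^esub> (c \<odot>\<^bsub>R\<^esub> x)"
        by (simp only: a_r_coset_def' UN_iff singleton_iff)
      from P.a_repr_independence'[OF this R.smult_closed[OF c x]]
      show ?thesis by (rule sym)
    qed
    have "(\<Union>y\<in>P +>\<^bsub>R\<^esub> x. P +>\<^bsub>R\<^esub> (c \<odot>\<^bsub>R\<^esub> y)) = P +>\<^bsub>R\<^esub> (c \<odot>\<^bsub>R\<^esub> x)"
      by (rule UN_constant_eq[OF P.a_rcos_self[OF x]]) (rule ballI, rule eq)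
    then show ?thesis by (simp only: quot_algebra_def module.simps)
  qed
  then show "c \<in> carrier K \<Longrightarrow> x \<in> carrier R \<Longrightarrow>
           c \<odot>\<^bsub>quot_algebra R P\<^esub> (P +>\<^bsub>R\<^esub> x) = P +>\<^bsub>R\<^esub> (c \<odot>\<^bsub>R\<^esub> x)" .
  have rq: "ring ?Q"
  proof -
    interpret Q: ring "R Quot P" by (rule P.quotient_is_ring)
    show ?thesis
    proof (rule ringI)
      show "abelian_group ?Q"
        by (rule abelian_groupI)
          (simp_all add: quot_algebra_def Q.a_ac Q.add.l_inv_ex)
      show "Group.monoid ?Q"
        by (rule monoidI) (simp_all add: quot_algebra_def Q.m_assoc)
    qed (simp_all add: quot_algebra_def Q.l_distr Q.r_distr)
  qed
  have car: "carrier ?Q = (+>\<^bsub>R\<^esub>) P ` carrier R"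
    by (auto simp: quot_algebra_def FactRing_def A_RCOSETS_def')
  have ad: "(P +>\<^bsub>R\<^esub> x) \<oplus>\<^bsub>?Q\<^esub> (P +>\<^bsub>R\<^esub> y) = P +>\<^bsub>R\<^esub> (x \<oplus>\<^bsub>R\<^esub> y)"
    if "x \<in> carrier R" "y \<in> carrier R" for x y
    using that by (simp add: quot_algebra_def FactRing_def P.a_rcos_sum)
  have mu: "(P +>\<^bsub>R\<^esub> x) \<otimes>\<^bsub>?Q\<^esub> (P +>\<^bsub>R\<^esub> y) = P +>\<^bsub>R\<^esub> (x \<otimes>\<^bsub>R\<^esub> y)"
    if "x \<in> carrier R" "y \<in> carrier R" for x y
    using that by (simp add: quot_algebra_def FactRing_def P.rcoset_mult_add)
  show "k_algebra K ?Q"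
    by (rule k_algebraI[OF R.field_axioms rq])
      (auto simp: car sm ad mu R.smult_l_distr R.smult_r_distr R.smult_assoc1
        R.smult_mult_left R.smult_mult_right)
qed

definition center :: "('a, 'm) ring_scheme \<Rightarrow> 'a set"
  where "center A = {z \<in> carrier A. \<forall>x\<in>carrier A. z \<otimes>\<^bsub>A\<^esub> x = x \<otimes>\<^bsub>A\<^esub> z}"

definition center_algebra :: "('k, 'a, 'm) module_scheme \<Rightarrow> ('k, 'a, 'm) module_scheme"
  where "center_algebra A = A\<lparr>carrier := center A\<rparr>"

definition algebraic_element ::
    "('k, 'c) ring_scheme \<Rightarrow> ('k, 'a, 'm) module_scheme \<Rightarrow> 'a \<Rightarrow> bool"
  where "algebraic_element K A x \<longleftrightarrow>
    (\<exists>p \<in> carrier (UP K). p \<noteq> \<zero>\<^bsub>UP K\<^esub> \<and>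
      UnivPoly.eval K A (\<lambda>c. c \<odot>\<^bsub>A\<^esub> \<one>\<^bsub>A\<^esub>) x p = \<zero>\<^bsub>A\<^esub>)"

text \<open>
  An element of the free algebra on countably many letters is a finitely supported function
  from words (lists of letters) to scalars; \<open>\<sigma>\<close> substitutes ring elements for the letters.
\<close>

definition word_value :: "('a, 'm) ring_scheme \<Rightarrow> (nat \<Rightarrow> 'a) \<Rightarrow> nat list \<Rightarrow> 'a"
  where "word_value A \<sigma> w = foldr (\<lambda>i y. \<sigma> i \<otimes>\<^bsub>A\<^esub> y) w \<one>\<^bsub>A\<^esub>"

definition PI_algebra :: "('k, 'c) ring_scheme \<Rightarrow> ('k, 'a, 'm) module_scheme \<Rightarrow> bool"
  where "PI_algebra K A \<longleftrightarrow>
    (\<exists>f :: nat list \<Rightarrow> 'k.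
      range f \<subseteq> carrier K \<and> finite {w. f w \<noteq> \<zero>\<^bsub>K\<^esub>} \<and> {w. f w \<noteq> \<zero>\<^bsub>K\<^esub>} \<noteq> {} \<and>
      (\<forall>\<sigma>. range \<sigma> \<subseteq> carrier A \<longrightarrow>
        (\<Oplus>\<^bsub>A\<^esub>w\<in>{w. f w \<noteq> \<zero>\<^bsub>K\<^esub>}. f w \<odot>\<^bsub>A\<^esub> word_value A \<sigma> w) = \<zero>\<^bsub>A\<^esub>))"


section \<open>Gelfand--Kirillov dimension\<close>

primrec space_power ::
    "('k, 'c) ring_scheme \<Rightarrow> ('k, 'a, 'm) module_scheme \<Rightarrow> 'a set \<Rightarrow> nat \<Rightarrow> 'a set"
  where
    "space_power K A V 0 = LinearCombinations.module.span K A {\<one>\<^bsub>A\<^esub>}"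
  | "space_power K A V (Suc n) =
      LinearCombinations.module.span K A (space_power K A V n <#>\<^bsub>A\<^esub> V)"

text \<open>The growth function \<open>dim (k + V + \<dots> + V\<^sup>n)\<close> of the subspace \<open>V\<close>.\<close>

definition growth ::
    "('k, 'c) ring_scheme \<Rightarrow> ('k, 'a, 'm) module_scheme \<Rightarrow> 'a set \<Rightarrow> nat \<Rightarrow> nat"
  where "growth K A V n =
    vectorspace.dim K
      (A\<lparr>carrier := LinearCombinations.module.span K A (\<Union>i\<le>n. space_power K A V i)\<rparr>)"

definition GKdim :: "('k, 'c) ring_scheme \<Rightarrow> ('k, 'a, 'm) module_scheme \<Rightarrow> ereal"
  where "GKdim K A =
    (SUP V \<in> {V. VectorSpace.subspace K V A \<and> vectorspace.fin_dim K (A\<lparr>carrier := V\<rparr>)}.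
      limsup (\<lambda>n. ereal (log (real n) (real (growth K A V n)))))"


section \<open>Ring-theoretic notions\<close>

text \<open>
  The library locale \<^locale>\<open>primeideal\<close> is the completely prime notion for commutative rings;
  in a noncommutative ring primeness is tested on products of two-sided ideals.
\<close>

definition prime_ideal :: "'a set \<Rightarrow> ('a, 'm) ring_scheme \<Rightarrow> bool"
  where "prime_ideal P R \<longleftrightarrow> ideal P R \<and> P \<noteq> carrier R \<and>
    (\<forall>I J. ideal I R \<longrightarrow> ideal J R \<longrightarrow> I <#>\<^bsub>R\<^esub> J \<subseteq> P \<longrightarrow> I \<subseteq> P \<or> J \<subseteq> P)"

definition prime_ring :: "('a, 'm) ring_scheme \<Rightarrow> bool"
  where "prime_ring R \<longleftrightarrow> prime_ideal {\<zero>\<^bsub>R\<^esub>} R"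

definition simple_ring :: "('a, 'm) ring_scheme \<Rightarrow> bool"
  where "simple_ring R \<longleftrightarrow> carrier R \<noteq> {\<zero>\<^bsub>R\<^esub>} \<and>
    (\<forall>I. ideal I R \<longrightarrow> I = {\<zero>\<^bsub>R\<^esub>} \<or> I = carrier R)"

definition opposite_ring :: "('a, 'm) ring_scheme \<Rightarrow> ('a, 'm) ring_scheme"
  where "opposite_ring R = R\<lparr>mult := (\<lambda>x y. y \<otimes>\<^bsub>R\<^esub> x)\<rparr>"

definition right_ideal :: "'a set \<Rightarrow> ('a, 'm) ring_scheme \<Rightarrow> bool"
  where "right_ideal I R \<longleftrightarrow>
    additive_subgroup I R \<and> (\<forall>x\<in>I. \<forall>r\<in>carrier R. x \<otimes>\<^bsub>R\<^esub> r \<in> I)"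

definition right_annihilator :: "('a, 'm) ring_scheme \<Rightarrow> 'a set \<Rightarrow> 'a set"
  where "right_annihilator R X = {r \<in> carrier R. \<forall>x\<in>X. x \<otimes>\<^bsub>R\<^esub> r = \<zero>\<^bsub>R\<^esub>}"

definition acc_right_annihilators :: "('a, 'm) ring_scheme \<Rightarrow> bool"
  where "acc_right_annihilators R \<longleftrightarrow>
    (\<forall>I :: nat \<Rightarrow> 'a set.
      (\<forall>n. I n \<in> right_annihilator R ` Pow (carrier R)) \<and> (\<forall>n. I n \<subseteq> I (Suc n)) \<longrightarrow>
      (\<exists>N. \<forall>n\<ge>N. I n = I N))"

definition infinite_direct_sum_of_right_ideals :: "('a, 'm) ring_scheme \<Rightarrow> (nat \<Rightarrow> 'a set) \<Rightarrow> bool"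
  where "infinite_direct_sum_of_right_ideals R I \<longleftrightarrow>
    (\<forall>n. right_ideal (I n) R \<and> I n \<noteq> {\<zero>\<^bsub>R\<^esub>}) \<and>
    (\<forall>F x. finite F \<and> x \<in> Pi F I \<and> (\<Oplus>\<^bsub>R\<^esub>i\<in>F. x i) = \<zero>\<^bsub>R\<^esub> \<longrightarrow> (\<forall>i\<in>F. x i = \<zero>\<^bsub>R\<^esub>))"

definition right_Goldie :: "('a, 'm) ring_scheme \<Rightarrow> bool"
  where "right_Goldie R \<longleftrightarrow>
    acc_right_annihilators R \<and> (\<nexists>I. infinite_direct_sum_of_right_ideals R I)"

definition Goldie :: "('a, 'm) ring_scheme \<Rightarrow> bool"
  where "Goldie R \<longleftrightarrow> right_Goldie R \<and> right_Goldie (opposite_ring R)"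

text \<open>The library locale \<^locale>\<open>module\<close> requires a commutative ring of scalars.\<close>

locale left_module = ring R + M?: abelian_group M
  for R :: "('a, 'r) ring_scheme" and M :: "('a, 'b, 'm) module_scheme" (structure) +
  assumes smult_closed:
      "\<lbrakk>r \<in> carrier R; m \<in> carrier M\<rbrakk> \<Longrightarrow> r \<odot>\<^bsub>M\<^esub> m \<in> carrier M"
    and smult_l_distr:
      "\<lbrakk>r \<in> carrier R; s \<in> carrier R; m \<in> carrier M\<rbrakk> \<Longrightarrow>
        (r \<oplus>\<^bsub>R\<^esub> s) \<odot>\<^bsub>M\<^esub> m = r \<odot>\<^bsub>M\<^esub> m \<oplus>\<^bsub>M\<^esub> s \<odot>\<^bsub>M\<^esub> m"
    and smult_r_distr:
      "\<lbrakk>r \<in> carrier R; m \<in> carrier M; n \<in> carrier M\<rbrakk> \<Longrightarrow>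
        r \<odot>\<^bsub>M\<^esub> (m \<oplus>\<^bsub>M\<^esub> n) = r \<odot>\<^bsub>M\<^esub> m \<oplus>\<^bsub>M\<^esub> r \<odot>\<^bsub>M\<^esub> n"
    and smult_assoc:
      "\<lbrakk>r \<in> carrier R; s \<in> carrier R; m \<in> carrier M\<rbrakk> \<Longrightarrow>
        (r \<otimes>\<^bsub>R\<^esub> s) \<odot>\<^bsub>M\<^esub> m = r \<odot>\<^bsub>M\<^esub> (s \<odot>\<^bsub>M\<^esub> m)"
    and smult_one:
      "m \<in> carrier M \<Longrightarrow> \<one>\<^bsub>R\<^esub> \<odot>\<^bsub>M\<^esub> m = m"

definition left_submodule ::
    "('a, 'r) ring_scheme \<Rightarrow> 'b set \<Rightarrow> ('a, 'b, 'm) module_scheme \<Rightarrow> bool"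
  where "left_submodule R N M \<longleftrightarrow>
    additive_subgroup N M \<and> (\<forall>r\<in>carrier R. \<forall>n\<in>N. r \<odot>\<^bsub>M\<^esub> n \<in> N)"

definition simple_left_module :: "('a, 'r) ring_scheme \<Rightarrow> ('a, 'b, 'm) module_scheme \<Rightarrow> bool"
  where "simple_left_module R M \<longleftrightarrow>
    left_module R M \<and> carrier M \<noteq> {\<zero>\<^bsub>M\<^esub>} \<and>
    (\<forall>N. left_submodule R N M \<longrightarrow> N = {\<zero>\<^bsub>M\<^esub>} \<or> N = carrier M)"

definition faithful_left_module :: "('a, 'r) ring_scheme \<Rightarrow> ('a, 'b, 'm) module_scheme \<Rightarrow> bool"
  where "faithful_left_module R M \<longleftrightarrow>
    left_module R M \<and>
    (\<forall>r\<in>carrier R. (\<forall>m\<in>carrier M. r \<odot>\<^bsub>M\<^esub> m = \<zero>\<^bsub>M\<^esub>) \<longrightarrow> r = \<zero>\<^bsub>R\<^esub>)"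

text \<open>
  Fixing the type of the module loses nothing: a simple left module is isomorphic to \<open>R/L\<close> for
  a maximal left ideal \<open>L\<close>, and the elements of \<open>R/L\<close> are sets of elements of \<open>R\<close>.
\<close>

definition primitive_ring :: "('a, 'r) ring_scheme \<Rightarrow> bool"
  where "primitive_ring R \<longleftrightarrow>
    (\<exists>M :: ('a, 'a set) module. simple_left_module R M \<and> faithful_left_module R M)"


section \<open>Classical rings of quotients\<close>

definition regular_elements :: "('a, 'm) ring_scheme \<Rightarrow> 'a set"
  where "regular_elements A =
    {s \<in> carrier A. \<forall>a\<in>carrier A. (s \<otimes>\<^bsub>A\<^esub> a = \<zero>\<^bsub>A\<^esub> \<longrightarrow> a = \<zero>\<^bsub>A\<^esub>) \<and>
                                   (a \<otimes>\<^bsub>A\<^esub> s = \<zero>\<^bsub>A\<^esub> \<longrightarrow> a = \<zero>\<^bsub>A\<^esub>)}"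

definition is_quotient_algebra_via ::
    "('k, 'c) ring_scheme \<Rightarrow> ('k, 'a, 'm) module_scheme \<Rightarrow> ('k, 'q, 'n) module_scheme \<Rightarrow>
      ('a \<Rightarrow> 'q) \<Rightarrow> bool"
  where "is_quotient_algebra_via K A Q \<iota> \<longleftrightarrow>
    k_algebra K Q \<and> \<iota> \<in> k_algebra_hom K A Q \<and> inj_on \<iota> (carrier A) \<and>
    (\<forall>s\<in>regular_elements A. \<iota> s \<in> Units Q) \<and>
    (\<forall>q\<in>carrier Q.
      (\<exists>a\<in>carrier A. \<exists>s\<in>regular_elements A. q = \<iota> a \<otimes>\<^bsub>Q\<^esub> inv\<^bsub>Q\<^esub> (\<iota> s)) \<and>
      (\<exists>b\<in>carrier A. \<exists>t\<in>regular_elements A. q = inv\<^bsub>Q\<^esub> (\<iota> t) \<otimes>\<^bsub>Q\<^esub> \<iota> b))"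

text \<open>
  A (two-sided) classical ring of quotients exists for every prime Goldie ring and every
  commutative domain.  It is unique up to isomorphism of \<open>k\<close>-algebras over \<open>A\<close>,
  so any choice will do.  The type of the chosen one is no restriction: an element of a ring of
  quotients can be identified with the set of pairs \<open>(a, s)\<close> for which it equals \<open>a s\<^sup>-\<^sup>1\<close>; see
  \<open>classical_quotient_algebra\<close> below.
\<close>

definition classical_quotient ::
    "('k, 'c) ring_scheme \<Rightarrow> ('k, 'a, 'm) module_scheme \<Rightarrow> ('k, ('a \<times> 'a) set) module"
  where "classical_quotient K A = (SOME Q. \<exists>\<iota>. is_quotient_algebra_via K A Q \<iota>)"

lemma classical_quotient_algebra:
  fixes K :: "('k, 'c) ring_scheme" and A :: "('k, 'a, 'm) module_scheme"
    and Q :: "('k, 'q, 'n) module_scheme"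
  assumes "is_quotient_algebra_via K A Q \<iota>"
  shows "\<exists>\<kappa>. is_quotient_algebra_via K A (classical_quotient K A) \<kappa>"
proof -
  let ?reg = "regular_elements A"
  interpret Q: k_algebra K Q using assms by (simp add: is_quotient_algebra_via_def)
  have hom: "\<iota> \<in> ring_hom A Q"
    and hs: "\<And>c x. c \<in> carrier K \<Longrightarrow> x \<in> carrier A \<Longrightarrow> \<iota> (c \<odot>\<^bsub>A\<^esub> x) = c \<odot>\<^bsub>Q\<^esub> \<iota> x"
    and inj: "inj_on \<iota> (carrier A)"
    and un: "\<And>s. s \<in> ?reg \<Longrightarrow> \<iota> s \<in> Units Q"
    and rfr: "\<And>q. q \<in> carrier Q \<Longrightarrow> \<exists>a\<in>carrier A. \<exists>s\<in>?reg. q = \<iota> a \<otimes>\<^bsub>Q\<^esub> inv\<^bsub>Q\<^esub> (\<iota> s)"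
    and lfr: "\<And>q. q \<in> carrier Q \<Longrightarrow> \<exists>b\<in>carrier A. \<exists>t\<in>?reg. q = inv\<^bsub>Q\<^esub> (\<iota> t) \<otimes>\<^bsub>Q\<^esub> \<iota> b"
    using assms by (auto simp: is_quotient_algebra_via_def k_algebra_hom_def)
  define g where "g q = {(a, s). a \<in> carrier A \<and> s \<in> ?reg \<and> q = \<iota> a \<otimes>\<^bsub>Q\<^esub> inv\<^bsub>Q\<^esub> (\<iota> s)}" for q
  have injg: "inj_on g (carrier Q)"
    by (rule inj_onI) (use rfr in \<open>fastforce simp: g_def set_eq_iff\<close>)
  define h where "h = inv_into (carrier Q) g"
  have hg [simp]: "h (g q) = q" if "q \<in> carrier Q" for q
    using that injg by (simp add: h_def)
  define Q' :: "('k, ('a \<times> 'a) set) module" where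
    "Q' = \<lparr>carrier = g ` carrier Q, mult = (\<lambda>X Y. g (h X \<otimes>\<^bsub>Q\<^esub> h Y)), one = g \<one>\<^bsub>Q\<^esub>,
      zero = g \<zero>\<^bsub>Q\<^esub>, add = (\<lambda>X Y. g (h X \<oplus>\<^bsub>Q\<^esub> h Y)), smult = (\<lambda>c X. g (c \<odot>\<^bsub>Q\<^esub> h X))\<rparr>"
  have ring': "ring Q'"
  proof (rule ringI)
    show "abelian_group Q'"
      by (rule abelian_groupI)
        (auto simp: Q'_def Q.a_ac Q.r_neg intro!: bexI[of _ "\<ominus>\<^bsub>Q\<^esub> _"])
    show "Group.monoid Q'"
      by (rule monoidI) (auto simp: Q'_def Q.m_assoc)
  qed (auto simp: Q'_def Q.l_distr Q.r_distr)
  have alg': "k_algebra K Q'"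
    by (rule k_algebraI[OF Q.field_axioms ring'])
      (auto simp: Q'_def Q.smult_l_distr Q.smult_r_distr Q.smult_assoc1
        Q.smult_mult_left Q.smult_mult_right)
  interpret Q': k_algebra K Q' by fact
  have c\<iota>: "\<iota> a \<in> carrier Q" if "a \<in> carrier A" for a
    using hom that by (rule ring_hom_closed)
  have regc: "s \<in> carrier A" if "s \<in> ?reg" for s using that by (simp add: regular_elements_def)
  have hom': "g \<circ> \<iota> \<in> k_algebra_hom K A Q'"
    using hom hs c\<iota> by (auto simp: k_algebra_hom_def ring_hom_def Q'_def)
  have inv': "g u \<in> Units Q' \<and> inv\<^bsub>Q'\<^esub> (g u) = g (inv\<^bsub>Q\<^esub> u)" if u: "u \<in> Units Q" for u
  proof -
    have "u \<in> carrier Q" "inv\<^bsub>Q\<^esub> u \<in> carrier Q" using u by auto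
    then have *: "g u \<in> carrier Q'" "g (inv\<^bsub>Q\<^esub> u) \<in> carrier Q'"
      "g u \<otimes>\<^bsub>Q'\<^esub> g (inv\<^bsub>Q\<^esub> u) = \<one>\<^bsub>Q'\<^esub>" "g (inv\<^bsub>Q\<^esub> u) \<otimes>\<^bsub>Q'\<^esub> g u = \<one>\<^bsub>Q'\<^esub>"
      using u by (auto simp: Q'_def)
    then have "g u \<in> Units Q'" by (auto simp: Units_def)
    moreover have "inv\<^bsub>Q'\<^esub> (g u) = g (inv\<^bsub>Q\<^esub> u)" using * by (intro Q'.inv_char) auto
    ultimately show ?thesis by blast
  qed
  have mu: "g x \<otimes>\<^bsub>Q'\<^esub> g y = g (x \<otimes>\<^bsub>Q\<^esub> y)" if "x \<in> carrier Q" "y \<in> carrier Q" for x y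
    using that by (simp add: Q'_def)
  have "is_quotient_algebra_via K A Q' (g \<circ> \<iota>)"
    unfolding is_quotient_algebra_via_def
  proof (intro conjI ballI)
    show "inj_on (g \<circ> \<iota>) (carrier A)"
      using inj injg c\<iota> by (auto intro!: comp_inj_on inj_on_subset[OF injg])
    fix s assume "s \<in> ?reg" then show "(g \<circ> \<iota>) s \<in> Units Q'" using inv' un by simp
  next
    fix q assume "q \<in> carrier Q'"
    then obtain p where p: "p \<in> carrier Q" "q = g p" by (auto simp: Q'_def)
    obtain a s where as: "a \<in> carrier A" "s \<in> ?reg" "p = \<iota> a \<otimes>\<^bsub>Q\<^esub> inv\<^bsub>Q\<^esub> (\<iota> s)"
      using rfr p by blast
    have "q = (g \<circ> \<iota>) a \<otimes>\<^bsub>Q'\<^esub> inv\<^bsub>Q'\<^esub> ((g \<circ> \<iota>) s)"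
      using as p inv' un c\<iota> by (simp add: mu)
    then show "\<exists>a\<in>carrier A. \<exists>s\<in>?reg. q = (g \<circ> \<iota>) a \<otimes>\<^bsub>Q'\<^esub> inv\<^bsub>Q'\<^esub> ((g \<circ> \<iota>) s)"
      using as by blast
    obtain b t where bt: "b \<in> carrier A" "t \<in> ?reg" "p = inv\<^bsub>Q\<^esub> (\<iota> t) \<otimes>\<^bsub>Q\<^esub> \<iota> b"
      using lfr p by blast
    have "q = inv\<^bsub>Q'\<^esub> ((g \<circ> \<iota>) t) \<otimes>\<^bsub>Q'\<^esub> (g \<circ> \<iota>) b"
      using bt p inv' un c\<iota> by (simp add: mu)
    then show "\<exists>b\<in>carrier A. \<exists>t\<in>?reg. q = inv\<^bsub>Q'\<^esub> ((g \<circ> \<iota>) t) \<otimes>\<^bsub>Q'\<^esub> (g \<circ> \<iota>) b"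
      using bt by blast
  qed (use alg' hom' in auto)
  then show ?thesis
    unfolding classical_quotient_def
    by (intro someI[of "\<lambda>Q. \<exists>\<kappa>. is_quotient_algebra_via K A Q \<kappa>"] exI)
qed

lemma k_algebra_UP:
  assumes "field K"
  shows "k_algebra K (UP K)"
proof -
  interpret K: field K by fact
  interpret P: UP_cring K "UP K"
    by (auto intro!: UP_cring.intro K.cring_axioms)
  show ?thesis
  proof (rule k_algebraI[OF assms P.P.ring_axioms])
    fix c x y assume *: "c \<in> carrier K" "x \<in> carrier (UP K)" "y \<in> carrier (UP K)"
    have "x \<otimes>\<^bsub>UP K\<^esub> (c \<odot>\<^bsub>UP K\<^esub> y) = (c \<odot>\<^bsub>UP K\<^esub> y) \<otimes>\<^bsub>UP K\<^esub> x"
      using * by (intro P.P.m_comm) auto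
    also have "\<dots> = c \<odot>\<^bsub>UP K\<^esub> (x \<otimes>\<^bsub>UP K\<^esub> y)"
      unfolding P.UP_smult_assoc2[OF *(1,3,2)] P.P.m_comm[OF *(3,2)] ..
    finally show "x \<otimes>\<^bsub>UP K\<^esub> (c \<odot>\<^bsub>UP K\<^esub> y) = c \<odot>\<^bsub>UP K\<^esub> (x \<otimes>\<^bsub>UP K\<^esub> y)" .
  qed (auto simp: P.UP_smult_l_distr P.UP_smult_r_distr P.UP_smult_assoc1 P.UP_smult_assoc2)
qed

text \<open>
  \<open>k(X)\<close> is the field of fractions of \<open>k[X]\<close>; \<^term>\<open>UP K\<close> carries its scalar multiplication.
\<close>

abbreviation rational_functions ::
    "('k, 'c) ring_scheme \<Rightarrow> ('k, ((nat \<Rightarrow> 'k) \<times> (nat \<Rightarrow> 'k)) set) module"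
  where "rational_functions K \<equiv> classical_quotient K (UP K)"

end

(*
  Suppose R is not primitive.  By Amitsur's trick, R (x - mu) is a proper left ideal for uncountably
  many mu; put it into a maximal left ideal M(mu) and let Q(mu), the largest two-sided ideal inside
  M(mu), be the corresponding primitive ideal, which is nonzero.  A nonzero ideal of R contains an
  element c with injective left multiplication (Goldie), and counting the products c^i w with w a
  normal word of the quotient shows that the quotient has growth dimension less than 2, hence linear
  growth (Bergman's gap theorem).  A primitive algebra of linear growth over an uncountable field is
  finite-dimensional: an infinite-dimensional simple module would occur only finitely often in a
  composition series of the algebra, all chains of left ideals would have bounded length, every
  element would be algebraic, and by the periodicity of long normal words the algebra would have
  finite dimension after all.  So all R/Q(mu) are finite-dimensional, and uncountably many of them
  have dimensions bounded by the same d.  The intersection I of these Q(mu) is nonzero, since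
  otherwise R would satisfy a standard identity.  Finally x is algebraic modulo I: otherwise an ideal
  maximal among those containing I and no monic polynomial in x is a prime P with GKdim(R/P) = 1 and
  x not algebraic modulo P.  But a monic p with p(x) in I vanishes at each of the infinitely many mu.
*)

theory Submission
  imports Defs "HOL-Library.List_Lenlexorder" "HOL-Combinatorics.Permutations" "HOL-Real_Asymp.Real_Asymp"
begin

section \<open>Independence over a subset\<close>

text \<open>The bound \<open>GKdim K R < 3\<close> is converted at once into one combinatorial fact:
  some length n \<ge> 1 at which a quotient has at most n normal words. Linear growth, finiteness
  and the equality \<open>GKdim = 1\<close> all start from that number. The obstacle is that a
  primitive quotient A comes with no chain condition and no known identity; counting words replaces
  both. An infinite-dimensional cyclic section of a chain of left ideals needs a word of every
  length to itself, so at most C of them fit when each length has at most C normal words. Hence a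
  faithful simple module A/M of infinite dimension embeds A in a finite power of A/M, which leaves
  no proper left ideal of finite codimension and makes each strict step of a chain count. Chains
  generated by products of factors y - \<mu> then make y - \<mu> left invertible for all but
  finitely many \<mu>, which is the input for Amitsur's trick. A common bound d on the dimensions is
  needed because a single standard polynomial must serve all quotients. Polynomials enter mainly as
  values of monic ones, so that division by x - \<mu> and root counting take place inside R, against
  left ideals.\<close>

context k_algebra
begin

section \<open>Closure properties of spans and subspaces\<close>

lemma span_in_carrier: "S \<subseteq> carrier A \<Longrightarrow> x \<in> span S \<Longrightarrow> x \<in> carrier A"
  using span_is_subset2 by blast

lemma span_base: "S \<subseteq> carrier A \<Longrightarrow> x \<in> S \<Longrightarrow> x \<in> span S"
  using in_own_span by blast

lemma span_zero: "S \<subseteq> carrier A \<Longrightarrow> \<zero> \<in> span S"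
  using submodule.zero_closed[OF span_is_submodule] .

lemma span_add: "S \<subseteq> carrier A \<Longrightarrow> x \<in> span S \<Longrightarrow> y \<in> span S \<Longrightarrow> x \<oplus> y \<in> span S"
  using submodule.m_closed[OF span_is_submodule] .

lemma span_smult: "S \<subseteq> carrier A \<Longrightarrow> c \<in> carrier K \<Longrightarrow> x \<in> span S \<Longrightarrow> c \<odot> x \<in> span S"
  using submodule.smult_closed[OF span_is_submodule] .

lemma submoduleI:
  assumes "N \<subseteq> carrier A" "\<zero> \<in> N" "\<And>x y. x \<in> N \<Longrightarrow> y \<in> N \<Longrightarrow> x \<oplus> y \<in> N"
    "\<And>c x. c \<in> carrier K \<Longrightarrow> x \<in> N \<Longrightarrow> c \<odot> x \<in> N"
  shows "submodule K N A"
  using assms module_axioms by (auto simp: submodule_def)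

lemma smult_minus_one: "x \<in> carrier A \<Longrightarrow> (\<ominus>\<^bsub>K\<^esub> \<one>\<^bsub>K\<^esub>) \<odot> x = \<ominus> x"
  by (simp add: smult_l_minus)

lemma submodule_uminus: "submodule K N A \<Longrightarrow> x \<in> N \<Longrightarrow> \<ominus> x \<in> N"
  by (metis R.add.inv_closed R.one_closed smult_minus_one submodule.smult_closed submodule.subset subsetD)

lemma submodule_minus: "submodule K N A \<Longrightarrow> x \<in> N \<Longrightarrow> y \<in> N \<Longrightarrow> x \<ominus> y \<in> N"
  unfolding a_minus_def by (intro submodule.m_closed submodule_uminus)

lemma span_uminus: "S \<subseteq> carrier A \<Longrightarrow> x \<in> span S \<Longrightarrow> \<ominus> x \<in> span S"
  using submodule_uminus span_is_submodule by blast

lemma span_minus: "S \<subseteq> carrier A \<Longrightarrow> x \<in> span S \<Longrightarrow> y \<in> span S \<Longrightarrow> x \<ominus> y \<in> span S"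
  using submodule_minus span_is_submodule by blast

lemma submodule_finsum:
  assumes N: "submodule K N A" and "\<And>i. i \<in> F \<Longrightarrow> f i \<in> N"
  shows "(\<Oplus>i\<in>F. f i) \<in> N"
proof -
  have c: "N \<subseteq> carrier A" using N by (rule submodule.subset)
  show ?thesis using assms(2)
  proof (induction F rule: infinite_finite_induct)
    case (insert i F)
    have "(\<Oplus>i\<in>insert i F. f i) = f i \<oplus> (\<Oplus>i\<in>F. f i)"
      using insert c by (intro finsum_insert) auto
    then show ?case using insert submodule.m_closed[OF N] by auto
  qed (use submodule.zero_closed[OF N] in auto)
qed

lemma span_subset_span: "S \<subseteq> span T \<Longrightarrow> T \<subseteq> carrier A \<Longrightarrow> span S \<subseteq> span T"
  using span_is_subset span_is_submodule by blast

lemma span_eq_self: "submodule K N A \<Longrightarrow> span N = N"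
  by (meson in_own_span order_refl span_is_subset submodule.subset subset_antisym)

lemma span_induct [consumes 2, case_names base zero add smult]:
  assumes x: "x \<in> span S" and S: "S \<subseteq> carrier A"
    and "\<And>s. s \<in> S \<Longrightarrow> P s" "P \<zero>"
    and "\<And>u v. u \<in> carrier A \<Longrightarrow> v \<in> carrier A \<Longrightarrow> P u \<Longrightarrow> P v \<Longrightarrow> P (u \<oplus> v)"
    and "\<And>c u. c \<in> carrier K \<Longrightarrow> u \<in> carrier A \<Longrightarrow> P u \<Longrightarrow> P (c \<odot> u)"
  shows "P x"
proof -
  have "submodule K {u \<in> carrier A. P u} A"
    by (rule submoduleI) (use assms in auto)
  with S assms(3) have "span S \<subseteq> {u \<in> carrier A. P u}" by (intro span_is_subset) auto
  with x show ?thesis by blast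
qed

lemma submodule_vimage:
  assumes "submodule K N A" "\<And>x. x \<in> carrier A \<Longrightarrow> h x \<in> carrier A"
    "\<And>x y. x \<in> carrier A \<Longrightarrow> y \<in> carrier A \<Longrightarrow> h (x \<oplus> y) = h x \<oplus> h y"
    "\<And>c x. c \<in> carrier K \<Longrightarrow> x \<in> carrier A \<Longrightarrow> h (c \<odot> x) = c \<odot> h x"
  shows "submodule K {x \<in> carrier A. h x \<in> N} A"
proof (rule submoduleI)
  have "h \<zero> = h (\<zero>\<^bsub>K\<^esub> \<odot> \<zero>)" by simp
  also have "\<dots> = \<zero>\<^bsub>K\<^esub> \<odot> h \<zero>" by (rule assms(4)) auto
  also have "\<dots> = \<zero>" using assms(2) by simp
  finally show "\<zero> \<in> {x \<in> carrier A. h x \<in> N}"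
    using submodule.zero_closed[OF assms(1)] by simp
qed (use assms submodule.m_closed[OF assms(1)] submodule.smult_closed[OF assms(1)] in auto)

text \<open>Linearity of \<open>h\<close> is a hypothesis rather than a bundled map, so that left
  and right multiplications can be inserted directly.\<close>

lemma span_image:
  assumes "x \<in> span S" "S \<subseteq> carrier A" "\<And>x. x \<in> carrier A \<Longrightarrow> h x \<in> carrier A"
    "\<And>x y. x \<in> carrier A \<Longrightarrow> y \<in> carrier A \<Longrightarrow> h (x \<oplus> y) = h x \<oplus> h y"
    "\<And>c x. c \<in> carrier K \<Longrightarrow> x \<in> carrier A \<Longrightarrow> h (c \<odot> x) = c \<odot> h x"
    and "\<And>s. s \<in> S \<Longrightarrow> h s \<in> span T" "T \<subseteq> carrier A"
  shows "h x \<in> span T"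
proof -
  have "submodule K {x \<in> carrier A. h x \<in> span T} A"
    using assms by (intro submodule_vimage span_is_submodule) auto
  then have "span S \<subseteq> {x \<in> carrier A. h x \<in> span T}"
    using assms by (intro span_is_subset) auto
  then show ?thesis using assms(1) by auto
qed

lemma span_mult_left:
  assumes "x \<in> span S" "S \<subseteq> carrier A" "a \<in> carrier A" "\<And>s. s \<in> S \<Longrightarrow> a \<otimes> s \<in> span T" "T \<subseteq> carrier A"
  shows "a \<otimes> x \<in> span T"
  by (rule span_image[OF assms(1,2)]) (use assms in \<open>auto simp: r_distr smult_mult_right\<close>)

lemma span_mult_right:
  assumes "x \<in> span S" "S \<subseteq> carrier A" "a \<in> carrier A" "\<And>s. s \<in> S \<Longrightarrow> s \<otimes> a \<in> span T" "T \<subseteq> carrier A"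
  shows "x \<otimes> a \<in> span T"
  by (rule span_image[OF assms(1,2)]) (use assms in \<open>auto simp: l_distr smult_mult_left\<close>)

lemma submodule_plus:
  assumes M: "submodule K M A" and N: "submodule K N A"
  shows "submodule K {m \<oplus> n |m n. m \<in> M \<and> n \<in> N} A"
proof -
  have car: "M \<subseteq> carrier A" "N \<subseteq> carrier A" using M N by (auto dest: submodule.subset)
  show ?thesis
  proof (rule submoduleI)
    show "\<zero> \<in> {m \<oplus> n |m n. m \<in> M \<and> n \<in> N}"
      using submodule.zero_closed[OF M] submodule.zero_closed[OF N] by (force intro: exI[of _ \<zero>])
  next
    fix x y assume "x \<in> {m \<oplus> n |m n. m \<in> M \<and> n \<in> N}" "y \<in> {m \<oplus> n |m n. m \<in> M \<and> n \<in> N}"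
    then obtain m n m' n' where *: "m \<in> M" "n \<in> N" "m' \<in> M" "n' \<in> N" "x = m \<oplus> n" "y = m' \<oplus> n'"
      by blast
    then have "x \<oplus> y = (m \<oplus> m') \<oplus> (n \<oplus> n')"
      using car by (simp add: subset_iff a_ac)
    then show "x \<oplus> y \<in> {m \<oplus> n |m n. m \<in> M \<and> n \<in> N}"
      using * submodule.m_closed[OF M] submodule.m_closed[OF N] by blast
  next
    fix c x assume c: "c \<in> carrier K" and "x \<in> {m \<oplus> n |m n. m \<in> M \<and> n \<in> N}"
    then obtain m n where *: "m \<in> M" "n \<in> N" "x = m \<oplus> n" by blast
    then have "c \<odot> x = c \<odot> m \<oplus> c \<odot> n"
      using car c by (simp add: subset_iff smult_r_distr)
    then show "c \<odot> x \<in> {m \<oplus> n |m n. m \<in> M \<and> n \<in> N}"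
      using * c submodule.smult_closed[OF M] submodule.smult_closed[OF N] by blast
  qed (use car in auto)
qed

lemma span_UnE:
  assumes "x \<in> span (S \<union> T)" "S \<subseteq> carrier A" "T \<subseteq> carrier A"
  obtains u v where "u \<in> span S" "v \<in> span T" "x = u \<oplus> v"
proof -
  let ?N = "{m \<oplus> n |m n. m \<in> span S \<and> n \<in> span T}"
  have "submodule K ?N A"
    using assms by (intro submodule_plus span_is_submodule)
  moreover have "S \<union> T \<subseteq> ?N"
  proof
    fix s assume s: "s \<in> S \<union> T"
    have "s = s \<oplus> \<zero>" "s = \<zero> \<oplus> s" using s assms by auto
    then show "s \<in> ?N"
      using s assms span_zero[of S] span_zero[of T] span_base[of S s] span_base[of T s] by blast
  qed
  ultimately have "span (S \<union> T) \<subseteq> ?N" by (intro span_is_subset)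
  then show ?thesis using assms(1) that by blast
qed

lemma span_singletonE:
  assumes "x \<in> span {a}" "a \<in> carrier A"
  obtains c where "c \<in> carrier K" "x = c \<odot> a"
proof -
  have c: "{a} \<subseteq> carrier A" using assms(2) by simp
  have "\<exists>c\<in>carrier K. x = c \<odot> a"
    using assms(1) c
  proof (induction rule: span_induct)
    case (base s)
    then show ?case using assms(2) by (intro bexI[of _ "\<one>\<^bsub>K\<^esub>"]) auto
  next
    case zero
    show ?case using assms(2) by (intro bexI[of _ "\<zero>\<^bsub>K\<^esub>"]) auto
  next
    case (add u v)
    then obtain c d where "c \<in> carrier K" "d \<in> carrier K" "u = c \<odot> a" "v = d \<odot> a" by blast
    then show ?case using assms(2) by (intro bexI[of _ "c \<oplus>\<^bsub>K\<^esub> d"]) (auto simp: smult_l_distr)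
  next
    case (smult c u)
    then obtain d where "d \<in> carrier K" "u = d \<odot> a" by blast
    then show ?case using assms(2) smult by (intro bexI[of _ "c \<otimes>\<^bsub>K\<^esub> d"]) (auto simp: smult_assoc1)
  qed
  then show ?thesis using that by blast
qed

lemma span_insertE:
  assumes "x \<in> span (insert a S)" "S \<subseteq> carrier A" "a \<in> carrier A"
  obtains c s where "c \<in> carrier K" "s \<in> span S" "x = c \<odot> a \<oplus> s"
proof -
  have "x \<in> span ({a} \<union> S)" using assms(1) by simp
  then obtain u v where uv: "u \<in> span {a}" "v \<in> span S" "x = u \<oplus> v"
    using assms(2,3) by (elim span_UnE) auto
  obtain c where "c \<in> carrier K" "u = c \<odot> a" using span_singletonE[OF uv(1) assms(3)] .
  with uv that show ?thesis by blast
qed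

lemma smult_inverse_cancel:
  assumes "c \<in> carrier K" "c \<noteq> \<zero>\<^bsub>K\<^esub>" "x \<in> carrier A"
  shows "inv\<^bsub>K\<^esub> c \<in> carrier K" "inv\<^bsub>K\<^esub> c \<odot> (c \<odot> x) = x"
proof -
  have "c \<in> Units K" using assms by (simp add: field_Units)
  then show i: "inv\<^bsub>K\<^esub> c \<in> carrier K" by (rule R.Units_inv_closed)
  have "inv\<^bsub>K\<^esub> c \<odot> (c \<odot> x) = (inv\<^bsub>K\<^esub> c \<otimes>\<^bsub>K\<^esub> c) \<odot> x"
    using i assms by (simp add: smult_assoc1)
  also have "\<dots> = x" using \<open>c \<in> Units K\<close> assms by (simp add: R.Units_l_inv)
  finally show "inv\<^bsub>K\<^esub> c \<odot> (c \<odot> x) = x" .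
qed

text \<open>The coefficient of \<open>a\<close> in \<open>x\<close> is nonzero because
  \<open>x\<close> lies outside \<open>span S\<close>; dividing by it solves for
  \<open>a\<close>.\<close>

lemma span_exchange:
  assumes x: "x \<in> span (insert a S)" "x \<notin> span S" and S: "S \<subseteq> carrier A" and a: "a \<in> carrier A"
  shows "a \<in> span (insert x S)"
proof -
  obtain c s where cs: "c \<in> carrier K" "s \<in> span S" "x = c \<odot> a \<oplus> s"
    using span_insertE[OF x(1) S a] .
  have sc: "s \<in> carrier A" using cs S span_in_carrier by blast
  have xc: "x \<in> carrier A" using cs sc a by simp
  have c0: "c \<noteq> \<zero>\<^bsub>K\<^esub>" using cs x(2) a sc by auto
  have "x \<ominus> s = c \<odot> a" using cs sc a by (simp add: a_minus_def a_assoc r_neg)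
  then have "a = inv\<^bsub>K\<^esub> c \<odot> (x \<ominus> s)"
    using smult_inverse_cancel(2)[OF cs(1) c0 a] by simp
  moreover have "x \<ominus> s \<in> span (insert x S)"
    using S xc cs span_base[of "insert x S" x] span_is_monotone[of S "insert x S"]
    by (intro span_minus) auto
  ultimately show ?thesis
    using S xc span_smult[OF _ smult_inverse_cancel(1)[OF cs(1) c0 a]] by auto
qed

text \<open>
  Linear independence of a family modulo the span of \<open>L\<close>, in the form that is natural for families
  ordered by leading terms: it suffices to exhibit a leading member of every finite subfamily.
\<close>

definition indep_over :: "'c set \<Rightarrow> ('i \<Rightarrow> 'c) \<Rightarrow> 'i set \<Rightarrow> bool" where
  "indep_over L f I \<longleftrightarrow>
    (\<forall>J. J \<subseteq> I \<and> finite J \<and> J \<noteq> {} \<longrightarrow> (\<exists>j\<in>J. f j \<notin> span (L \<union> f ` (J - {j}))))"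

lemma indep_over_subset: "indep_over L f I \<Longrightarrow> I' \<subseteq> I \<Longrightarrow> indep_over L f I'"
  by (auto simp: indep_over_def)

text \<open>Everything happens modulo \<open>L\<close>, which may be infinite: \<open>f\<close> and
  \<open>W\<close> stand for vectors of the quotient space. The definition of
  \<open>indep_over\<close> offers one member outside the span of the others, so the induction
  removes exactly that member.\<close>

lemma steinitz_exchange:
  assumes "finite I" "finite W" "W \<subseteq> carrier A" "L \<subseteq> carrier A" "f ` I \<subseteq> span (L \<union> W)" "indep_over L f I"
  shows "\<exists>W'. W' \<subseteq> W \<and> card W' + card I = card W \<and> W \<subseteq> span (L \<union> f ` I \<union> W')"
  using assms(1,5,6)
proof (induction I rule: finite_psubset_induct)
  case (psubset I)
  show ?case
  proof (cases "I = {}")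
    case True
    then show ?thesis using assms span_base[of "L \<union> W"] by (intro exI[of _ W]) auto
  next
    case False
    then obtain j where j: "j \<in> I" "f j \<notin> span (L \<union> f ` (I - {j}))"
      using psubset.prems(2) psubset.hyps unfolding indep_over_def by blast
    let ?I = "I - {j}"
    have 1: "?I \<subset> I" using j by auto
    have 2: "f ` ?I \<subseteq> span (L \<union> W)" using psubset.prems(1) by auto
    have 3: "indep_over L f ?I" using psubset.prems(2) by (rule indep_over_subset) auto
    obtain W' where W': "W' \<subseteq> W" "card W' + card ?I = card W" "W \<subseteq> span (L \<union> f ` ?I \<union> W')"
      using psubset.IH[OF 1 2 3] by (elim exE conjE)
    let ?S = "L \<union> f ` ?I"
    have LW: "L \<union> W \<subseteq> carrier A" using assms by auto
    have fI: "f ` I \<subseteq> carrier A" using psubset.prems(1) span_is_subset2[OF LW] by auto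
    have Sc: "?S \<subseteq> carrier A" using fI assms by auto
    have SWc: "?S \<union> W' \<subseteq> carrier A" using Sc W' assms by auto
    have fj: "f j \<in> span (?S \<union> W')"
    proof -
      have "L \<union> W \<subseteq> span (?S \<union> W')" using W' span_base[OF SWc] by auto
      then have "span (L \<union> W) \<subseteq> span (?S \<union> W')" using SWc by (rule span_subset_span)
      then show ?thesis using psubset.prems(1) j by auto
    qed
    \<comment> \<open>In an inclusion-minimal \<open>T\<close> every member really occurs in
      \<open>f j\<close>, so any \<open>a\<close> in \<open>T\<close> can be exchanged for
      \<open>f j\<close>.\<close>
    define C where "C = {T. T \<subseteq> W' \<and> f j \<in> span (?S \<union> T)}"
    have "finite C" unfolding C_def using finite_subset[OF W'(1)] assms by auto
    moreover have "C \<noteq> {}" using fj by (auto simp: C_def)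
    ultimately obtain T where T: "T \<in> C" "\<And>U. U \<in> C \<Longrightarrow> U \<subseteq> T \<Longrightarrow> U = T"
      using finite_has_minimal[of C] by blast
    have "T \<noteq> {}" using T(1) j by (auto simp: C_def)
    then obtain a where a: "a \<in> T" by auto
    have n: "f j \<notin> span (?S \<union> (T - {a}))"
      using T(2)[of "T - {a}"] a T(1) by (auto simp: C_def)
    have TW: "T \<subseteq> W'" using T by (auto simp: C_def)
    have "insert a (?S \<union> (T - {a})) = ?S \<union> T" using a by auto
    then have "f j \<in> span (insert a (?S \<union> (T - {a})))" using T by (simp add: C_def)
    moreover have Tc: "?S \<union> (T - {a}) \<subseteq> carrier A" "a \<in> carrier A" using SWc TW a by auto
    ultimately have "a \<in> span (insert (f j) (?S \<union> (T - {a})))"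
      using span_exchange[OF _ n Tc] by blast
    also have "\<dots> \<subseteq> span (L \<union> f ` I \<union> (W' - {a}))"
      using TW j by (intro span_is_monotone) auto
    finally have a_in: "a \<in> span (L \<union> f ` I \<union> (W' - {a}))" .
    have c2: "L \<union> f ` I \<union> (W' - {a}) \<subseteq> carrier A" using SWc fI by auto
    have "?S \<union> W' \<subseteq> span (L \<union> f ` I \<union> (W' - {a}))"
      using span_base[OF c2] a_in by blast
    then have "span (?S \<union> W') \<subseteq> span (L \<union> f ` I \<union> (W' - {a}))"
      using c2 by (rule span_subset_span)
    with W'(3) have "W \<subseteq> span (L \<union> f ` I \<union> (W' - {a}))" by blast
    moreover have "card (W' - {a}) + card I = card W"
    proof -
      have fin: "finite W'" "a \<in> W'" using finite_subset[OF W'(1)] assms TW a by auto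
      have "card I > 0" using False psubset.hyps by (simp add: card_gt_0_iff)
      moreover have "card W' > 0" using fin by (auto simp: card_gt_0_iff)
      ultimately show ?thesis using W'(2) fin j psubset.hyps by simp
    qed
    ultimately show ?thesis using W'(1) by (intro exI[of _ "W' - {a}"]) auto
  qed
qed

lemma steinitz_card_le:
  assumes "finite W" "W \<subseteq> carrier A" "L \<subseteq> carrier A" "f ` I \<subseteq> span (L \<union> W)" "indep_over L f I"
  shows "finite I \<and> card I \<le> card W"
proof -
  have *: "card I' \<le> card W" if "I' \<subseteq> I" "finite I'" for I'
  proof -
    have "f ` I' \<subseteq> span (L \<union> W)" "indep_over L f I'"
      using that assms indep_over_subset by blast+
    then show ?thesis using steinitz_exchange[OF that(2) assms(1,2,3)] by (metis le_add2)
  qed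
  have "finite I"
  proof (rule ccontr)
    assume "infinite I"
    then obtain I' where "I' \<subseteq> I" "finite I'" "card I' = Suc (card W)"
      using infinite_arbitrarily_large by blast
    with *[of I'] show False by simp
  qed
  with * show ?thesis by blast
qed

lemma indep_over_insert:
  assumes "indep_over L f I" "f i \<notin> span (L \<union> f ` I)"
  shows "indep_over L f (insert i I)"
  unfolding indep_over_def
proof (intro allI impI, elim conjE)
  fix J assume J: "J \<subseteq> insert i I" "finite J" "J \<noteq> {}"
  show "\<exists>j\<in>J. f j \<notin> span (L \<union> f ` (J - {j}))"
  proof (cases "i \<in> J")
    case True
    have "span (L \<union> f ` (J - {i})) \<subseteq> span (L \<union> f ` I)"
      using J by (intro span_is_monotone) auto
    then show ?thesis using True assms by blast
  next
    case False
    then have "J \<subseteq> I" using J by auto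
    then show ?thesis using assms(1) J by (auto simp: indep_over_def)
  qed
qed

text \<open>Steinitz bounds the size of independent subsets, so a largest one exists, and it spans.
  Choosing \<open>X\<close> inside \<open>D\<close> matters for intersections of subspaces of finite
  codimension.\<close>

lemma maximal_indep:
  assumes D: "D \<subseteq> span (L \<union> W)" and W: "finite W" "W \<subseteq> carrier A" and L: "L \<subseteq> carrier A"
  obtains X where "finite X" "X \<subseteq> D" "indep_over L (\<lambda>x. x) X" "card X \<le> card W" "D \<subseteq> span (L \<union> X)"
proof -
  let ?P = "\<lambda>n. \<exists>X. finite X \<and> X \<subseteq> D \<and> indep_over L (\<lambda>x. x) X \<and> card X = n"
  have b: "n \<le> card W" if "?P n" for n
    using that steinitz_card_le[OF W L, of "\<lambda>x. x"] D by (metis image_ident order_trans)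
  have "?P 0" by (intro exI[of _ "{}"]) (auto simp: indep_over_def)
  then have "?P (Greatest ?P)" using b by (rule GreatestI_nat)
  then obtain X where X: "finite X" "X \<subseteq> D" "indep_over L (\<lambda>x. x) X" "card X = Greatest ?P" by blast
  have "D \<subseteq> span (L \<union> X)"
  proof
    fix d assume d: "d \<in> D"
    show "d \<in> span (L \<union> X)"
    proof (rule ccontr)
      assume n: "d \<notin> span (L \<union> X)"
      have LW: "L \<union> W \<subseteq> carrier A" using W L by auto
      have "X \<subseteq> carrier A" using X D span_is_subset2[OF LW] by auto
      then have "d \<notin> X" using n span_base[of "L \<union> X" d] L by auto
      moreover have "indep_over L (\<lambda>x. x) (insert d X)"
        using indep_over_insert[OF X(3)] n by simp
      ultimately have "?P (Suc (card X))"
        using X d by (intro exI[of _ "insert d X"]) auto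
      then have "Suc (card X) \<le> Greatest ?P" using b by (rule Greatest_le_nat)
      then show False using X by simp
    qed
  qed
  with X b that show ?thesis by metis
qed

section \<open>Comparison with the dimension of vector spaces\<close>

lemma submodule_vectorspace:
  assumes "submodule K N A" shows "vectorspace K (A\<lparr>carrier := N\<rparr>)"
proof -
  have "vectorspace K A" ..
  with assms have "VectorSpace.subspace K N A" by (simp add: VectorSpace.subspace_def)
  then show ?thesis by (rule subspace_is_vs)
qed

lemma dim_le_card:
  assumes N: "submodule K N A" and W: "finite W" "W \<subseteq> carrier A" "N \<subseteq> span W"
  shows "vectorspace.fin_dim K (A\<lparr>carrier := N\<rparr>)" "vectorspace.dim K (A\<lparr>carrier := N\<rparr>) \<le> card W"
proof -
  interpret N: vectorspace K "A\<lparr>carrier := N\<rparr>" using N by (rule submodule_vectorspace)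
  obtain X where X: "finite X" "X \<subseteq> N" "card X \<le> card W" "N \<subseteq> span X"
  proof (rule maximal_indep[of N "{}" W])
    show "N \<subseteq> span ({} \<union> W)" using W by simp
  qed (use W in simp_all)
  have "span X = N" using span_is_subset[OF X(2) N] X by auto
  then have "N.span X = N" using span_li_not_depend[OF X(2) N] by simp
  then have g: "N.gen_set X" by simp
  show "N.fin_dim" using X g by (auto simp: N.fin_dim_def)
  have "N.dim \<le> card X" using X g by (intro N.gen_ge_dim) auto
  with X show "N.dim \<le> card W" by simp
qed

text \<open>A basis of \<open>N\<close> spans \<open>N\<close>, and Steinitz applies to it as
  \<open>W\<close>; only spanning has to be translated between the two notions, never
  independence.\<close>

lemma indep_card_le_dim:
  assumes N: "submodule K N A" and fd: "vectorspace.fin_dim K (A\<lparr>carrier := N\<rparr>)"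
    and f: "f ` I \<subseteq> N" "indep_over {} f I"
  shows "finite I \<and> card I \<le> vectorspace.dim K (A\<lparr>carrier := N\<rparr>)"
proof -
  interpret N: vectorspace K "A\<lparr>carrier := N\<rparr>" using N by (rule submodule_vectorspace)
  obtain X where X: "finite X" "N.basis X" using N.finite_basis_exists[OF fd] by blast
  have XN: "X \<subseteq> N" using X by (simp add: N.basis_def)
  have "N.span X = N" using X by (simp add: N.basis_def)
  then have "span X = N" using span_li_not_depend[OF XN N] by simp
  then have "finite I \<and> card I \<le> card X"
    using X XN f submodule.subset[OF N] by (intro steinitz_card_le[where L = "{}"]) auto
  also have "card X = N.dim" using X by (simp add: N.dim_basis)
  finally show ?thesis .
qed

end

section \<open>Algebraic elements\<close>

lemma uncountable_piece:
  fixes B :: "nat \<Rightarrow> 'b set"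
  assumes "uncountable S" "S \<subseteq> (\<Union>n. B n)"
  shows "\<exists>n. uncountable (S \<inter> B n)"
proof (rule ccontr)
  assume "\<not> ?thesis"
  then have "countable (\<Union>n. S \<inter> B n)" by (intro countable_UN) auto
  moreover have "(\<Union>n. S \<inter> B n) = S" using assms(2) by blast
  ultimately show False using assms(1) by simp
qed

context k_algebra
begin

definition left_ideal :: "'c set \<Rightarrow> bool" where
  "left_ideal L \<longleftrightarrow> L \<subseteq> carrier A \<and> \<zero> \<in> L \<and> (\<forall>x\<in>L. \<forall>y\<in>L. x \<oplus> y \<in> L) \<and>
    (\<forall>a\<in>carrier A. \<forall>x\<in>L. a \<otimes> x \<in> L)"

lemma scalar_mult [simp]:
  assumes "c \<in> carrier K" "x \<in> carrier A"
  shows "(c \<odot> \<one>) \<otimes> x = c \<odot> x" "x \<otimes> (c \<odot> \<one>) = c \<odot> x"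
  using assms by (simp_all add: smult_mult_left smult_mult_right)

text \<open>Scalars act through the elements \<open>c \<odot> \<one>\<close>, so closure under left
  multiplication already gives a subspace, and with it negatives and differences.\<close>

lemma left_ideal_submodule: "left_ideal L \<Longrightarrow> submodule K L A"
proof (rule submoduleI)
  fix c x assume L: "left_ideal L" and "c \<in> carrier K" "x \<in> L"
  then have "(c \<odot> \<one>) \<otimes> x \<in> L" "x \<in> carrier A" by (auto simp: left_ideal_def)
  then show "c \<odot> x \<in> L" using \<open>c \<in> carrier K\<close> by simp
qed (auto simp: left_ideal_def)

lemma left_ideal_carrier: "left_ideal L \<Longrightarrow> x \<in> L \<Longrightarrow> x \<in> carrier A"
  by (auto simp: left_ideal_def)

lemma left_ideal_mult: "left_ideal L \<Longrightarrow> a \<in> carrier A \<Longrightarrow> x \<in> L \<Longrightarrow> a \<otimes> x \<in> L"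
  by (auto simp: left_ideal_def)

lemma left_ideal_add: "left_ideal L \<Longrightarrow> x \<in> L \<Longrightarrow> y \<in> L \<Longrightarrow> x \<oplus> y \<in> L"
  by (auto simp: left_ideal_def)

lemma left_ideal_zero: "left_ideal L \<Longrightarrow> \<zero> \<in> L"
  by (auto simp: left_ideal_def)

lemma left_ideal_smult: "left_ideal L \<Longrightarrow> c \<in> carrier K \<Longrightarrow> x \<in> L \<Longrightarrow> c \<odot> x \<in> L"
  using submodule.smult_closed[OF left_ideal_submodule] .

lemma left_ideal_minus: "left_ideal L \<Longrightarrow> x \<in> L \<Longrightarrow> y \<in> L \<Longrightarrow> x \<ominus> y \<in> L"
  using submodule_minus[OF left_ideal_submodule] .

lemma left_ideal_smultD:
  assumes "left_ideal L" "c \<in> carrier K" "c \<noteq> \<zero>\<^bsub>K\<^esub>" "x \<in> carrier A" "c \<odot> x \<in> L"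
  shows "x \<in> L"
proof -
  note i = smult_inverse_cancel[OF assms(2,3,4)]
  have "inv\<^bsub>K\<^esub> c \<odot> (c \<odot> x) \<in> L" using assms(1) i(1) assms(5) by (rule left_ideal_smult)
  then show ?thesis by (simp only: i(2))
qed

definition shift :: "'c \<Rightarrow> 'a \<Rightarrow> 'c" where "shift y \<mu> = y \<ominus> \<mu> \<odot> \<one>"

lemma shift_closed [simp]: "y \<in> carrier A \<Longrightarrow> \<mu> \<in> carrier K \<Longrightarrow> shift y \<mu> \<in> carrier A"
  by (simp add: shift_def)

lemma minus_add_self: "x \<in> carrier A \<Longrightarrow> y \<in> carrier A \<Longrightarrow> (x \<ominus> y) \<oplus> y = x"
  by (simp add: a_minus_def a_assoc l_neg)

lemma add_minus_cancel:
  assumes "x \<in> carrier A" "y \<in> carrier A"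
  shows "(x \<oplus> y) \<ominus> x = y"
proof -
  have "(x \<oplus> y) \<ominus> x = (y \<oplus> x) \<ominus> x" using assms by (simp only: a_comm)
  then show ?thesis using assms by (simp add: a_minus_def a_assoc r_neg)
qed

lemma shift_mult_right:
  assumes "y \<in> carrier A" "\<mu> \<in> carrier K" "q \<in> carrier A"
  shows "q \<otimes> shift y \<mu> = q \<otimes> y \<ominus> \<mu> \<odot> q"
  using assms by (simp add: shift_def a_minus_def r_distr r_minus)

lemma shift_mult_left:
  assumes "y \<in> carrier A" "\<mu> \<in> carrier K" "q \<in> carrier A"
  shows "shift y \<mu> \<otimes> q = y \<otimes> q \<ominus> \<mu> \<odot> q"
  using assms by (simp add: shift_def a_minus_def l_distr l_minus)

lemma mult_shift_add:
  assumes "y \<in> carrier A" "\<mu> \<in> carrier K" "q \<in> carrier A"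
  shows "q \<otimes> y = q \<otimes> shift y \<mu> \<oplus> \<mu> \<odot> q"
  using assms by (simp add: shift_mult_right minus_add_self)

text \<open>For distinct scalars the correction term is a nonzero multiple of \<open>q\<close>. This
  is the coprimality of y - \<mu> and y - \<nu> in the form used for root counting and for Amitsur's
  trick.\<close>

lemma shift_change:
  assumes "y \<in> carrier A" "\<mu> \<in> carrier K" "\<nu> \<in> carrier K" "q \<in> carrier A"
  shows "q \<otimes> shift y \<mu> = q \<otimes> shift y \<nu> \<oplus> (\<nu> \<ominus>\<^bsub>K\<^esub> \<mu>) \<odot> q"
  using assms
  by (simp add: shift_mult_right a_minus_def R.minus_eq smult_l_distr smult_l_minus a_assoc r_neg1)

lemma smult_diff_cancel:
  assumes "\<mu> \<in> carrier K" "\<nu> \<in> carrier K" "\<mu> \<noteq> \<nu>"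
  shows "\<nu> \<ominus>\<^bsub>K\<^esub> \<mu> \<in> carrier K" "\<nu> \<ominus>\<^bsub>K\<^esub> \<mu> \<noteq> \<zero>\<^bsub>K\<^esub>"
  using assms R.r_right_minus_eq by auto

section \<open>Powers and monic polynomials of a single element\<close>

definition powers :: "'c \<Rightarrow> nat \<Rightarrow> 'c set" where "powers y n = (\<lambda>i. y [^] i) ` {..<n}"

text \<open>The values at \<open>y\<close> of monic polynomials of degree n. Since only values are
  recorded, one element may belong to several degrees; \<open>\<zero>\<close> belongs to some degree
  exactly when \<open>y\<close> is algebraic.\<close>

definition monic :: "'c \<Rightarrow> nat \<Rightarrow> 'c set" where
  "monic y n = {y [^] n \<oplus> s |s. s \<in> span (powers y n)}"

text \<open>Over a field the leading coefficient can be normalised, so a relation among powers of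
  \<open>y\<close> is all that has to be recorded. For n = 0 the condition reads
  \<open>\<one> = \<zero>\<close>.\<close>

definition algebraic_over :: "'c \<Rightarrow> bool" where
  "algebraic_over y \<longleftrightarrow> (\<exists>n. y [^] n \<in> span (powers y n))"

lemma powers_closed: "y \<in> carrier A \<Longrightarrow> powers y n \<subseteq> carrier A"
  by (auto simp: powers_def)

lemma powers_mono: "m \<le> n \<Longrightarrow> powers y m \<subseteq> powers y n"
  by (auto simp: powers_def)

lemma powers_span: "y \<in> carrier A \<Longrightarrow> i < n \<Longrightarrow> y [^] (i::nat) \<in> span (powers y n)"
  by (rule span_base) (auto simp: powers_def)

lemma powers_Suc: "powers y (Suc n) = insert (y [^] n) (powers y n)"
  by (auto simp: powers_def lessThan_Suc)

lemma span_empty: "span {} = {\<zero>}"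
proof -
  have "submodule K {\<zero>} A" by (rule submoduleI) auto
  then have "span {} \<subseteq> {\<zero>}" by (intro span_is_subset) auto
  with span_zero[of "{}"] show ?thesis by auto
qed

lemma monic_0: "monic y 0 = {\<one>}"
  by (auto simp: monic_def powers_def span_empty)

lemma monic_closed: "y \<in> carrier A \<Longrightarrow> monic y n \<subseteq> carrier A"
  using span_in_carrier[OF powers_closed] by (auto simp: monic_def)

lemma monic_span: "y \<in> carrier A \<Longrightarrow> p \<in> monic y n \<Longrightarrow> p \<in> span (powers y (Suc n))"
proof -
  assume y: "y \<in> carrier A" and "p \<in> monic y n"
  then obtain s where s: "s \<in> span (powers y n)" "p = y [^] n \<oplus> s" by (auto simp: monic_def)
  have "s \<in> span (powers y (Suc n))"
    using s span_is_monotone[OF powers_mono[of n "Suc n" y]] by auto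
  then show "p \<in> span (powers y (Suc n))"
    unfolding s(2) using y powers_span[OF y, of n "Suc n"] by (intro span_add powers_closed) auto
qed

lemma power_mult_span:
  assumes "y \<in> carrier A" "s \<in> span (powers y n)"
  shows "y [^] (m::nat) \<otimes> s \<in> span (powers y (m + n))"
proof (rule span_mult_left[OF assms(2) powers_closed[OF assms(1)]])
  fix t assume "t \<in> powers y n"
  then obtain i where "i < n" "t = y [^] i" by (auto simp: powers_def)
  then show "y [^] m \<otimes> t \<in> span (powers y (m + n))"
    using assms powers_span[of y "m + i" "m + n"] by (simp add: nat_pow_mult)
qed (use assms powers_closed in auto)

lemma span_mult_power:
  assumes "y \<in> carrier A" "s \<in> span (powers y n)"
  shows "s \<otimes> y [^] (m::nat) \<in> span (powers y (n + m))"
proof (rule span_mult_right[OF assms(2) powers_closed[OF assms(1)]])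
  fix t assume "t \<in> powers y n"
  then obtain i where "i < n" "t = y [^] i" by (auto simp: powers_def)
  then show "t \<otimes> y [^] m \<in> span (powers y (n + m))"
    using assms powers_span[of y "i + m" "n + m"] by (simp add: nat_pow_mult)
qed (use assms powers_closed in auto)

lemma span_powers_mult:
  assumes y: "y \<in> carrier A" and s: "s \<in> span (powers y m)" and t: "t \<in> span (powers y n)"
  shows "s \<otimes> t \<in> span (powers y (m + n))"
proof (rule span_mult_right[OF s powers_closed[OF y]])
  fix u assume "u \<in> powers y m"
  then obtain i where "i < m" "u = y [^] i" by (auto simp: powers_def)
  then show "u \<otimes> t \<in> span (powers y (m + n))"
    using power_mult_span[OF y t, of i] span_is_monotone[OF powers_mono[of "i + n" "m + n" y]] by auto
qed (use y t powers_closed span_in_carrier[OF powers_closed[OF y] t] in auto)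

lemma monic_mult:
  assumes y: "y \<in> carrier A" and p: "p \<in> monic y m" and q: "q \<in> monic y n"
  shows "p \<otimes> q \<in> monic y (m + n)"
proof -
  obtain s t where st: "s \<in> span (powers y m)" "t \<in> span (powers y n)"
    "p = y [^] m \<oplus> s" "q = y [^] n \<oplus> t"
    using p q by (auto simp: monic_def)
  have c: "s \<in> carrier A" "t \<in> carrier A" using st y span_in_carrier powers_closed by blast+
  have "p \<otimes> q = y [^] (m + n) \<oplus> (y [^] m \<otimes> t \<oplus> (s \<otimes> y [^] n \<oplus> s \<otimes> t))"
    using st c y by (simp add: l_distr r_distr a_ac nat_pow_mult)
  moreover have "y [^] m \<otimes> t \<oplus> (s \<otimes> y [^] n \<oplus> s \<otimes> t) \<in> span (powers y (m + n))"
    using st y by (intro span_add power_mult_span span_mult_power span_powers_mult powers_closed)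
  ultimately show ?thesis by (auto simp: monic_def)
qed

lemma algebraic_over_iff_monic:
  assumes y: "y \<in> carrier A"
  shows "algebraic_over y \<longleftrightarrow> (\<exists>n. \<zero> \<in> monic y n)"
proof -
  have "y [^] n \<in> span (powers y n) \<longleftrightarrow> \<zero> \<in> monic y n" for n :: nat
  proof
    assume "y [^] n \<in> span (powers y n)"
    then have "\<ominus> (y [^] n) \<in> span (powers y n)" using y by (intro span_uminus powers_closed)
    moreover have "\<zero> = y [^] n \<oplus> \<ominus> (y [^] n)" using y by (simp add: r_neg)
    ultimately show "\<zero> \<in> monic y n" by (auto simp: monic_def)
  next
    assume "\<zero> \<in> monic y n"
    then obtain s where s: "s \<in> span (powers y n)" "\<zero> = y [^] n \<oplus> s" by (auto simp: monic_def)
    have "s \<in> carrier A" using s y span_in_carrier powers_closed by blast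
    then have "y [^] n = \<ominus> s" using s(2) y by (metis minus_equality nat_pow_closed)
    then show "y [^] n \<in> span (powers y n)" using span_uminus[OF powers_closed[OF y] s(1)] by simp
  qed
  then show ?thesis by (simp add: algebraic_over_def)
qed

text \<open>Division with remainder by y - \<mu>, carried out on values. The quotient stays monic,
  which the root count needs, and the factor y - \<mu> stands on the right, where a left ideal
  absorbs it.\<close>

lemma power_div_shift:
  assumes y: "y \<in> carrier A" and \<mu>: "\<mu> \<in> carrier K"
  shows "\<exists>q\<in>monic y n. \<exists>c\<in>carrier K. y [^] Suc n = q \<otimes> shift y \<mu> \<oplus> c \<odot> \<one>"
proof (induction n)
  case 0
  show ?case
    using y \<mu> mult_shift_add[of y \<mu> \<one>] by (intro bexI[of _ \<one>] bexI[of _ \<mu>]) (auto simp: monic_0)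
next
  case (Suc n)
  then obtain q c where q: "q \<in> monic y n" "c \<in> carrier K" "y [^] Suc n = q \<otimes> shift y \<mu> \<oplus> c \<odot> \<one>"
    by blast
  have qc: "q \<in> carrier A" using q y monic_closed by blast
  have "y [^] Suc (Suc n) = y \<otimes> y [^] Suc n" using y by (rule nat_pow_Suc2)
  also have "\<dots> = (y \<otimes> q) \<otimes> shift y \<mu> \<oplus> c \<odot> y"
    using q qc y \<mu> by (simp add: r_distr m_assoc del: nat_pow_Suc)
  \<comment> \<open>The old remainder times \<open>y\<close> is divided once more, using y = (y -
    \<mu>) + \<mu>.\<close>
  also have "c \<odot> y = c \<odot> (shift y \<mu> \<oplus> \<mu> \<odot> \<one>)"
    using mult_shift_add[of y \<mu> \<one>] y \<mu> by simp
  also have "(y \<otimes> q) \<otimes> shift y \<mu> \<oplus> \<dots> = (y \<otimes> q \<oplus> c \<odot> \<one>) \<otimes> shift y \<mu> \<oplus> (c \<otimes>\<^bsub>K\<^esub> \<mu>) \<odot> \<one>"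
    using q qc y \<mu> by (simp add: l_distr smult_r_distr smult_assoc1 a_assoc)
  finally have eq: "y [^] Suc (Suc n) = \<dots>" .
  have "y \<otimes> q \<in> monic y (Suc n)"
  proof -
    have "y \<in> monic y 1" using y span_zero[OF powers_closed[OF y]] by (force simp: monic_def)
    then show ?thesis using monic_mult[OF y _ q(1), of y 1] by simp
  qed
  then obtain s where s: "s \<in> span (powers y (Suc n))" "y \<otimes> q = y [^] Suc n \<oplus> s"
    by (auto simp: monic_def)
  have "s \<in> carrier A" using s y span_in_carrier powers_closed by blast
  then have "y \<otimes> q \<oplus> c \<odot> \<one> = y [^] Suc n \<oplus> (s \<oplus> c \<odot> \<one>)"
    unfolding s(2) using y q by (intro a_assoc nat_pow_closed smult_closed one_closed)
  moreover have "s \<oplus> c \<odot> \<one> \<in> span (powers y (Suc n))"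
    using s y q powers_span[OF y, of 0 "Suc n"] by (intro span_add span_smult powers_closed) auto
  ultimately have "y \<otimes> q \<oplus> c \<odot> \<one> \<in> monic y (Suc n)" by (auto simp: monic_def)
  then show ?case using eq q \<mu> by blast
qed

lemma span_div_shift:
  assumes y: "y \<in> carrier A" and \<mu>: "\<mu> \<in> carrier K" and p: "p \<in> span (powers y (Suc n))"
  shows "\<exists>q\<in>span (powers y n). \<exists>c\<in>carrier K. p = q \<otimes> shift y \<mu> \<oplus> c \<odot> \<one>"
  using p powers_closed[OF y]
proof (induction rule: span_induct)
  case (base s)
  then obtain i where i: "i \<le> n" "s = y [^] i" by (auto simp: powers_def less_Suc_eq_le)
  show ?case
  proof (cases i)
    case 0
    then show ?thesis
      using i y \<mu> by (intro bexI[of _ \<zero>] bexI[of _ "\<one>\<^bsub>K\<^esub>"]) (auto simp: span_zero powers_closed)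
  next
    case (Suc j)
    then have "monic y j \<subseteq> span (powers y n)"
      using monic_span[OF y] span_is_monotone[OF powers_mono[of "Suc j" n y]] i by auto
    then show ?thesis using power_div_shift[OF y \<mu>, of j] i Suc by blast
  qed
next
  case zero
  show ?case
    using y \<mu> by (intro bexI[of _ \<zero>] bexI[of _ "\<zero>\<^bsub>K\<^esub>"]) (auto simp: span_zero powers_closed)
next
  case (add u v)
  then obtain q c q' c' where *: "q \<in> span (powers y n)" "c \<in> carrier K" "u = q \<otimes> shift y \<mu> \<oplus> c \<odot> \<one>"
    "q' \<in> span (powers y n)" "c' \<in> carrier K" "v = q' \<otimes> shift y \<mu> \<oplus> c' \<odot> \<one>" by blast
  have "q \<in> carrier A" "q' \<in> carrier A" using * y span_in_carrier powers_closed by blast+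
  then have "u \<oplus> v = (q \<oplus> q') \<otimes> shift y \<mu> \<oplus> (c \<oplus>\<^bsub>K\<^esub> c') \<odot> \<one>"
    using * y \<mu> by (simp add: l_distr smult_l_distr a_ac)
  moreover have "q \<oplus> q' \<in> span (powers y n)" using * y by (intro span_add powers_closed)
  ultimately show ?case using * by blast
next
  case (smult c u)
  then obtain q d where *: "q \<in> span (powers y n)" "d \<in> carrier K" "u = q \<otimes> shift y \<mu> \<oplus> d \<odot> \<one>"
    by blast
  have "q \<in> carrier A" using * y span_in_carrier powers_closed by blast+
  then have "c \<odot> u = (c \<odot> q) \<otimes> shift y \<mu> \<oplus> (c \<otimes>\<^bsub>K\<^esub> d) \<odot> \<one>"
    using * y \<mu> smult by (simp add: smult_r_distr smult_mult_left smult_assoc1)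
  moreover have "c \<odot> q \<in> span (powers y n)" using * y smult by (intro span_smult powers_closed)
  ultimately show ?case using * smult by blast
qed

lemma monic_div_shift:
  assumes y: "y \<in> carrier A" and \<mu>: "\<mu> \<in> carrier K" and p: "p \<in> monic y (Suc n)"
  obtains q c where "q \<in> monic y n" "c \<in> carrier K" "p = q \<otimes> shift y \<mu> \<oplus> c \<odot> \<one>"
proof -
  obtain s where s: "s \<in> span (powers y (Suc n))" "p = y [^] Suc n \<oplus> s"
    using p by (auto simp: monic_def)
  obtain q c where q: "q \<in> span (powers y n)" "c \<in> carrier K" "s = q \<otimes> shift y \<mu> \<oplus> c \<odot> \<one>"
    using span_div_shift[OF y \<mu> s(1)] by blast
  obtain q' c' where q': "q' \<in> monic y n" "c' \<in> carrier K" "y [^] Suc n = q' \<otimes> shift y \<mu> \<oplus> c' \<odot> \<one>"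
    using power_div_shift[OF y \<mu>] by blast
  obtain t where t: "t \<in> span (powers y n)" "q' = y [^] n \<oplus> t" using q' by (auto simp: monic_def)
  have c: "q \<in> carrier A" "q' \<in> carrier A" "t \<in> carrier A"
    using q q' t y span_in_carrier powers_closed monic_closed by blast+
  have "p = (q' \<oplus> q) \<otimes> shift y \<mu> \<oplus> (c' \<oplus>\<^bsub>K\<^esub> c) \<odot> \<one>"
    unfolding s(2) q(3) q'(3) using q q' c y \<mu> by (simp add: l_distr smult_l_distr a_ac)
  moreover have "q' \<oplus> q = y [^] n \<oplus> (t \<oplus> q)" using t c y by (simp add: a_assoc)
  then have "q' \<oplus> q \<in> monic y n"
    unfolding monic_def using t q span_add[OF powers_closed[OF y]] by blast
  ultimately show ?thesis using that q q' by blast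
qed

text \<open>Modulo \<open>M \<mu>\<close> every \<open>q \<otimes> y\<close> is congruent to
  \<open>\<mu> \<odot> q\<close>, so a polynomial in \<open>y\<close> is congruent to its scalar
  value at \<mu>. Membership of \<open>p\<close> in the proper left ideal \<open>M \<mu>\<close>
  thus makes \<mu> a root, although \<open>M \<mu>\<close> need not be two-sided.\<close>

lemma monic_roots_le:
  assumes y: "y \<in> carrier A"
  shows "\<lbrakk>p \<in> monic y n; finite F; F \<subseteq> carrier K;
      \<And>\<mu>. \<mu> \<in> F \<Longrightarrow> left_ideal (M \<mu>) \<and> \<one> \<notin> M \<mu> \<and> shift y \<mu> \<in> M \<mu> \<and> p \<in> M \<mu>\<rbrakk> \<Longrightarrow> card F \<le> n"
proof (induction n arbitrary: p F)
  case 0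
  then have "p = \<one>" by (simp add: monic_0)
  then have "F = {}" using "0.prems"(4) by blast
  then show ?case by simp
next
  case (Suc n)
  show ?case
  proof (cases "F = {}")
    case False
    then obtain \<mu> where \<mu>: "\<mu> \<in> F" by blast
    then have \<mu>K: "\<mu> \<in> carrier K" using Suc.prems by blast
    obtain q c where q: "q \<in> monic y n" "c \<in> carrier K" "p = q \<otimes> shift y \<mu> \<oplus> c \<odot> \<one>"
      using monic_div_shift[OF y \<mu>K Suc.prems(1)] .
    have qc: "q \<in> carrier A" using q y monic_closed by blast
    note M = Suc.prems(4)
    \<comment> \<open>The remainder lies in \<open>M \<mu>\<close> together with \<open>p\<close>; a
      nonzero scalar there would bring \<open>\<one>\<close> along.\<close>
    have "c = \<zero>\<^bsub>K\<^esub>"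
    proof (rule ccontr)
      assume c0: "c \<noteq> \<zero>\<^bsub>K\<^esub>"
      have li: "left_ideal (M \<mu>)" using M[OF \<mu>] by simp
      have "q \<otimes> shift y \<mu> \<in> M \<mu>" using M[OF \<mu>] qc by (intro left_ideal_mult) auto
      then have "p \<ominus> q \<otimes> shift y \<mu> \<in> M \<mu>" using M[OF \<mu>] by (intro left_ideal_minus) auto
      also have "p \<ominus> q \<otimes> shift y \<mu> = c \<odot> \<one>"
        using q qc y \<mu>K by (simp add: a_minus_def a_ac r_neg)
      finally have "\<one> \<in> M \<mu>" using left_ideal_smultD[OF li q(2) c0] by simp
      then show False using M[OF \<mu>] by simp
    qed
    then have p: "p = q \<otimes> shift y \<mu>" using q qc y \<mu>K by simp
    have "card (F - {\<mu>}) \<le> n"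
    proof (rule Suc.IH[OF q(1)])
      fix \<nu> assume \<nu>: "\<nu> \<in> F - {\<mu>}"
      then have \<nu>K: "\<nu> \<in> carrier K" and ne: "\<mu> \<noteq> \<nu>" and \<nu>F: "\<nu> \<in> F" using Suc.prems by auto
      have li: "left_ideal (M \<nu>)" using M[OF \<nu>F] by simp
      have in1: "q \<otimes> shift y \<nu> \<in> M \<nu>" using M[OF \<nu>F] qc by (intro left_ideal_mult) auto
      \<comment> \<open>At another point \<nu> the factor y - \<mu> is congruent to the nonzero
        scalar \<nu> - \<mu>, so it is the quotient \<open>q\<close> that vanishes there.\<close>
      have "p \<ominus> q \<otimes> shift y \<nu> \<in> M \<nu>" using M[OF \<nu>F] in1 by (intro left_ideal_minus) auto
      also have "p \<ominus> q \<otimes> shift y \<nu> = (\<nu> \<ominus>\<^bsub>K\<^esub> \<mu>) \<odot> q"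
        unfolding p shift_change[OF y \<mu>K \<nu>K qc]
        using smult_diff_cancel[OF \<mu>K \<nu>K ne] y \<nu>K qc by (intro add_minus_cancel) auto
      finally have "q \<in> M \<nu>"
        using left_ideal_smultD[OF li smult_diff_cancel[OF \<mu>K \<nu>K ne] qc] by simp
      then show "left_ideal (M \<nu>) \<and> \<one> \<notin> M \<nu> \<and> shift y \<nu> \<in> M \<nu> \<and> q \<in> M \<nu>"
        using M[OF \<nu>F] by simp
    qed (use Suc.prems in auto)
    then show ?thesis using \<mu> Suc.prems by simp
  qed simp
qed

section \<open>Amitsur's trick\<close>

text \<open>
  Uncountably many left inverses of elements \<open>y - \<mu>\<close> in an algebra of countable dimension are
  linearly dependent; clearing denominators in a dependency makes \<open>y\<close> algebraic.
\<close>

definition shift_prod :: "'c \<Rightarrow> 'a list \<Rightarrow> 'c" where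
  "shift_prod y \<mu>s = foldr (\<lambda>\<mu> r. shift y \<mu> \<otimes> r) \<mu>s \<one>"

definition kpoly :: "'c \<Rightarrow> 'c set" where "kpoly y = span (range (\<lambda>i::nat. y [^] i))"

lemma kpoly_submodule: "y \<in> carrier A \<Longrightarrow> submodule K (kpoly y) A"
  unfolding kpoly_def by (rule span_is_submodule) auto

lemma kpoly_closed: "y \<in> carrier A \<Longrightarrow> p \<in> kpoly y \<Longrightarrow> p \<in> carrier A"
  using kpoly_submodule submodule.subset by blast

lemma kpoly_one: "y \<in> carrier A \<Longrightarrow> \<one> \<in> kpoly y"
  unfolding kpoly_def by (rule span_base) (auto intro: image_eqI[of _ _ "0::nat"])

lemma kpoly_smult: "y \<in> carrier A \<Longrightarrow> c \<in> carrier K \<Longrightarrow> p \<in> kpoly y \<Longrightarrow> c \<odot> p \<in> kpoly y"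
  using submodule.smult_closed[OF kpoly_submodule] .

lemma kpoly_minus: "y \<in> carrier A \<Longrightarrow> p \<in> kpoly y \<Longrightarrow> q \<in> kpoly y \<Longrightarrow> p \<ominus> q \<in> kpoly y"
  using submodule_minus[OF kpoly_submodule] .

lemma kpoly_commute:
  assumes y: "y \<in> carrier A" and p: "p \<in> kpoly y"
  shows "p \<otimes> y = y \<otimes> p"
proof -
  have c: "range (\<lambda>i::nat. y [^] i) \<subseteq> carrier A" using y by auto
  show ?thesis using p[unfolded kpoly_def] c
  proof (induction rule: span_induct)
    case (base s)
    then obtain i :: nat where "s = y [^] i" by auto
    then show ?case using y nat_pow_Suc2[of y i] by simp
  qed (use y in \<open>auto simp: l_distr r_distr smult_mult_left smult_mult_right\<close>)
qed

lemma kpoly_mult_right: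
  assumes y: "y \<in> carrier A" and p: "p \<in> kpoly y"
  shows "p \<otimes> y \<in> kpoly y"
  unfolding kpoly_def
proof (rule span_mult_right[OF p[unfolded kpoly_def] _ y])
  fix s assume "s \<in> range (\<lambda>i::nat. y [^] i)"
  then obtain i :: nat where "s = y [^] i" by auto
  then have "s \<otimes> y = y [^] Suc i" by simp
  then have "s \<otimes> y \<in> range (\<lambda>i::nat. y [^] i)" by (rule range_eqI)
  then show "s \<otimes> y \<in> span (range (\<lambda>i::nat. y [^] i))" using y by (intro span_base) auto
qed (use y in auto)

lemma kpoly_shift:
  assumes y: "y \<in> carrier A" and p: "p \<in> kpoly y" and \<mu>: "\<mu> \<in> carrier K"
  shows "p \<otimes> shift y \<mu> \<in> kpoly y" "shift y \<mu> \<otimes> p = p \<otimes> shift y \<mu>"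
proof -
  have "p \<otimes> y \<ominus> \<mu> \<odot> p \<in> kpoly y"
    using assms by (intro kpoly_minus kpoly_mult_right kpoly_smult)
  then show "p \<otimes> shift y \<mu> \<in> kpoly y" "shift y \<mu> \<otimes> p = p \<otimes> shift y \<mu>"
    using assms kpoly_closed[OF y p] kpoly_commute[OF y p]
    by (simp_all add: shift_mult_left shift_mult_right)
qed

lemma shift_prod_kpoly:
  assumes y: "y \<in> carrier A"
  shows "set \<mu>s \<subseteq> carrier K \<Longrightarrow> shift_prod y \<mu>s \<in> kpoly y"
  by (induction \<mu>s) (use y in \<open>auto simp: shift_prod_def kpoly_one kpoly_shift\<close>)

lemma shift_prod_Cons: "shift_prod y (\<mu> # \<mu>s) = shift y \<mu> \<otimes> shift_prod y \<mu>s"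
  by (simp add: shift_prod_def)

lemma shift_prod_factor:
  assumes y: "y \<in> carrier A"
  shows "set \<mu>s \<subseteq> carrier K \<Longrightarrow> \<mu> \<in> set \<mu>s \<Longrightarrow> \<exists>p\<in>kpoly y. shift_prod y \<mu>s = shift y \<mu> \<otimes> p"
proof (induction \<mu>s)
  case (Cons \<nu> \<mu>s)
  show ?case
  proof (cases "\<mu> = \<nu>")
    case True
    then show ?thesis using shift_prod_kpoly[OF y] Cons.prems by (auto simp: shift_prod_Cons)
  next
    case False
    then obtain p where p: "p \<in> kpoly y" "shift_prod y \<mu>s = shift y \<mu> \<otimes> p" using Cons by auto
    have K: "\<nu> \<in> carrier K" "\<mu> \<in> carrier K" using Cons.prems by auto
    have pc: "p \<in> carrier A" using kpoly_closed[OF y p(1)] .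
    have 1: "p \<otimes> shift y \<nu> \<in> kpoly y" using kpoly_shift[OF y p(1) K(1)] by simp
    have "shift_prod y (\<nu> # \<mu>s) = shift y \<nu> \<otimes> (p \<otimes> shift y \<mu>)"
      using kpoly_shift(2)[OF y p(1) K(2)] by (simp add: shift_prod_Cons p(2))
    also have "\<dots> = shift y \<nu> \<otimes> p \<otimes> shift y \<mu>" using K y pc by (simp add: m_assoc)
    also have "\<dots> = p \<otimes> shift y \<nu> \<otimes> shift y \<mu>" using kpoly_shift(2)[OF y p(1) K(1)] by simp
    also have "\<dots> = shift y \<mu> \<otimes> (p \<otimes> shift y \<nu>)" using kpoly_shift(2)[OF y 1 K(2)] by simp
    finally show ?thesis using 1 by blast
  qed
qed simp

text \<open>Coprimality: \<mu> is not among the factors, so they can be cancelled one after another.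
  Each cancellation only subtracts an element of k[y] and rescales, hence the cofactor never leaves
  \<open>N\<close>. Taking N = k[y] leads to algebraicity, taking the whole algebra leads to left
  inverses.\<close>

lemma shift_prod_cancel:
  assumes y: "y \<in> carrier A" and \<mu>: "\<mu> \<in> carrier K" and N: "submodule K N A" "kpoly y \<subseteq> N"
  shows "\<lbrakk>set \<mu>s \<subseteq> carrier K; \<mu> \<notin> set \<mu>s; q \<in> N; shift_prod y \<mu>s = q \<otimes> shift y \<mu>\<rbrakk>
    \<Longrightarrow> \<exists>q\<in>N. \<one> = q \<otimes> shift y \<mu>"
proof (induction \<mu>s arbitrary: q)
  case Nil
  then show ?case by (auto simp: shift_prod_def)
next
  case (Cons \<nu> \<mu>s)
  let ?P = "shift_prod y \<mu>s"
  have \<nu>: "\<nu> \<in> carrier K" and ne: "\<nu> \<noteq> \<mu>" and sub: "set \<mu>s \<subseteq> carrier K" using Cons.prems by auto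
  have P: "?P \<in> kpoly y" using shift_prod_kpoly[OF y sub] .
  have Pc: "?P \<in> carrier A" using kpoly_closed[OF y P] .
  have qc: "q \<in> carrier A" using Cons.prems(3) submodule.subset[OF N(1)] by blast
  \<comment> \<open>The first factor is split as y - \<nu> = (y - \<mu>) + (\<mu> - \<nu>), which
    isolates a nonzero multiple of the shorter product.\<close>
  have "?P \<otimes> shift y \<mu> \<oplus> (\<mu> \<ominus>\<^bsub>K\<^esub> \<nu>) \<odot> ?P = q \<otimes> shift y \<mu>"
    using Cons.prems(4) shift_change[OF y \<nu> \<mu> Pc] kpoly_shift(2)[OF y P \<nu>]
    by (simp add: shift_prod_Cons)
  then have "(\<mu> \<ominus>\<^bsub>K\<^esub> \<nu>) \<odot> ?P = q \<otimes> shift y \<mu> \<ominus> ?P \<otimes> shift y \<mu>"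
    using y \<mu> \<nu> Pc qc
    by (metis R.minus_closed add.inv_solve_right' a_comm a_minus_def m_closed shift_closed smult_closed)
  then have eq: "(\<mu> \<ominus>\<^bsub>K\<^esub> \<nu>) \<odot> ?P = (q \<ominus> ?P) \<otimes> shift y \<mu>"
    using y \<mu> Pc qc by (simp add: a_minus_def l_distr l_minus)
  define d where "d = inv\<^bsub>K\<^esub> (\<mu> \<ominus>\<^bsub>K\<^esub> \<nu>)"
  have d: "d \<in> carrier K" "d \<odot> ((\<mu> \<ominus>\<^bsub>K\<^esub> \<nu>) \<odot> ?P) = ?P"
    unfolding d_def using smult_inverse_cancel[OF smult_diff_cancel[OF \<nu> \<mu> ne] Pc] by auto
  have "?P = (d \<odot> (q \<ominus> ?P)) \<otimes> shift y \<mu>"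
    using d eq y \<mu> Pc qc by (simp add: smult_mult_left)
  moreover have "q \<ominus> ?P \<in> N" using submodule_minus[OF N(1) Cons.prems(3)] P N(2) by blast
  then have "d \<odot> (q \<ominus> ?P) \<in> N" by (rule submodule.smult_closed[OF N(1) d(1)])
  ultimately show ?case using Cons.IH[OF sub] Cons.prems(2) by simp
qed

lemma kpoly_powers:
  assumes y: "y \<in> carrier A" and p: "p \<in> kpoly y"
  shows "\<exists>n. p \<in> span (powers y n)"
proof -
  have c: "range (\<lambda>i::nat. y [^] i) \<subseteq> carrier A" using y by auto
  show ?thesis using p[unfolded kpoly_def] c
  proof (induction rule: span_induct)
    case (base s)
    then obtain i :: nat where "s = y [^] i" by auto
    then show ?case using powers_span[OF y, of i "Suc i"] by auto
  next
    case zero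
    then show ?case using span_zero powers_closed[OF y] by blast
  next
    case (add u v)
    then obtain m n where "u \<in> span (powers y m)" "v \<in> span (powers y n)" by blast
    then have "u \<oplus> v \<in> span (powers y (max m n))"
      using span_is_monotone[OF powers_mono[of m "max m n" y]] span_is_monotone[OF powers_mono[of n "max m n" y]]
      by (intro span_add powers_closed y) auto
    then show ?case by blast
  next
    case (smult c u)
    then show ?case using span_smult powers_closed[OF y] by blast
  qed
qed

text \<open>The leading term of q times y - \<mu> has nothing to cancel against except a relation
  among the powers of \<open>y\<close>. Choosing the least n for \<open>q\<close> guarantees a
  nonzero leading coefficient.\<close>

lemma shift_inverse_algebraic:
  assumes y: "y \<in> carrier A" and \<mu>: "\<mu> \<in> carrier K" and q: "q \<in> kpoly y" "\<one> = q \<otimes> shift y \<mu>"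
  shows "algebraic_over y"
proof -
  define n where "n = (LEAST n. q \<in> span (powers y n))"
  have n: "q \<in> span (powers y n)" unfolding n_def using kpoly_powers[OF y q(1)] by (rule LeastI_ex)
  have min: "q \<notin> span (powers y m)" if "m < n" for m
    using that not_less_Least unfolding n_def by blast
  show ?thesis
  proof (cases n)
    case 0
    then have "q = \<zero>" using n by (simp add: powers_def span_empty)
    then have "\<one> = \<zero>" using q y \<mu> by simp
    then have "y [^] (0::nat) \<in> span (powers y 0)" by (simp add: powers_def span_empty)
    then show ?thesis unfolding algebraic_over_def by blast
  next
    case (Suc m)
    have pc: "powers y m \<subseteq> carrier A" "y [^] m \<in> carrier A" using y powers_closed by auto
    obtain c s where cs: "c \<in> carrier K" "s \<in> span (powers y m)" "q = c \<odot> y [^] m \<oplus> s"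
      using span_insertE[of q "y [^] m" "powers y m"] n Suc pc by (auto simp: powers_Suc)
    have sc: "s \<in> carrier A" and qc: "q \<in> carrier A" using cs pc span_in_carrier by auto
    have "c \<noteq> \<zero>\<^bsub>K\<^esub>" using min[of m] cs sc pc Suc by auto
    have "\<one> = (c \<odot> y [^] Suc m \<oplus> s \<otimes> y) \<ominus> \<mu> \<odot> q"
      unfolding q(2) shift_mult_right[OF y \<mu> qc]
      unfolding cs(3) using cs sc pc y by (simp add: l_distr smult_mult_left)
    then have "\<one> \<oplus> \<mu> \<odot> q = c \<odot> y [^] Suc m \<oplus> s \<otimes> y"
      using minus_add_self[of "c \<odot> y [^] Suc m \<oplus> s \<otimes> y" "\<mu> \<odot> q"] cs sc y \<mu> qc by simp
    then have "(\<one> \<oplus> \<mu> \<odot> q) \<ominus> s \<otimes> y = c \<odot> y [^] Suc m"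
      using cs sc y by (simp add: a_minus_def a_assoc r_neg)
    moreover have "(\<one> \<oplus> \<mu> \<odot> q) \<ominus> s \<otimes> y \<in> span (powers y (Suc m))"
      using powers_span[OF y, of 0 "Suc m"] n Suc \<mu> y span_mult_power[OF y cs(2), of 1]
      by (intro span_minus span_add span_smult powers_closed) auto
    ultimately have "c \<odot> y [^] Suc m \<in> span (powers y (Suc m))" by simp
    moreover note i = smult_inverse_cancel[OF cs(1) \<open>c \<noteq> \<zero>\<^bsub>K\<^esub>\<close> nat_pow_closed[OF y, of "Suc m"]]
    ultimately have "inv\<^bsub>K\<^esub> c \<odot> (c \<odot> y [^] Suc m) \<in> span (powers y (Suc m))"
      using span_smult[OF powers_closed[OF y]] by blast
    then have "y [^] Suc m \<in> span (powers y (Suc m))" by (simp only: i(2))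
    then show ?thesis unfolding algebraic_over_def by blast
  qed
qed

text \<open>Multiplication by the product P of all y - \<nu> with \<nu> in \<open>F\<close> turns
  each \<open>b \<nu>\<close> into P with one factor removed, so the dependency puts
  \<open>b \<mu> \<otimes> P\<close> into k[y]. Since the factors commute, P equals this element
  times y - \<mu>, and cancelling P leaves an inverse of y - \<mu> inside k[y].\<close>

lemma amitsur_dependent:
  assumes y: "y \<in> carrier A" and F: "finite F" "F \<subseteq> carrier K" and \<mu>: "\<mu> \<in> carrier K" "\<mu> \<notin> F"
    and b: "\<And>\<nu>. \<nu> \<in> insert \<mu> F \<Longrightarrow> b \<nu> \<in> carrier A \<and> b \<nu> \<otimes> shift y \<nu> = \<one>"
    and dep: "b \<mu> \<in> span (b ` F)"
  shows "algebraic_over y"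
proof -
  obtain \<mu>s where \<mu>s: "set \<mu>s = F" using F finite_list by blast
  have sub: "set \<mu>s \<subseteq> carrier K" using \<mu>s F by simp
  let ?P = "shift_prod y \<mu>s"
  have P: "?P \<in> kpoly y" using shift_prod_kpoly[OF y sub] .
  have Pc: "?P \<in> carrier A" using kpoly_closed[OF y P] .
  have "b \<mu> \<otimes> ?P \<in> kpoly y" unfolding kpoly_def
  proof (rule span_mult_right[OF dep])
    fix s assume "s \<in> b ` F"
    then obtain \<nu> where \<nu>: "\<nu> \<in> F" "s = b \<nu>" by blast
    then obtain p where p: "p \<in> kpoly y" "?P = shift y \<nu> \<otimes> p"
      using shift_prod_factor[OF y sub] \<mu>s by blast
    have "s \<otimes> ?P = (b \<nu> \<otimes> shift y \<nu>) \<otimes> p"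
      using p \<nu> b[of \<nu>] F y kpoly_closed[OF y p(1)] by (subst m_assoc) auto
    also have "\<dots> = p" using b[of \<nu>] \<nu> kpoly_closed[OF y p(1)] by simp
    finally show "s \<otimes> ?P \<in> span (range (\<lambda>i::nat. y [^] i))" using p by (simp add: kpoly_def)
  qed (use b Pc y in auto)
  moreover have "?P = (b \<mu> \<otimes> ?P) \<otimes> shift y \<mu>"
  proof -
    have "(b \<mu> \<otimes> ?P) \<otimes> shift y \<mu> = b \<mu> \<otimes> (?P \<otimes> shift y \<mu>)"
      using b[of \<mu>] Pc y \<mu> by (simp add: m_assoc)
    also have "\<dots> = b \<mu> \<otimes> (shift y \<mu> \<otimes> ?P)" using kpoly_shift(2)[OF y P \<mu>(1)] by simp
    also have "\<dots> = (b \<mu> \<otimes> shift y \<mu>) \<otimes> ?P" using b[of \<mu>] Pc y \<mu> by (intro m_assoc[symmetric]) auto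
    also have "\<dots> = ?P" using b[of \<mu>] Pc by simp
    finally show ?thesis by simp
  qed
  ultimately obtain q where "q \<in> kpoly y" "\<one> = q \<otimes> shift y \<mu>"
    using shift_prod_cancel[OF y \<mu>(1) kpoly_submodule[OF y] order_refl sub] \<mu> \<mu>s by blast
  then show ?thesis using shift_inverse_algebraic[OF y \<mu>(1)] by blast
qed

theorem amitsur:
  assumes y: "y \<in> carrier A" and W: "\<And>n::nat. finite (W n)" "\<And>n. W n \<subseteq> carrier A"
    and gen: "carrier A \<subseteq> (\<Union>n. span (W n))"
    and unc: "uncountable {\<mu> \<in> carrier K. \<exists>b\<in>carrier A. b \<otimes> shift y \<mu> = \<one>}"
  shows "algebraic_over y"
proof -
  let ?S = "{\<mu> \<in> carrier K. \<exists>b\<in>carrier A. b \<otimes> shift y \<mu> = \<one>}"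
  obtain b where b: "b \<mu> \<in> carrier A" "b \<mu> \<otimes> shift y \<mu> = \<one>" if "\<mu> \<in> ?S" for \<mu>
    by (rule that[of "\<lambda>\<mu>. SOME b. b \<in> carrier A \<and> b \<otimes> shift y \<mu> = \<one>"])
      (simp_all, (smt (verit, ccfv_SIG) someI_ex)+)
  have "?S \<subseteq> (\<Union>n. {\<mu>. b \<mu> \<in> span (W n)})" using b(1) gen by blast
  then have "\<exists>n. uncountable (?S \<inter> {\<mu>. b \<mu> \<in> span (W n)})"
    by (rule uncountable_piece[OF unc])
  then obtain n where "uncountable (?S \<inter> {\<mu>. b \<mu> \<in> span (W n)})" (is "uncountable ?T")
    by (rule exE)
  \<comment> \<open>Uncountability has trapped infinitely many left inverses in the span of a single
    finite \<open>W n\<close>.\<close>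
  then have inf: "infinite ?T" by (meson countable_finite)
  have sub: "b ` ?T \<subseteq> span ({} \<union> W n)" by auto
  have "\<not> indep_over {} b ?T"
    using inf by (rule contrapos_nn) (use steinitz_card_le[OF W(1) W(2) empty_subsetI sub] in simp)
  then obtain J where J: "J \<subseteq> ?T" "finite J" "J \<noteq> {}" "\<forall>j\<in>J. b j \<in> span (b ` (J - {j}))"
    by (auto simp: indep_over_def)
  then obtain \<mu> where \<mu>: "\<mu> \<in> J" by blast
  show ?thesis
  proof (rule amitsur_dependent[OF y, of "J - {\<mu>}" \<mu> b])
    show "b \<nu> \<in> carrier A \<and> b \<nu> \<otimes> shift y \<nu> = \<one>" if "\<nu> \<in> insert \<mu> (J - {\<mu>})" for \<nu>
    proof -
      have "\<nu> \<in> ?S" using that J(1) \<mu> by blast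
      with b show ?thesis by blast
    qed
    show "b \<mu> \<in> span (b ` (J - {\<mu>}))" using J \<mu> by blast
  qed (use J \<mu> in auto)
qed

end

section \<open>Normal words\<close>

text \<open>Words are ordered by length first and then lexicographically. Compatibility with
  concatenation on both sides is what makes factors of normal words normal.\<close>

lemma list_less_append:
  fixes xs ys zs :: "nat list"
  assumes "xs < ys"
  shows "zs @ xs < zs @ ys" "xs @ zs < ys @ zs"
proof -
  have "irrefl {(u, v :: nat). u < v}" by (auto simp: irrefl_def)
  then show "zs @ xs < zs @ ys" using assms by (simp add: list_less_def lenlex_append2)
  show "xs @ zs < ys @ zs" using assms by (simp add: list_less_def lenlex_append1)
qed

lemma list_less_length: "length xs < length ys \<Longrightarrow> xs < (ys :: nat list)"
  by (simp add: list_less_def lenlex_conv)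

text \<open>
  The numbers of windows of lengths \<open>0, \<dots>, n\<close> cannot increase strictly from \<open>1\<close> to at most \<open>n\<close>,
  so for some \<open>j < n\<close> each window of length \<open>j\<close> determines the letter that follows it; hence the
  word is periodic from its second repeated window on.
\<close>

lemma repetition_of_few_windows:
  fixes w :: "nat list"
  assumes n: "n \<ge> 1" and len: "2 * n \<le> length w"
    and few: "card ((\<lambda>p. take n (drop p w)) ` {..length w - n}) \<le> n"
  obtains u v t i where "w = u @ concat (replicate i v) @ t" "length u \<le> n" "length v \<le> n" "v \<noteq> []"
    "length t \<le> 2 * n"
proof -
  \<comment> \<open>\<open>m\<close> is the last position at which a full window of length n
    fits.\<close>
  define m where "m = length w - n"
  have m: "n \<le> m" "length w = m + n" using len by (auto simp: m_def)
  define win where "win j p = take j (drop p w)" for j p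
  define F where "F j = win j ` {..m}" for j
  have finF: "finite (F j)" for j by (simp add: F_def)
  have Fim: "F j = take j ` F (Suc j)" for j
    by (auto simp: F_def win_def image_image min_def)
  have mono1: "card (F j) \<le> card (F (Suc j))" for j
    using Fim card_image_le finF by metis
  have mono: "card (F j) \<le> card (F n)" if "j \<le> n" for j
    using that by (induction rule: inc_induct) (use mono1 le_trans in blast)+
  have Fn: "card (F n) \<le> n" using few by (simp add: F_def win_def m_def)
  have "\<exists>j<n. card (F (Suc j)) \<le> card (F j)"
  proof (rule ccontr)
    assume "\<not> ?thesis"
    then have lt: "card (F j) < card (F (Suc j))" if "j < n" for j using that by (simp add: not_le)
    have "Suc j \<le> card (F j)" if "j \<le> n" for j
      using that
    proof (induction j)
      case 0
      have "F 0 \<noteq> {}" by (simp add: F_def)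
      then show ?case using finF[of 0] by (simp add: card_gt_0_iff Suc_le_eq)
    next
      case (Suc j)
      then show ?case using lt[of j] by simp
    qed
    from this[of n] Fn show False by simp
  qed
  then obtain j where j: "j < n" "card (F (Suc j)) \<le> card (F j)" by blast
  have inj: "inj_on (take j) (F (Suc j))"
    using j(2) Fim[of j] finF mono1[of j] by (intro eq_card_imp_inj_on) auto
  have det: "win (Suc j) p = win (Suc j) q" if "p \<le> m" "q \<le> m" "win j p = win j q" for p q
  proof (rule inj_onD[OF inj])
    show "take j (win (Suc j) p) = take j (win (Suc j) q)"
      using that(3) by (simp add: win_def min_def)
  qed (use that in \<open>auto simp: F_def\<close>)
  \<comment> \<open>There are n + 1 starting positions and at most n windows, so two positions share
    a window.\<close>
  have "card (win j ` {..n}) < card {..n}"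
  proof -
    have "card (win j ` {..n}) \<le> card (F j)"
      using m by (intro card_mono) (auto simp: F_def)
    then show ?thesis using mono[of j] j Fn by simp
  qed
  then have "\<not> inj_on (win j) {..n}" by (rule pigeonhole)
  then obtain a' b' where ab': "a' \<le> n" "b' \<le> n" "a' \<noteq> b'" "win j a' = win j b'"
    by (auto simp: inj_on_def)
  obtain a b where ab: "a < b" "b \<le> n" "win j a = win j b"
    by (cases "a' < b'") (use ab' that[of a' b'] that[of b' a'] in auto)
  \<comment> \<open>Dropping the first letter of equal windows of length j + 1 leaves equal windows
    of length j one position further on; \<open>det\<close> extends these by a letter again.\<close>
  have same: "win (Suc j) (a + q) = win (Suc j) (b + q)" if "b + q \<le> m" for q
    using that
  proof (induction q)
    case 0
    then show ?case using det[of a b] ab by simp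
  next
    case (Suc q)
    then have "win (Suc j) (a + q) = win (Suc j) (b + q)" by simp
    then have "tl (win (Suc j) (a + q)) = tl (win (Suc j) (b + q))" by simp
    then have "win j (a + Suc q) = win j (b + Suc q)"
      by (simp add: win_def tl_take tl_drop drop_Suc)
    then show ?case using det[of "a + Suc q" "b + Suc q"] Suc.prems ab by simp
  qed
  define d where "d = b - a"
  have d: "d \<ge> 1" "d \<le> n" "b = a + d" using ab by (auto simp: d_def)
  have per1: "w ! (a + q) = w ! (a + q + d)" if "a + q + d \<le> m" for q
  proof -
    have "hd (win (Suc j) (a + q)) = hd (win (Suc j) (b + q))" using same[of q] that d by simp
    then show ?thesis
      using that m n d by (simp add: win_def hd_drop_conv_nth add.assoc add.commute add.left_commute)
  qed
  have per: "w ! (a + i * d + r) = w ! (a + r)" if "a + i * d + r \<le> m" for i r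
    using that
  proof (induction i)
    case (Suc i)
    have "w ! (a + (i * d + r)) = w ! (a + (i * d + r) + d)" using Suc.prems by (intro per1) simp
    then show ?case using Suc by (simp add: algebra_simps)
  qed simp
  define v where "v = take d (drop a w)"
  have lv: "length v = d" using m d ab by (simp add: v_def)
  have rep: "take (i * d) (drop a w) = concat (replicate i v)" if "a + i * d \<le> m + 1" for i
    using that
  proof (induction i)
    case (Suc i)
    have "take d (drop (a + i * d) w) = v"
    proof (rule nth_equalityI)
      show "length (take d (drop (a + i * d) w)) = length v" using lv Suc.prems m n by simp
      fix r assume "r < length (take d (drop (a + i * d) w))"
      then have "r < d" by simp
      then show "take d (drop (a + i * d) w) ! r = v ! r"
        using per[of i r] Suc.prems m n d ab by (simp add: v_def)
    qed
    moreover have "Suc i * d = i * d + d" by simp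
    then have "take (Suc i * d) (drop a w) = take (i * d) (drop a w) @ take d (drop (a + i * d) w)"
      by (simp only: take_add drop_drop add.commute[of a])
    moreover have "concat (replicate (Suc i) v) = concat (replicate i v) @ v"
      using replicate_append_same[of i v] by (metis concat.simps(2) concat_append append_Nil2 concat.simps(1) replicate_Suc)
    ultimately show ?case using Suc by simp
  qed simp
  \<comment> \<open>As many full periods as fit up to position m + 1. Less than one period and the
    last n - 1 letters remain, whence the bound on the tail.\<close>
  define i where "i = (m + 1 - a) div d"
  have id: "a + i * d \<le> m + 1" using ab m by (simp add: i_def) (metis add_le_mono1 diff_le_mono le_add_diff_inverse div_times_less_eq_dividend le_trans less_imp_le_nat add.commute le_SucI nat_add_left_cancel_le le_diff_conv2)
  have lt: "m + 1 < a + i * d + d"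
  proof -
    have "m + 1 - a < i * d + d" using d dividend_less_div_times[of d "m + 1 - a"] by (simp add: i_def)
    then show ?thesis by simp
  qed
  have "w = take a w @ take (i * d) (drop a w) @ drop (a + i * d) w"
    by (metis append_take_drop_id drop_drop add.commute)
  then have "w = take a w @ concat (replicate i v) @ drop (a + i * d) w" using rep[OF id] by simp
  moreover have "length (drop (a + i * d) w) \<le> 2 * n" using lt m d by simp
  moreover have "length (take a w) \<le> n" using ab by simp
  moreover have "length v \<le> n" "v \<noteq> []" using lv d by auto
  ultimately show ?thesis using that by blast
qed

context k_algebra
begin

lemma word_value_closed: "range \<sigma> \<subseteq> carrier A \<Longrightarrow> word_value A \<sigma> w \<in> carrier A"
  by (induction w) (auto simp: word_value_def)

lemma word_value_append:
  "range \<sigma> \<subseteq> carrier A \<Longrightarrow> word_value A \<sigma> (u @ v) = word_value A \<sigma> u \<otimes> word_value A \<sigma> v"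
proof (induction u)
  case (Cons i u)
  have "word_value A \<sigma> u \<in> carrier A" "word_value A \<sigma> v \<in> carrier A" "\<sigma> i \<in> carrier A"
    using Cons.prems word_value_closed by auto
  then show ?case using Cons by (simp add: word_value_def m_assoc)
qed (use word_value_closed in \<open>auto simp: word_value_def\<close>)

end

text \<open>Letters form a total sequence of which the first \<open>g\<close> generate. This is the
  shape of substitution used for polynomial identities, so \<open>word_value\<close> serves both
  purposes.\<close>

locale generated_algebra = k_algebra K A
  for K :: "('k, 'd) ring_scheme" and A :: "('k, 'a, 'm) module_scheme" (structure) +
  fixes \<sigma> :: "nat \<Rightarrow> 'a" and g :: nat
  assumes letters: "range \<sigma> \<subseteq> carrier A"
    and generated: "carrier A \<subseteq> span (word_value A \<sigma> ` lists {..<g})"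
begin

abbreviation wv :: "nat list \<Rightarrow> 'a" where "wv \<equiv> word_value A \<sigma>"

abbreviation wds :: "nat list set" where "wds \<equiv> lists {..<g}"

lemma wv_Nil [simp]: "wv [] = \<one>"
  by (simp add: word_value_def)

lemma wv_Cons [simp]: "wv (i # w) = \<sigma> i \<otimes> wv w"
  by (simp add: word_value_def)

lemma \<sigma>_closed [simp]: "\<sigma> i \<in> carrier A"
  using letters by auto

lemma wv_closed [simp]: "wv w \<in> carrier A"
  by (rule word_value_closed[OF letters])

lemma wv_image_closed [simp]: "wv ` X \<subseteq> carrier A"
  by auto

lemma wv_append: "wv (u @ v) = wv u \<otimes> wv v"
  by (rule word_value_append[OF letters])

lemma wv_replicate: "wv (concat (replicate i v)) = wv v [^] i"
proof (induction i)
  case (Suc i)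
  then show ?case unfolding nat_pow_Suc2[OF wv_closed] by (simp add: wv_append)
qed simp

text \<open>The words that are not the leading word of any relation. Normality belongs to the word
  and not to its value, which allows arguments about factors and periods.\<close>

definition normal :: "nat list \<Rightarrow> bool" where
  "normal w \<longleftrightarrow> w \<in> wds \<and> wv w \<notin> span (wv ` {u \<in> wds. u < w})"

lemma normal_wds: "normal w \<Longrightarrow> w \<in> wds"
  by (simp add: normal_def)

text \<open>A relation that rewrites \<open>u\<close> through smaller words can be multiplied by
  \<open>a\<close> and \<open>b\<close> on the two sides, and every word in it stays below the
  leading one.\<close>

lemma normal_factor:
  assumes "normal (a @ u @ b)"
  shows "normal u"
proof (rule ccontr)
  assume n: "\<not> normal u"
  have w: "a \<in> wds" "u \<in> wds" "b \<in> wds" using assms by (auto simp: normal_def)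
  with n have "wv u \<in> span (wv ` {v \<in> wds. v < u})" by (simp add: normal_def)
  then have 1: "wv u \<otimes> wv b \<in> span (wv ` {v \<in> wds. v < u @ b})"
  proof (rule span_mult_right)
    fix s assume "s \<in> wv ` {v \<in> wds. v < u}"
    then obtain v where v: "v \<in> wds" "v < u" "s = wv v" by auto
    have "v @ b \<in> {v \<in> wds. v < u @ b}" using v w by (auto simp: list_less_append)
    then have "wv (v @ b) \<in> wv ` {v \<in> wds. v < u @ b}" by (rule imageI)
    then show "s \<otimes> wv b \<in> span (wv ` {v \<in> wds. v < u @ b})"
      using v by (intro span_base) (auto simp: wv_append)
  qed auto
  have "wv a \<otimes> (wv u \<otimes> wv b) \<in> span (wv ` {v \<in> wds. v < a @ u @ b})"
  proof (rule span_mult_left[OF 1])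
    fix s assume "s \<in> wv ` {v \<in> wds. v < u @ b}"
    then obtain v where v: "v \<in> wds" "v < u @ b" "s = wv v" by auto
    have "a @ v \<in> {v \<in> wds. v < a @ u @ b}" using v w by (auto simp: list_less_append)
    then have "wv (a @ v) \<in> wv ` {v \<in> wds. v < a @ u @ b}" by (rule imageI)
    then show "wv a \<otimes> s \<in> span (wv ` {v \<in> wds. v < a @ u @ b})"
      using v by (intro span_base) (auto simp: wv_append)
  qed auto
  then show False using assms by (simp add: normal_def wv_append)
qed

text \<open>The order on words is well-founded, so rewriting by smaller words terminates; as it
  never lengthens a word, the length bound of the next lemma is inherited.\<close>

lemma normal_span: "w \<in> wds \<Longrightarrow> wv w \<in> span (wv ` {u. normal u \<and> u \<le> w})"
proof (induction w rule: less_induct)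
  case (less w)
  show ?case
  proof (cases "normal w")
    case True
    then show ?thesis by (intro span_base) auto
  next
    case False
    then have "wv w \<in> span (wv ` {u \<in> wds. u < w})" using less.prems by (simp add: normal_def)
    also have "\<dots> \<subseteq> span (wv ` {u. normal u \<and> u \<le> w})"
    proof (rule span_subset_span)
      show "wv ` {u \<in> wds. u < w} \<subseteq> span (wv ` {u. normal u \<and> u \<le> w})"
      proof
        fix s assume "s \<in> wv ` {u \<in> wds. u < w}"
        then obtain u where u: "u \<in> wds" "u < w" "s = wv u" by auto
        have "span (wv ` {v. normal v \<and> v \<le> u}) \<subseteq> span (wv ` {v. normal v \<and> v \<le> w})"
          using u by (intro span_is_monotone image_mono) auto
        then show "s \<in> span (wv ` {u. normal u \<and> u \<le> w})" using less.IH[OF u(2,1)] u(3) by auto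
      qed
    qed simp
    finally show ?thesis .
  qed
qed

lemma normal_span_length: 
  assumes "w \<in> wds"
  shows "wv w \<in> span (wv ` {u. normal u \<and> length u \<le> length w})"
proof -
  have "span (wv ` {u. normal u \<and> u \<le> w}) \<subseteq> span (wv ` {u. normal u \<and> length u \<le> length w})"
    by (intro span_is_monotone image_mono) (use list_less_length leD not_le in blast)
  then show ?thesis using normal_span[OF assms] by auto
qed

lemma carrier_normal_span: "carrier A = span (wv ` {u. normal u})"
proof
  have "wv ` wds \<subseteq> span (wv ` {u. normal u})"
  proof
    fix s assume "s \<in> wv ` wds"
    then obtain w where w: "w \<in> wds" "s = wv w" by auto
    have "span (wv ` {u. normal u \<and> u \<le> w}) \<subseteq> span (wv ` {u. normal u})"
      by (intro span_is_monotone) auto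
    then show "s \<in> span (wv ` {u. normal u})" using normal_span w by auto
  qed
  then have "span (wv ` wds) \<subseteq> span (wv ` {u. normal u})" by (rule span_subset_span) simp
  then show "carrier A \<subseteq> span (wv ` {u. normal u})" using generated by blast
qed (intro span_is_subset2 wv_image_closed)

lemma normal_indep: "indep_over {} wv {w. normal w}"
  unfolding indep_over_def
proof (intro allI impI, elim conjE)
  fix J :: "nat list set" assume J: "J \<subseteq> {w. normal w}" "finite J" "J \<noteq> {}"
  then have M: "Max J \<in> J" by (intro Max_in)
  then have N: "normal (Max J)" using J by blast
  have "span ({} \<union> wv ` (J - {Max J})) \<subseteq> span (wv ` {u \<in> wds. u < Max J})"
    using J normal_wds by (intro span_is_monotone) (auto simp: order.strict_iff_order)
  moreover have "wv (Max J) \<notin> span (wv ` {u \<in> wds. u < Max J})" using N by (simp add: normal_def)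
  ultimately show "\<exists>j\<in>J. wv j \<notin> span ({} \<union> wv ` (J - {j}))" using M by blast
qed

lemma finite_words_length: "finite {w \<in> wds. length w \<le> n}"
  using finite_lists_length_le[of "{..<g}" n] by (simp add: lists_eq_set)

lemma finite_normal_length_le: "finite {w. normal w \<and> length w \<le> n}"
  by (rule finite_subset[OF _ finite_words_length[of n]]) (auto simp: normal_def)

lemma finite_normal_length: "finite {w. normal w \<and> length w = n}"
  by (rule finite_subset[OF _ finite_words_length[of n]]) (auto simp: normal_def)

text \<open>All windows of length n of a normal word are themselves normal, hence there are at most
  n of them and the word is periodic up to short ends.\<close>

lemma normal_shape:
  assumes n: "n \<ge> 1" and few: "card {w. normal w \<and> length w = n} \<le> n" and w: "normal w"
  obtains u v t i where "w = u @ concat (replicate i v) @ t" "u \<in> wds" "v \<in> wds" "t \<in> wds"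
    "length u \<le> 2 * n" "length v \<le> 2 * n" "length t \<le> 2 * n" "v = [] \<longrightarrow> i = 0"
proof (cases "2 * n \<le> length w")
  case True
  have "(\<lambda>p. take n (drop p w)) ` {..length w - n} \<subseteq> {w. normal w \<and> length w = n}"
  proof
    fix x assume "x \<in> (\<lambda>p. take n (drop p w)) ` {..length w - n}"
    then obtain p where p: "p \<le> length w - n" "x = take n (drop p w)" by auto
    have "w = take p w @ x @ drop n (drop p w)" unfolding p(2) by (simp only: append_take_drop_id)
    then have "normal x" using w normal_factor by metis
    then show "x \<in> {w. normal w \<and> length w = n}" using p True n by auto
  qed
  then have "card ((\<lambda>p. take n (drop p w)) ` {..length w - n}) \<le> n"
    using card_mono[OF finite_normal_length] few by (meson le_trans)
  then obtain u v t i where d: "w = u @ concat (replicate i v) @ t" "length u \<le> n" "length v \<le> n" "v \<noteq> []"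
    "length t \<le> 2 * n"
    by (rule repetition_of_few_windows[OF n True])
  have ww: "w \<in> wds" using w by (rule normal_wds)
  show ?thesis
  proof (cases i)
    case 0
    \<comment> \<open>With no repetition present, the letters of \<open>v\<close> are not visible in
      \<open>w\<close>; the empty word is a safe replacement.\<close>
    then show ?thesis using that[of u 0 "[]" t] d ww by auto
  next
    case (Suc k)
    then have "v \<in> wds" using d ww by auto
    then show ?thesis using that[of u i v t] d ww by auto
  qed
next
  case False
  then show ?thesis using that[of w 0 "[]" "[]"] normal_wds[OF w] by auto
qed

text \<open>A normal word is recovered from its length and the triple (u, v, t): the length
  determines the exponent, and exponent 0 for empty v removes the remaining ambiguity. The number of
  such triples does not depend on m and is the bound.\<close>

lemma normal_bounded:
  assumes n: "n \<ge> 1" and few: "card {w. normal w \<and> length w = n} \<le> n"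
  shows "\<exists>C. \<forall>m. card {w. normal w \<and> length w = m} \<le> C"
proof (intro exI allI)
  fix m
  let ?S = "{w \<in> wds. length w \<le> 2 * n}"
  let ?N = "{w. normal w \<and> length w = m}"
  let ?P = "\<lambda>w x. \<exists>i. w = fst x @ concat (replicate i (fst (snd x))) @ snd (snd x) \<and>
      (fst (snd x) = [] \<longrightarrow> i = 0)"
  have "\<exists>x\<in>?S \<times> ?S \<times> ?S. ?P w x" if w: "w \<in> ?N" for w
  proof -
    have "normal w" using w by simp
    then obtain u v t i where d: "w = u @ concat (replicate i v) @ t" "u \<in> wds" "v \<in> wds" "t \<in> wds"
      "length u \<le> 2 * n" "length v \<le> 2 * n" "length t \<le> 2 * n" "v = [] \<longrightarrow> i = 0"
      by (rule normal_shape[OF n few])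
    show ?thesis by (rule bexI[of _ "(u, v, t)"]) (use d in auto)
  qed
  then have "\<forall>w\<in>?N. \<exists>x. x \<in> ?S \<times> ?S \<times> ?S \<and> ?P w x" by blast
  then obtain f where "\<forall>w\<in>?N. f w \<in> ?S \<times> ?S \<times> ?S \<and> ?P w (f w)" by (rule bchoice[THEN exE])
  then have f: "f w \<in> ?S \<times> ?S \<times> ?S \<and> ?P w (f w)" if "w \<in> ?N" for w using that by (rule bspec)
  have "inj_on f ?N"
  proof (rule inj_onI)
    fix w w' assume w: "w \<in> ?N" "w' \<in> ?N" "f w = f w'"
    obtain u v t where uvt: "f w = (u, v, t)" by (cases "f w") auto
    obtain i where i: "w = u @ concat (replicate i v) @ t" "v = [] \<longrightarrow> i = 0" using f[OF w(1)] uvt by auto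
    obtain k where k: "w' = u @ concat (replicate k v) @ t" "v = [] \<longrightarrow> k = 0" using f[OF w(2)] uvt w(3) by auto
    have "length w = length w'" using w by simp
    then have "i * length v = k * length v" using i k by (simp add: length_concat sum_list_replicate)
    then have "i = k" using i k by auto
    then show "w = w'" using i k by simp
  qed
  moreover have "f ` ?N \<subseteq> ?S \<times> ?S \<times> ?S" using f by blast
  moreover have "finite (?S \<times> ?S \<times> ?S)" by (intro finite_cartesian_product finite_words_length)
  ultimately show "card ?N \<le> card (?S \<times> ?S \<times> ?S)" by (rule card_inj_on_le)
qed

text \<open>If the value of v satisfies a monic equation of degree e, its power with exponent e is a
  combination of shorter words, so no normal word contains v repeated e times. This bounds the
  exponent in the periodic shape.\<close>

lemma normal_finite_of_algebraic:
  assumes n: "n \<ge> 1" and few: "card {w. normal w \<and> length w = n} \<le> n"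
    and alg: "\<And>y. y \<in> carrier A \<Longrightarrow> algebraic_over y"
  shows "finite {w. normal w}"
proof -
  let ?S = "{w \<in> wds. length w \<le> 2 * n}"
  have "\<exists>e::nat. wv v [^] e \<in> span (powers (wv v) e)" for v
    using alg[of "wv v"] by (simp add: algebraic_over_def)
  then obtain e :: "nat list \<Rightarrow> nat" where e: "wv v [^] e v \<in> span (powers (wv v) (e v))" for v by metis
  have bound: "i < e v" if "normal (u @ concat (replicate i v) @ t)" "v \<in> wds" "v \<noteq> []" for u v t i
  proof (rule ccontr)
    assume "\<not> i < e v"
    then have "replicate i v = replicate (e v) v @ replicate (i - e v) v"
      by (simp flip: replicate_add)
    then have "u @ concat (replicate i v) @ t
        = u @ concat (replicate (e v) v) @ (concat (replicate (i - e v) v) @ t)" by simp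
    then have "normal (concat (replicate (e v) v))" using that(1) normal_factor by metis
    then have nn: "wv v [^] e v \<notin> span (wv ` {u \<in> wds. u < concat (replicate (e v) v)})"
      by (simp add: normal_def wv_replicate)
    have "powers (wv v) (e v) \<subseteq> wv ` {u \<in> wds. u < concat (replicate (e v) v)}"
    proof
      fix s assume "s \<in> powers (wv v) (e v)"
      then obtain j where j: "j < e v" "s = wv v [^] j" by (auto simp: powers_def)
      have "concat (replicate j v) \<in> {u \<in> wds. u < concat (replicate (e v) v)}"
        using j that by (auto intro!: list_less_length simp: length_concat sum_list_replicate)
      then have "wv (concat (replicate j v)) \<in> wv ` {u \<in> wds. u < concat (replicate (e v) v)}"
        by (rule imageI)
      then show "s \<in> wv ` {u \<in> wds. u < concat (replicate (e v) v)}" using j by (simp add: wv_replicate)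
    qed
    then have "span (powers (wv v) (e v)) \<subseteq> span (wv ` {u \<in> wds. u < concat (replicate (e v) v)})"
      by (rule span_is_monotone)
    then show False using e nn by blast
  qed
  \<comment> \<open>Only finitely many periods of length at most 2 n exist, so the degrees of their
    equations have a common bound.\<close>
  define E where "E = Max (insert 0 (e ` ?S))"
  have E: "e v \<le> E" if "v \<in> ?S" for v
    unfolding E_def using that finite_words_length by (intro Max_ge) auto
  have "{w. normal w} \<subseteq> {w \<in> wds. length w \<le> 4 * n + E * (2 * n)}"
  proof
    fix w assume "w \<in> {w. normal w}"
    then have w: "normal w" by simp
    obtain u v t i where d: "w = u @ concat (replicate i v) @ t" "u \<in> wds" "v \<in> wds" "t \<in> wds"
      "length u \<le> 2 * n" "length v \<le> 2 * n" "length t \<le> 2 * n" "v = [] \<longrightarrow> i = 0"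
      by (rule normal_shape[OF n few w])
    have "i \<le> E"
    proof (cases "v = []")
      case False
      then have "i < e v" using bound w d by blast
      also have "e v \<le> E" using d by (intro E) auto
      finally show ?thesis by simp
    qed (use d in simp)
    then have "i * length v \<le> E * (2 * n)" using d by (intro mult_le_mono)
    then show "w \<in> {w \<in> wds. length w \<le> 4 * n + E * (2 * n)}"
      using d normal_wds[OF w] by (simp add: length_concat sum_list_replicate)
  qed
  then show ?thesis using finite_words_length by (rule finite_subset)
qed

end

section \<open>Growth\<close>

lemma limsup_log_le_1:
  fixes f :: "nat \<Rightarrow> nat"
  assumes "\<And>n. f n \<le> D * n + D"
  shows "limsup (\<lambda>n. ereal (log (real n) (real (f n)))) \<le> 1"
proof -
  \<comment> \<open>\<open>D + 1\<close> keeps the linear bound at least 1, and its logarithm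
    nonnegative, even for D = 0.\<close>
  define E where "E = real D + 1"
  have E: "E > 0" by (simp add: E_def)
  have "((\<lambda>n. log (real n) (E * real n + E)) \<longlongrightarrow> 1) sequentially"
    using E by real_asymp
  then have "((\<lambda>n. ereal (log (real n) (E * real n + E))) \<longlongrightarrow> ereal 1) sequentially"
    by simp
  then have lim: "limsup (\<lambda>n. ereal (log (real n) (E * real n + E))) = 1"
    by (simp add: lim_imp_Limsup one_ereal_def)
  have "limsup (\<lambda>n. ereal (log (real n) (real (f n)))) \<le> limsup (\<lambda>n. ereal (log (real n) (E * real n + E)))"
  proof (rule Limsup_mono)
    show "\<forall>\<^sub>F n in sequentially. ereal (log (real n) (real (f n))) \<le> ereal (log (real n) (E * real n + E))"
      using eventually_ge_at_top[of 2]
    proof eventually_elim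
      case (elim n)
      have "real (f n) \<le> real (D * n + D)" using assms[of n] by (simp only: of_nat_le_iff)
      also have "\<dots> \<le> E * real n + E" by (simp add: E_def algebra_simps)
      finally have le: "real (f n) \<le> E * real n + E" .
      have ge1: "1 \<le> E * real n + E" by (simp add: E_def algebra_simps)
      show ?case
      proof (cases "f n = 0")
        case True
        \<comment> \<open>By convention the logarithm of 0 is 0.\<close>
        then have "log (real n) (real (f n)) = 0" by (simp add: log_def)
        also have "0 \<le> log (real n) (E * real n + E)" using elim ge1 by simp
        finally show ?thesis by simp
      next
        case False
        then show ?thesis using elim le by (simp add: log_le_cancel_iff)
      qed
    qed
  qed
  with lim show ?thesis by simp
qed

lemma limsup_log_ge_1:
  fixes f :: "nat \<Rightarrow> nat"
  assumes "\<And>n. n \<le> f n"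
  shows "1 \<le> limsup (\<lambda>n. ereal (log (real n) (real (f n))))"
proof (rule le_Limsup)
  show "\<forall>\<^sub>F n in sequentially. 1 \<le> ereal (log (real n) (real (f n)))"
    using eventually_ge_at_top[of 2]
  proof eventually_elim
    case (elim n)
    have "log (real n) (real n) \<le> log (real n) (real (f n))"
      using elim assms[of n] by (subst log_le_cancel_iff) auto
    then show ?case using elim by (simp add: one_ereal_def)
  qed
qed simp

text \<open>The cubic bound is available only at even arguments and with factor 1/2. Neither changes
  the exponent: a limsup along a subsequence is a lower bound, and constants vanish after division
  by the logarithm of n.\<close>

lemma limsup_log_ge_3:
  fixes f :: "nat \<Rightarrow> nat"
  assumes "\<And>n. n ^ 3 \<le> 2 * f (2 * n)"
  shows "3 \<le> limsup (\<lambda>n. ereal (log (real n) (real (f n))))"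
proof -
  let ?X = "\<lambda>n. ereal (log (real n) (real (f n)))"
  have "((\<lambda>n. log (real (2 * n)) (real n ^ 3 / 2)) \<longlongrightarrow> 3) sequentially"
    by real_asymp
  then have "((\<lambda>n. ereal (log (real (2 * n)) (real n ^ 3 / 2))) \<longlongrightarrow> ereal 3) sequentially"
    by simp
  then have lim: "limsup (\<lambda>n. ereal (log (real (2 * n)) (real n ^ 3 / 2))) = 3"
    by (simp add: lim_imp_Limsup)
  have "limsup (\<lambda>n. ereal (log (real (2 * n)) (real n ^ 3 / 2))) \<le> limsup (?X \<circ> (\<lambda>n. 2 * n))"
  proof (rule Limsup_mono)
    show "\<forall>\<^sub>F n in sequentially. ereal (log (real (2 * n)) (real n ^ 3 / 2)) \<le> (?X \<circ> (\<lambda>n. 2 * n)) n"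
      using eventually_ge_at_top[of 2]
    proof eventually_elim
      case (elim n)
      have "real (n ^ 3) \<le> real (2 * f (2 * n))" using assms[of n] by (simp only: of_nat_le_iff)
      then have "real n ^ 3 / 2 \<le> real (f (2 * n))" by simp
      moreover have "0 < real n ^ 3 / 2" using elim by simp
      moreover from calculation have "0 < real (f (2 * n))" by linarith
      ultimately have "log (real (2 * n)) (real n ^ 3 / 2) \<le> log (real (2 * n)) (real (f (2 * n)))"
        using elim by (subst log_le_cancel_iff) auto
      then show ?case by simp
    qed
  qed
  also have "\<dots> \<le> limsup ?X" by (rule limsup_subseq_mono) (simp add: strict_mono_def)
  finally show ?thesis using lim by simp
qed

context k_algebra
begin

lemma space_power_carrier: "V \<subseteq> carrier A \<Longrightarrow> space_power K A V n \<subseteq> carrier A"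
proof (induction n)
  case (Suc n)
  then have "space_power K A V n <#> V \<subseteq> carrier A" by (auto simp: set_mult_def)
  then show ?case by (simp add: span_is_subset2)
qed (simp add: span_is_subset2)

lemma space_power_mult:
  assumes V: "V \<subseteq> carrier A" and x: "x \<in> space_power K A V n" and v: "v \<in> V"
  shows "x \<otimes> v \<in> space_power K A V (Suc n)"
proof -
  have "space_power K A V n <#> V \<subseteq> carrier A"
    using V space_power_carrier[OF V] by (auto simp: set_mult_def)
  moreover have "x \<otimes> v \<in> space_power K A V n <#> V" using x v by (auto simp: set_mult_def)
  ultimately show ?thesis by (simp add: span_base)
qed

definition growth_space :: "'c set \<Rightarrow> nat \<Rightarrow> 'c set" where
  "growth_space V n = span (\<Union>i\<le>n. space_power K A V i)"

lemma growth_space_submodule: "V \<subseteq> carrier A \<Longrightarrow> submodule K (growth_space V n) A"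
  unfolding growth_space_def using space_power_carrier by (intro span_is_submodule) blast

lemma space_power_growth_space:
  assumes "V \<subseteq> carrier A" "i \<le> n" "x \<in> space_power K A V i"
  shows "x \<in> growth_space V n"
  unfolding growth_space_def
proof (rule span_base)
  show "(\<Union>i\<le>n. space_power K A V i) \<subseteq> carrier A" using space_power_carrier[OF assms(1)] by blast
qed (use assms in blast)

lemma growth_eq: "growth K A V n = vectorspace.dim K (A\<lparr>carrier := growth_space V n\<rparr>)"
  by (simp add: growth_def growth_space_def)

text \<open>\<open>growth\<close> is a dimension, and independent families can be counted against it
  only once finite generation of the space is known.\<close>

lemma growth_space_finite:
  assumes V: "V \<subseteq> span W" and W: "finite W" "W \<subseteq> carrier A"
  shows "\<exists>X. finite X \<and> X \<subseteq> carrier A \<and> growth_space V n \<subseteq> span X"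
proof -
  have Vc: "V \<subseteq> carrier A" using V W span_is_subset2 by blast
  have *: "\<exists>X. finite X \<and> X \<subseteq> carrier A \<and> space_power K A V i \<subseteq> span X" for i
  proof (induction i)
    case 0
    show ?case by (intro exI[of _ "{\<one>}"]) simp
  next
    case (Suc i)
    then obtain X where X: "finite X" "X \<subseteq> carrier A" "space_power K A V i \<subseteq> span X" by blast
    let ?Y = "(\<lambda>(x, w). x \<otimes> w) ` (X \<times> W)"
    have Y: "?Y \<subseteq> carrier A" using X W by auto
    have "space_power K A V i <#> V \<subseteq> span ?Y"
    proof
      fix s assume "s \<in> space_power K A V i <#> V"
      then obtain p v where "p \<in> space_power K A V i" "v \<in> V" and s: "s = p \<otimes> v"
        by (auto simp: set_mult_def)
      then have pv: "p \<in> span X" "v \<in> span W" using X V by blast+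
      have vc: "v \<in> carrier A" using pv W span_in_carrier by blast
      show "s \<in> span ?Y" unfolding s
      proof (rule span_mult_right[OF pv(1) X(2) vc _ Y])
        fix x assume x: "x \<in> X"
        then have "x \<in> carrier A" using X by blast
        then show "x \<otimes> v \<in> span ?Y"
          using pv(2) W Y x by (intro span_mult_left[OF pv(2)] span_base) auto
      qed
    qed
    then have "space_power K A V (Suc i) \<subseteq> span ?Y" using Y by (simp add: span_subset_span)
    then show ?case using X W Y by (intro exI[of _ ?Y]) auto
  qed
  then obtain X where X: "finite (X i)" "X i \<subseteq> carrier A" "space_power K A V i \<subseteq> span (X i)" for i
    by metis
  let ?X = "\<Union>i\<le>n. X i"
  have Xc: "?X \<subseteq> carrier A" using X by blast
  have "(\<Union>i\<le>n. space_power K A V i) \<subseteq> span ?X"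
    using X(3) span_is_monotone[of "X _" ?X] by blast
  then have "growth_space V n \<subseteq> span ?X" unfolding growth_space_def using Xc by (rule span_subset_span)
  then show ?thesis using X Xc by (intro exI[of _ ?X]) auto
qed

lemma card_le_growth:
  assumes V: "V \<subseteq> span W" and W: "finite W" "W \<subseteq> carrier A"
    and f: "f ` I \<subseteq> growth_space V n" "indep_over {} f I"
  shows "finite I \<and> card I \<le> growth K A V n"
proof -
  have Vc: "V \<subseteq> carrier A" using V W span_is_subset2 by blast
  obtain X where X: "finite X" "X \<subseteq> carrier A" "growth_space V n \<subseteq> span X"
    using growth_space_finite[OF V W] by blast
  have "vectorspace.fin_dim K (A\<lparr>carrier := growth_space V n\<rparr>)"
    using dim_le_card(1)[OF growth_space_submodule[OF Vc] X] .
  from indep_card_le_dim[OF growth_space_submodule[OF Vc] this f]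
  show ?thesis by (simp add: growth_eq)
qed

lemma growth_le_card:
  assumes V: "V \<subseteq> carrier A" and X: "finite X" "X \<subseteq> carrier A" "growth_space V n \<subseteq> span X"
  shows "growth K A V n \<le> card X"
  unfolding growth_eq using dim_le_card(2)[OF growth_space_submodule[OF V] X] .

lemma limsup_le_GKdim:
  assumes W: "finite W" "W \<subseteq> carrier A"
  shows "limsup (\<lambda>n. ereal (log (real n) (real (growth K A (span W) n)))) \<le> GKdim K A"
  unfolding GKdim_def
proof (rule SUP_upper)
  have "vectorspace K A" ..
  moreover have "submodule K (span W) A" using W by (intro span_is_submodule)
  ultimately show "span W \<in> {V. VectorSpace.subspace K V A \<and> vectorspace.fin_dim K (A\<lparr>carrier := V\<rparr>)}"
    using dim_le_card(1)[of "span W" W] W by (simp add: VectorSpace.subspace_def)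
qed

lemma GKdim_leI:
  assumes "\<And>W. finite W \<Longrightarrow> W \<subseteq> carrier A \<Longrightarrow>
    limsup (\<lambda>n. ereal (log (real n) (real (growth K A (span W) n)))) \<le> b"
  shows "GKdim K A \<le> b"
  unfolding GKdim_def
proof (rule SUP_least)
  fix V assume V: "V \<in> {V. VectorSpace.subspace K V A \<and> vectorspace.fin_dim K (A\<lparr>carrier := V\<rparr>)}"
  then have sub: "submodule K V A" by (simp add: VectorSpace.subspace_def)
  interpret V: vectorspace K "A\<lparr>carrier := V\<rparr>" using sub by (rule submodule_vectorspace)
  obtain W where W: "finite W" "W \<subseteq> V" "V.span W = V" using V by (auto simp: V.fin_dim_def)
  then have "span W = V" using span_li_not_depend[OF W(2) sub] by simp
  then show "limsup (\<lambda>n. ereal (log (real n) (real (growth K A V n)))) \<le> b"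
    using assms[OF W(1)] W(2) submodule.subset[OF sub] by auto
qed

end

context generated_algebra
begin

text \<open>The element \<open>c\<close> counts with degree one like a letter. It will be a regular
  element of an ideal, adjoined to the generating space.\<close>

lemma power_word_growth:
  assumes V: "V \<subseteq> carrier A" and c: "c \<in> V" and \<sigma>: "\<sigma> ` {..<g} \<subseteq> V" and w: "w \<in> wds"
  shows "c [^] (i::nat) \<otimes> wv w \<in> space_power K A V (i + length w)"
  using w
proof (induction w rule: rev_induct)
  case Nil
  show ?case
  proof (induction i)
    case (Suc i)
    have "c [^] i \<in> space_power K A V i" using Suc V c by (simp add: subset_iff)
    then show ?case using space_power_mult[OF V _ c, of "c [^] i" i] V c by (simp add: subset_iff)
  qed (simp add: span_base)
next
  case (snoc k w)
  have "(c [^] i \<otimes> wv w) \<otimes> \<sigma> k \<in> space_power K A V (Suc (i + length w))"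
    using snoc \<sigma> by (intro space_power_mult[OF V]) auto
  then show ?case using V c by (simp add: wv_append m_assoc subset_iff)
qed

lemma word_growth:
  assumes "length w \<le> n" "w \<in> wds"
  shows "wv w \<in> growth_space (span (\<sigma> ` {..<g})) n"
proof -
  have Vc: "span (\<sigma> ` {..<g}) \<subseteq> carrier A" by (intro span_is_subset2) auto
  have "wv w \<in> space_power K A (span (\<sigma> ` {..<g})) (length w)"
    \<comment> \<open>With exponent 0 any member of the span may stand for \<open>c\<close>; here it
      is \<open>\<zero>\<close>.\<close>
    using power_word_growth[OF Vc span_zero in_own_span assms(2), of 0] by (auto simp: image_subset_iff)
  then show ?thesis using space_power_growth_space[OF Vc assms(1)] by blast
qed

text \<open>Prefixes of normal words are normal, so the lengths of normal words have no
  gaps.\<close>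

lemma normal_of_length:
  assumes "infinite {w. normal w}"
  shows "\<exists>w. normal w \<and> length w = n"
proof -
  have "\<exists>w. normal w \<and> n < length w"
  proof (rule ccontr)
    assume "\<not> ?thesis"
    then have "{w. normal w} \<subseteq> {w. normal w \<and> length w \<le> n}" by (auto simp: not_less)
    then show False using finite_normal_length_le assms finite_subset by blast
  qed
  then obtain w where w: "normal w" "n < length w" by blast
  then have "normal (take n w)" using normal_factor[of "[]" "take n w" "drop n w"] by simp
  then show ?thesis using w by (intro exI[of _ "take n w"]) auto
qed

lemma card_normal_length_le:
  "card {w. normal w \<and> length w \<le> n} = (\<Sum>m\<le>n. card {w. normal w \<and> length w = m})"
proof -
  have "{w. normal w \<and> length w \<le> n} = (\<Union>m\<le>n. {w. normal w \<and> length w = m})" by auto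
  then show ?thesis by (simp add: card_UN_disjoint[OF finite_atMost] finite_normal_length disjoint_iff)
qed

lemma space_power_words:
  assumes V: "V \<subseteq> span (wv ` {w \<in> wds. length w \<le> s})"
  shows "space_power K A V i \<subseteq> span (wv ` {w \<in> wds. length w \<le> i * s})"
proof (induction i)
  case 0
  show ?case by (simp, rule span_is_monotone) (auto intro!: image_eqI[of _ _ "[]"])
next
  case (Suc i)
  have "space_power K A V i <#> V \<subseteq> span (wv ` {w \<in> wds. length w \<le> Suc i * s})"
  proof
    fix x assume "x \<in> space_power K A V i <#> V"
    then obtain p v where pv: "p \<in> span (wv ` {w \<in> wds. length w \<le> i * s})"
      "v \<in> span (wv ` {w \<in> wds. length w \<le> s})" "x = p \<otimes> v"
      using Suc V by (auto simp: set_mult_def)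
    show "x \<in> span (wv ` {w \<in> wds. length w \<le> Suc i * s})" unfolding pv(3)
    proof (rule span_mult_right[OF pv(1)])
      fix y assume "y \<in> wv ` {w \<in> wds. length w \<le> i * s}"
      then obtain w where w: "w \<in> wds" "length w \<le> i * s" "y = wv w" by auto
      show "y \<otimes> v \<in> span (wv ` {w \<in> wds. length w \<le> Suc i * s})" unfolding w(3)
      proof (rule span_mult_left[OF pv(2)])
        fix z assume "z \<in> wv ` {w \<in> wds. length w \<le> s}"
        then obtain u where u: "u \<in> wds" "length u \<le> s" "z = wv u" by auto
        then have "w @ u \<in> {w \<in> wds. length w \<le> Suc i * s}" using w by auto
        then have "wv (w @ u) \<in> wv ` {w \<in> wds. length w \<le> Suc i * s}" by (rule imageI)
        then show "wv w \<otimes> z \<in> span (wv ` {w \<in> wds. length w \<le> Suc i * s})"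
          using u by (intro span_base) (auto simp: wv_append)
      qed auto
    qed (use pv span_in_carrier[OF wv_image_closed] in auto)
  qed
  then show ?case using span_subset_span by auto
qed

lemma words_span_normal:
  "span (wv ` {w \<in> wds. length w \<le> n}) \<subseteq> span (wv ` {w. normal w \<and> length w \<le> n})"
proof (rule span_subset_span)
  show "wv ` {w \<in> wds. length w \<le> n} \<subseteq> span (wv ` {w. normal w \<and> length w \<le> n})"
  proof
    fix x assume "x \<in> wv ` {w \<in> wds. length w \<le> n}"
    then obtain w where w: "w \<in> wds" "length w \<le> n" "x = wv w" by auto
    have "span (wv ` {u. normal u \<and> length u \<le> length w}) \<subseteq> span (wv ` {w. normal w \<and> length w \<le> n})"
      using w by (intro span_is_monotone image_mono) auto
    then show "x \<in> span (wv ` {w. normal w \<and> length w \<le> n})"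
      using normal_span_length[OF w(1)] w(3) by auto
  qed
qed simp

lemma carrier_words_length: "carrier A \<subseteq> (\<Union>n. span (wv ` {w \<in> wds. length w \<le> n}))"
proof
  fix x assume "x \<in> carrier A"
  then have "x \<in> span (wv ` wds)" using generated by blast
  then have "\<exists>n. x \<in> span (wv ` {w \<in> wds. length w \<le> n})"
    using wv_image_closed
  proof (induction rule: span_induct)
    case (base s)
    then obtain w where "w \<in> wds" "s = wv w" by auto
    then show ?case by (intro exI[of _ "length w"] span_base) auto
  next
    case zero
    then show ?case using span_zero[OF wv_image_closed] by blast
  next
    case (add u v)
    then obtain m n where "u \<in> span (wv ` {w \<in> wds. length w \<le> m})" "v \<in> span (wv ` {w \<in> wds. length w \<le> n})"
      by blast
    moreover have "span (wv ` {w \<in> wds. length w \<le> m}) \<subseteq> span (wv ` {w \<in> wds. length w \<le> max m n})"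
      "span (wv ` {w \<in> wds. length w \<le> n}) \<subseteq> span (wv ` {w \<in> wds. length w \<le> max m n})"
      by (intro span_is_monotone image_mono; auto)+
    ultimately have "u \<oplus> v \<in> span (wv ` {w \<in> wds. length w \<le> max m n})"
      by (intro span_add) auto
    then show ?case by blast
  next
    case (smult c u)
    then show ?case using span_smult[OF wv_image_closed] by blast
  qed
  then show "x \<in> (\<Union>n. span (wv ` {w \<in> wds. length w \<le> n}))" by blast
qed

lemma finite_subset_words:
  assumes "finite W" "W \<subseteq> carrier A"
  shows "\<exists>n. W \<subseteq> span (wv ` {w \<in> wds. length w \<le> n})"
  using assms
proof (induction W)
  case (insert x W)
  then obtain m n where "x \<in> span (wv ` {w \<in> wds. length w \<le> m})" "W \<subseteq> span (wv ` {w \<in> wds. length w \<le> n})"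
    using carrier_words_length by blast
  moreover have "span (wv ` {w \<in> wds. length w \<le> m}) \<subseteq> span (wv ` {w \<in> wds. length w \<le> max m n})"
    "span (wv ` {w \<in> wds. length w \<le> n}) \<subseteq> span (wv ` {w \<in> wds. length w \<le> max m n})"
    by (intro span_is_monotone image_mono; auto)+
  ultimately show ?case by blast
qed simp

text \<open>With at least one and at most \<open>C\<close> normal words in every length, growth is
  squeezed between linear functions. For the upper bound an arbitrary finite set is placed inside
  the words of some length s, which merely rescales the argument.\<close>

theorem GKdim_eq_1:
  assumes inf: "infinite {w. normal w}" and C: "\<And>m. card {w. normal w \<and> length w = m} \<le> C"
  shows "GKdim K A = 1"
proof (rule antisym)
  show "GKdim K A \<le> 1"
  proof (rule GKdim_leI)
    fix W assume W: "finite W" "W \<subseteq> carrier A"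
    obtain s where s: "W \<subseteq> span (wv ` {w \<in> wds. length w \<le> s})" using finite_subset_words[OF W] by blast
    have V: "span W \<subseteq> span (wv ` {w \<in> wds. length w \<le> s})" using s by (rule span_subset_span) auto
    have Vc: "span W \<subseteq> carrier A" using W by (intro span_is_subset2)
    have "growth K A (span W) n \<le> (C * (s + 1)) * n + C * (s + 1)" for n
    proof -
      have "space_power K A (span W) i \<subseteq> span (wv ` {w \<in> wds. length w \<le> n * s})" if "i \<le> n" for i
      proof -
        have "span (wv ` {w \<in> wds. length w \<le> i * s}) \<subseteq> span (wv ` {w \<in> wds. length w \<le> n * s})"
          by (intro span_is_monotone image_mono) (auto intro: order_trans[OF _ mult_le_mono1[OF that]])
        then show ?thesis using space_power_words[OF V, of i] by blast
      qed
      then have "growth_space (span W) n \<subseteq> span (wv ` {w \<in> wds. length w \<le> n * s})"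
        unfolding growth_space_def by (intro span_subset_span) auto
      also have "\<dots> \<subseteq> span (wv ` {w. normal w \<and> length w \<le> n * s})" by (rule words_span_normal)
      finally have "growth K A (span W) n \<le> card (wv ` {w. normal w \<and> length w \<le> n * s})"
        using Vc finite_normal_length_le by (intro growth_le_card) auto
      also have "\<dots> \<le> card {w. normal w \<and> length w \<le> n * s}"
        by (intro card_image_le finite_normal_length_le)
      also have "\<dots> \<le> (\<Sum>m\<le>n * s. C)" unfolding card_normal_length_le by (intro sum_mono C)
      also have "\<dots> = C * (n * s + 1)" by simp
      also have "\<dots> \<le> (C * (s + 1)) * n + C * (s + 1)" by (simp add: algebra_simps)
      finally show ?thesis .
    qed
    then show "limsup (\<lambda>n. ereal (log (real n) (real (growth K A (span W) n)))) \<le> 1"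
      by (rule limsup_log_le_1)
  qed
  let ?V = "span (\<sigma> ` {..<g})"
  have "n \<le> growth K A ?V n" for n
  proof -
    have "n \<le> (\<Sum>m\<le>n. 1)" by simp
    also have "\<dots> \<le> (\<Sum>m\<le>n. card {w. normal w \<and> length w = m})"
    proof (rule sum_mono)
      fix m
      have "{w. normal w \<and> length w = m} \<noteq> {}" using normal_of_length[OF inf] by blast
      then show "1 \<le> card {w. normal w \<and> length w = m}"
        using finite_normal_length by (simp add: Suc_le_eq card_gt_0_iff)
    qed
    also have "\<dots> = card {w. normal w \<and> length w \<le> n}" by (simp add: card_normal_length_le)
    also have "\<dots> \<le> growth K A ?V n"
    proof -
      have i: "indep_over {} wv {w. normal w \<and> length w \<le> n}"
        using normal_indep by (rule indep_over_subset) auto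
      have s: "wv ` {w. normal w \<and> length w \<le> n} \<subseteq> growth_space ?V n"
        using word_growth normal_wds by blast
      have "finite (\<sigma> ` {..<g})" "\<sigma> ` {..<g} \<subseteq> carrier A" by auto
      from card_le_growth[OF order_refl this s i] show ?thesis by simp
    qed
    finally show ?thesis .
  qed
  then have "1 \<le> limsup (\<lambda>n. ereal (log (real n) (real (growth K A ?V n))))"
    by (rule limsup_log_ge_1)
  also have "\<dots> \<le> GKdim K A" by (rule limsup_le_GKdim) auto
  finally show "1 \<le> GKdim K A" .
qed

end

section \<open>Left ideals in algebras of linear growth\<close>

context k_algebra
begin

text \<open>The annihilator of the class of \<open>e\<close> in A/L; the quotient by it is
  isomorphic to the cyclic submodule generated by that class.\<close>

definition colon :: "'c set \<Rightarrow> 'c \<Rightarrow> 'c set" where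
  "colon L e = {b \<in> carrier A. b \<otimes> e \<in> L}"

definition finite_codim :: "'c set \<Rightarrow> bool" where
  "finite_codim L \<longleftrightarrow> (\<exists>W. finite W \<and> W \<subseteq> carrier A \<and> carrier A \<subseteq> span (L \<union> W))"

definition maximal_left_ideal :: "'c set \<Rightarrow> bool" where
  "maximal_left_ideal M \<longleftrightarrow> left_ideal M \<and> \<one> \<notin> M \<and>
    (\<forall>L. left_ideal L \<and> M \<subseteq> L \<and> \<one> \<notin> L \<longrightarrow> L = M)"

lemma left_ideal_colon: "left_ideal L \<Longrightarrow> e \<in> carrier A \<Longrightarrow> left_ideal (colon L e)"
  by (auto simp: left_ideal_def colon_def l_distr m_assoc)

lemma left_ideal_eq_carrier: "left_ideal L \<Longrightarrow> \<one> \<in> L \<Longrightarrow> L = carrier A"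
  using left_ideal_mult[of L _ \<one>] left_ideal_carrier[of L] by force

lemma left_ideal_Int: "left_ideal L \<Longrightarrow> left_ideal L' \<Longrightarrow> left_ideal (L \<inter> L')"
  by (auto simp: left_ideal_def)

lemma left_ideal_carrier_self: "left_ideal (carrier A)"
  by (auto simp: left_ideal_def)

lemma left_ideal_principal:
  assumes "p \<in> carrier A" shows "left_ideal {b \<otimes> p |b. b \<in> carrier A}"
  unfolding left_ideal_def
proof (intro conjI ballI)
  show "\<zero> \<in> {b \<otimes> p |b. b \<in> carrier A}" using assms by (force intro: exI[of _ \<zero>])
next
  fix x y assume "x \<in> {b \<otimes> p |b. b \<in> carrier A}" "y \<in> {b \<otimes> p |b. b \<in> carrier A}"
  then obtain b c where *: "b \<in> carrier A" "c \<in> carrier A" "x = b \<otimes> p" "y = c \<otimes> p" by blast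
  then have "x \<oplus> y = (b \<oplus> c) \<otimes> p" using assms by (simp add: l_distr)
  with * show "x \<oplus> y \<in> {b \<otimes> p |b. b \<in> carrier A}" by blast
next
  fix a x assume a: "a \<in> carrier A" and "x \<in> {b \<otimes> p |b. b \<in> carrier A}"
  then obtain b where *: "b \<in> carrier A" "x = b \<otimes> p" by blast
  then have "a \<otimes> x = (a \<otimes> b) \<otimes> p" using assms a by (simp add: m_assoc)
  with * a show "a \<otimes> x \<in> {b \<otimes> p |b. b \<in> carrier A}" by blast
qed (use assms in auto)

lemma left_ideal_plus:
  assumes L: "left_ideal L" and M: "left_ideal M"
  shows "left_ideal {l \<oplus> m |l m. l \<in> L \<and> m \<in> M}"
proof -
  have s: "submodule K {l \<oplus> m |l m. l \<in> L \<and> m \<in> M} A"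
    using L M by (intro submodule_plus left_ideal_submodule)
  show ?thesis unfolding left_ideal_def
  proof (intro conjI ballI)
    fix a x assume a: "a \<in> carrier A" and "x \<in> {l \<oplus> m |l m. l \<in> L \<and> m \<in> M}"
    then obtain l m where *: "l \<in> L" "m \<in> M" "x = l \<oplus> m" by blast
    then have "a \<otimes> x = a \<otimes> l \<oplus> a \<otimes> m"
      using a left_ideal_carrier[OF L] left_ideal_carrier[OF M] by (simp add: r_distr)
    with * a show "a \<otimes> x \<in> {l \<oplus> m |l m. l \<in> L \<and> m \<in> M}"
      using left_ideal_mult[OF L] left_ideal_mult[OF M] by blast
  qed (use submodule.subset[OF s] submodule.zero_closed[OF s] submodule.m_closed[OF s] in auto)
qed

lemma span_image_lift:
  assumes x: "x \<in> span (h ` S)" and S: "S \<subseteq> carrier A" and h: "\<And>x. x \<in> carrier A \<Longrightarrow> h x \<in> carrier A"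
    and add: "\<And>x y. x \<in> carrier A \<Longrightarrow> y \<in> carrier A \<Longrightarrow> h (x \<oplus> y) = h x \<oplus> h y"
    and smult: "\<And>c x. c \<in> carrier K \<Longrightarrow> x \<in> carrier A \<Longrightarrow> h (c \<odot> x) = c \<odot> h x"
  shows "\<exists>y\<in>span S. x = h y"
proof -
  have c: "h ` S \<subseteq> carrier A" using S h by auto
  note sc = span_in_carrier[OF S]
  show ?thesis using x c
  proof (induction rule: span_induct)
    case (base s)
    then show ?case using span_base[OF S] by blast
  next
    case zero
    have "h (\<zero>\<^bsub>K\<^esub> \<odot> \<zero>) = \<zero>\<^bsub>K\<^esub> \<odot> h \<zero>" by (rule smult) auto
    then show ?case using span_zero[OF S] h by (intro bexI[of _ \<zero>]) auto
  next
    case (add u v)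
    then obtain y z where yz: "y \<in> span S" "z \<in> span S" "u = h y" "v = h z" by blast
    then have "u \<oplus> v = h (y \<oplus> z)" using sc assms(4) by simp
    then show ?case using span_add[OF S] yz by blast
  next
    case (smult c u)
    then obtain y where y: "y \<in> span S" "u = h y" by blast
    then have "c \<odot> u = h (c \<odot> y)" using sc assms(5) smult by simp
    then show ?case using span_smult[OF S] y smult by blast
  qed
qed

lemma span_image_mult_right:
  assumes "x \<in> span ((\<lambda>s. s \<otimes> l) ` S)" "S \<subseteq> carrier A" "l \<in> carrier A"
  shows "\<exists>y\<in>span S. x = y \<otimes> l"
  using assms by (intro span_image_lift) (auto simp: l_distr smult_mult_left)

lemma span_image_mult_left:
  assumes "x \<in> span ((\<lambda>s. l \<otimes> s) ` S)" "S \<subseteq> carrier A" "l \<in> carrier A"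
  shows "\<exists>y\<in>span S. x = l \<otimes> y"
  using assms by (intro span_image_lift) (auto simp: r_distr smult_mult_right)

text \<open>Right multiplication by \<open>l\<close> induces an injection from A modulo
  \<open>colon L l\<close> into A/L. Read contrapositively, independence modulo the colon passes to
  the products with \<open>l\<close> modulo \<open>L\<close>.\<close>

lemma span_colon:
  assumes x: "x \<otimes> l \<in> span (L \<union> (\<lambda>s. s \<otimes> l) ` S)" and L: "left_ideal L" and S: "S \<subseteq> carrier A"
    and l: "l \<in> carrier A" and xc: "x \<in> carrier A"
  shows "x \<in> span (colon L l \<union> S)"
proof -
  have Lc: "L \<subseteq> carrier A" using L by (simp add: left_ideal_def)
  have cc: "colon L l \<union> S \<subseteq> carrier A" using S by (auto simp: colon_def)
  obtain u v where uv: "u \<in> span L" "v \<in> span ((\<lambda>s. s \<otimes> l) ` S)" "x \<otimes> l = u \<oplus> v"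
    using x by (rule span_UnE) (use Lc S l in auto)
  have u: "u \<in> L" using uv span_eq_self[OF left_ideal_submodule[OF L]] by simp
  obtain y where y: "y \<in> span S" "v = y \<otimes> l" using span_image_mult_right[OF uv(2) S l] by blast
  have yc: "y \<in> carrier A" using span_in_carrier[OF S y(1)] .
  have uc: "u \<in> carrier A" using u Lc by blast
  have "(x \<ominus> y) \<otimes> l = u"
    using uv(3) y(2) xc yc uc l by (simp add: a_minus_def l_distr l_minus a_assoc r_neg)
  then have "x \<ominus> y \<in> colon L l" using u xc yc by (simp add: colon_def)
  then have "x \<ominus> y \<in> span (colon L l \<union> S)" by (intro span_base[OF cc]) simp
  moreover have "y \<in> span (colon L l \<union> S)" using y span_is_monotone[of S "colon L l \<union> S"] by auto
  ultimately have "(x \<ominus> y) \<oplus> y \<in> span (colon L l \<union> S)" by (rule span_add[OF cc])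
  then show ?thesis using xc yc by (simp add: minus_add_self)
qed

lemma finite_codim_indep:
  assumes "finite_codim L" "L \<subseteq> carrier A" "f ` I \<subseteq> carrier A" "indep_over L f I"
  shows "finite I"
proof -
  obtain W where "finite W" "W \<subseteq> carrier A" "carrier A \<subseteq> span (L \<union> W)"
    using assms(1) by (auto simp: finite_codim_def)
  then show ?thesis using steinitz_card_le[of W L f I] assms by blast
qed

lemma finite_codim_mono: 
  assumes "finite_codim L" "L \<subseteq> L'"
  shows "finite_codim L'"
proof -
  obtain W where W: "finite W" "W \<subseteq> carrier A" "carrier A \<subseteq> span (L \<union> W)"
    using assms(1) by (auto simp: finite_codim_def)
  moreover have "span (L \<union> W) \<subseteq> span (L' \<union> W)" using assms(2) by (intro span_is_monotone) auto
  ultimately show ?thesis unfolding finite_codim_def by blast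
qed

lemma finite_codim_Int:
  assumes L: "submodule K L A" "finite_codim L" and L': "submodule K L' A" "finite_codim L'"
  shows "finite_codim (L \<inter> L')"
proof -
  have c: "L \<subseteq> carrier A" "L' \<subseteq> carrier A" using L L' by (auto dest: submodule.subset)
  obtain W where W: "finite W" "W \<subseteq> carrier A" "carrier A \<subseteq> span (L \<union> W)"
    using L by (auto simp: finite_codim_def)
  obtain W' where W': "finite W'" "W' \<subseteq> carrier A" "carrier A \<subseteq> span (L' \<union> W')"
    using L' by (auto simp: finite_codim_def)
  have "L \<subseteq> span (L' \<union> W')" using c W' by blast
  \<comment> \<open>The representatives of \<open>L\<close> modulo \<open>L'\<close> are taken from
    \<open>L\<close> itself, so that subtracting them does not leave \<open>L\<close>.\<close>
  then obtain X where X: "finite X" "X \<subseteq> L" "L \<subseteq> span (L' \<union> X)"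
    using maximal_indep[OF _ W'(1,2) c(2)] by metis
  have Y: "(L \<inter> L') \<union> (X \<union> W) \<subseteq> carrier A" using c X W by auto
  have "L \<subseteq> span ((L \<inter> L') \<union> (X \<union> W))"
  proof
    fix l assume l: "l \<in> L"
    then have "l \<in> span (L' \<union> X)" using X by blast
    then obtain u v where uv: "u \<in> span L'" "v \<in> span X" "l = u \<oplus> v"
      by (rule span_UnE) (use c X in auto)
    have u: "u \<in> L'" using uv span_eq_self[OF L'(1)] by simp
    have v: "v \<in> L" using uv span_is_subset[OF X(2) L(1)] by blast
    have cc: "u \<in> carrier A" "v \<in> carrier A" using u v c by auto
    have "l \<ominus> v \<in> L" using submodule_minus[OF L(1) l v] .
    also have "l \<ominus> v = u" using uv(3) cc by (simp add: a_minus_def a_assoc r_neg)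
    finally have "u \<in> span ((L \<inter> L') \<union> (X \<union> W))" using u span_base[OF Y] by blast
    moreover have "v \<in> span ((L \<inter> L') \<union> (X \<union> W))"
      using uv(2) span_is_monotone[of X "(L \<inter> L') \<union> (X \<union> W)"] by blast
    ultimately show "l \<in> span ((L \<inter> L') \<union> (X \<union> W))" unfolding uv(3) by (rule span_add[OF Y])
  qed
  then have "L \<union> W \<subseteq> span ((L \<inter> L') \<union> (X \<union> W))" using span_base[OF Y] by blast
  then have "span (L \<union> W) \<subseteq> span ((L \<inter> L') \<union> (X \<union> W))" using Y by (rule span_subset_span)
  then show ?thesis unfolding finite_codim_def using W X Y by (intro exI[of _ "X \<union> W"]) auto
qed

lemma maximal_left_ideal_one:
  assumes M: "maximal_left_ideal M" and L: "left_ideal L" and l: "l \<in> L" "l \<notin> M"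
  shows "\<exists>b\<in>L. b \<ominus> \<one> \<in> M"
proof -
  have LM: "left_ideal L" "left_ideal M" using assms by (auto simp: maximal_left_ideal_def)
  let ?S = "{l \<oplus> m |l m. l \<in> L \<and> m \<in> M}"
  have S: "left_ideal ?S" using LM by (rule left_ideal_plus)
  have MS: "M \<subseteq> ?S"
  proof
    fix m assume m: "m \<in> M"
    then have "m = \<zero> \<oplus> m" using left_ideal_carrier[OF LM(2)] by simp
    then show "m \<in> ?S" using m left_ideal_zero[OF LM(1)] by blast
  qed
  have lS: "l \<in> ?S"
  proof -
    have "l = l \<oplus> \<zero>" using l left_ideal_carrier[OF LM(1)] by simp
    then show ?thesis using l left_ideal_zero[OF LM(2)] by blast
  qed
  have "\<one> \<in> ?S"
  proof (rule ccontr)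
    assume "\<one> \<notin> ?S"
    then have "?S = M" using M S MS by (simp add: maximal_left_ideal_def)
    then show False using lS l by simp
  qed
  then obtain b m where bm: "b \<in> L" "m \<in> M" "\<one> = b \<oplus> m" by blast
  have c: "b \<in> carrier A" "m \<in> carrier A" using bm left_ideal_carrier[OF LM(1)] left_ideal_carrier[OF LM(2)] by auto
  have "b \<ominus> \<one> = \<ominus> m" unfolding bm(3) using c by (simp add: a_minus_def minus_add r_neg1 a_assoc[symmetric] r_neg)
  moreover have "\<ominus> m \<in> M" using submodule_uminus[OF left_ideal_submodule[OF LM(2)] bm(2)] .
  ultimately have "b \<ominus> \<one> \<in> M" by simp
  then show ?thesis using bm(1) by blast
qed

text \<open>The joint annihilator of the classes of \<open>E\<close> in A/M. For finite
  \<open>E\<close>, the quotient by it embeds in a finite power of A/M.\<close>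

definition ann_mod :: "'c set \<Rightarrow> 'c set \<Rightarrow> 'c set" where
  "ann_mod M E = {a \<in> carrier A. \<forall>e\<in>E. a \<otimes> e \<in> M}"

lemma ann_mod_empty: "ann_mod M {} = carrier A"
  by (simp add: ann_mod_def)

lemma ann_mod_insert: "ann_mod M (insert e E) = ann_mod M E \<inter> colon M e"
  by (auto simp: ann_mod_def colon_def)

lemma left_ideal_ann_mod: 
  assumes "left_ideal M" "E \<subseteq> carrier A"
  shows "left_ideal (ann_mod M E)"
  using assms unfolding left_ideal_def ann_mod_def
  by (auto simp: l_distr m_assoc subset_iff)

text \<open>Simplicity of A/M: a nonzero class generates the module, so a left multiple of it is the
  class of \<open>\<one>\<close>. Multiplying \<open>a\<close> on the left keeps it in
  \<open>L\<close>.\<close>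

lemma maximal_left_ideal_mult_one:
  assumes M: "maximal_left_ideal M" and e: "e \<in> carrier A" and L: "left_ideal L" and a: "a \<in> L" "a \<otimes> e \<notin> M"
  shows "\<exists>b\<in>L. b \<otimes> e \<ominus> \<one> \<in> M"
proof -
  have ac: "a \<in> carrier A" using a left_ideal_carrier[OF L] by blast
  have "\<exists>c\<in>{b \<otimes> (a \<otimes> e) |b. b \<in> carrier A}. c \<ominus> \<one> \<in> M"
  proof (rule maximal_left_ideal_one[OF M left_ideal_principal _ a(2)])
    have "a \<otimes> e = \<one> \<otimes> (a \<otimes> e)" using ac e by simp
    then show "a \<otimes> e \<in> {b \<otimes> (a \<otimes> e) |b. b \<in> carrier A}" by blast
  qed (use ac e in simp)
  then obtain b where b: "b \<in> carrier A" "b \<otimes> (a \<otimes> e) \<ominus> \<one> \<in> M" by blast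
  then have "(b \<otimes> a) \<otimes> e \<ominus> \<one> \<in> M" using ac e by (simp add: m_assoc)
  then show ?thesis using left_ideal_mult[OF L b(1) a(1)] by blast
qed

text \<open>The element \<open>a\<close> sends the class of \<open>e\<close> to the class of
  \<open>\<one>\<close>, whose annihilator is \<open>M\<close>.\<close>

lemma colon_unit_mod:
  assumes M: "left_ideal M" and a: "a \<in> carrier A" "e \<in> carrier A" "a \<otimes> e \<ominus> \<one> \<in> M"
    and b: "b \<in> carrier A" "b \<otimes> a \<otimes> e \<in> M"
  shows "b \<in> M"
proof -
  have "b \<otimes> (a \<otimes> e \<ominus> \<one>) \<in> M" using left_ideal_mult[OF M b(1) a(3)] .
  then have "b \<otimes> a \<otimes> e \<ominus> b \<otimes> (a \<otimes> e \<ominus> \<one>) \<in> M" using left_ideal_minus[OF M b(2)] by blast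
  also have "b \<otimes> a \<otimes> e \<ominus> b \<otimes> (a \<otimes> e \<ominus> \<one>) = b"
    using a b by (simp add: a_minus_def r_distr r_minus minus_add minus_minus m_assoc a_assoc[symmetric] r_neg)
  finally show ?thesis .
qed

lemma finite_codim_ann_mod:
  assumes M: "left_ideal M" and E: "finite E" "E \<subseteq> carrier A"
    and col: "\<And>e. e \<in> carrier A \<Longrightarrow> finite_codim (colon M e)"
  shows "finite_codim (ann_mod M E)"
  using E
proof (induction E)
  case empty
  show ?case unfolding ann_mod_empty finite_codim_def
    using span_base[of "carrier A"] by (intro exI[of _ "{}"]) auto
next
  case (insert e E)
  then show ?case unfolding ann_mod_insert
    using M col by (intro finite_codim_Int left_ideal_submodule left_ideal_ann_mod left_ideal_colon) auto
qed

end

section \<open>Infinite-dimensional cyclic modules and chains of left ideals\<close>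

context generated_algebra
begin

text \<open>If every word of length j were caught, the span of \<open>L\<close> and the shorter
  words would be closed under left multiplication by letters, hence be everything, and
  \<open>L\<close> would have finite codimension. One such word for each j gives a family in which
  the longest word leads.\<close>

lemma escaping_word:
  assumes L: "left_ideal L" and nf: "\<not> finite_codim L"
  shows "\<exists>w\<in>wds. length w = j \<and> wv w \<notin> span (L \<union> wv ` {u \<in> wds. length u < j})"
proof (rule ccontr)
  assume n: "\<not> ?thesis"
  let ?W = "{u \<in> wds. length u < j}"
  let ?T = "span (L \<union> wv ` ?W)"
  have Tc: "L \<union> wv ` ?W \<subseteq> carrier A" using L by (auto simp: left_ideal_def)
  have inT: "wv w \<in> ?T" if "w \<in> wds" "length w \<le> j" for w
  proof (cases "length w = j")
    case True
    then show ?thesis using n that by blast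
  next
    case False
    then show ?thesis using that by (intro span_base[OF Tc]) auto
  qed
  have "wv w \<in> ?T" if "w \<in> wds" for w
    using that
  proof (induction w)
    case Nil
    then show ?case by (intro inT) auto
  next
    case (Cons i w)
    then have i: "i \<in> {..<g}" by (simp del: lessThan_iff)
    have "\<sigma> i \<otimes> wv w \<in> ?T"
    proof (rule span_mult_left[OF _ Tc _ _ Tc])
      show "wv w \<in> ?T" using Cons by auto
      fix s assume "s \<in> L \<union> wv ` ?W"
      then show "\<sigma> i \<otimes> s \<in> ?T"
      proof
        assume "s \<in> L"
        then show ?thesis using left_ideal_mult[OF L] by (intro span_base[OF Tc]) auto
      next
        assume "s \<in> wv ` ?W"
        then obtain u where u: "u \<in> wds" "length u < j" "s = wv u" by auto
        then have "wv (i # u) \<in> ?T" by (intro inT) (use i in auto)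
        then show ?thesis using u by simp
      qed
    qed simp
    then show ?case by simp
  qed
  then have "wv ` wds \<subseteq> ?T" by blast
  then have "span (wv ` wds) \<subseteq> ?T" using Tc by (rule span_subset_span)
  then have "carrier A \<subseteq> ?T" using generated by blast
  moreover have "finite (wv ` ?W)"
    by (rule finite_imageI, rule finite_subset[OF _ finite_words_length[of j]]) auto
  ultimately have "finite_codim L" unfolding finite_codim_def by (intro exI[of _ "wv ` ?W"]) auto
  with nf show False by blast
qed

text \<open>A modulo the colon embeds in A/L by multiplication with \<open>a\<close>. Were it
  infinite-dimensional, escaping words would give an explicit infinite independent family in
  A/L.\<close>

lemma finite_codim_colon:
  assumes L: "left_ideal L" "finite_codim L" and a: "a \<in> carrier A"
  shows "finite_codim (colon L a)"
proof (rule ccontr)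
  assume nf: "\<not> finite_codim (colon L a)"
  have "\<forall>j. \<exists>w. w \<in> wds \<and> length w = j \<and> wv w \<notin> span (colon L a \<union> wv ` {u \<in> wds. length u < j})"
    using escaping_word[OF left_ideal_colon[OF L(1) a] nf] by blast
  then obtain w where "\<forall>j. w j \<in> wds \<and> length (w j) = j \<and>
      wv (w j) \<notin> span (colon L a \<union> wv ` {u \<in> wds. length u < j})"
    by (rule choice[THEN exE])
  then have w: "w j \<in> wds" "length (w j) = j"
    "wv (w j) \<notin> span (colon L a \<union> wv ` {u \<in> wds. length u < j})" for j
    by simp_all
  have "indep_over L (\<lambda>j. wv (w j) \<otimes> a) UNIV"
    unfolding indep_over_def
  proof (intro allI impI, elim conjE)
    fix J :: "nat set" assume J: "finite J" "J \<noteq> {}"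
    let ?m = "Max J"
    let ?S = "wv ` {u \<in> wds. length u < ?m}"
    have "wv (w ?m) \<otimes> a \<notin> span (L \<union> (\<lambda>j. wv (w j) \<otimes> a) ` (J - {?m}))"
    proof
      assume "wv (w ?m) \<otimes> a \<in> span (L \<union> (\<lambda>j. wv (w j) \<otimes> a) ` (J - {?m}))"
      also have "\<dots> \<subseteq> span (L \<union> (\<lambda>s. s \<otimes> a) ` ?S)"
      proof (intro span_is_monotone Un_mono order_refl image_subsetI)
        fix j assume "j \<in> J - {?m}"
        then have "j < ?m" using J by (simp add: order.strict_iff_order)
        then have "wv (w j) \<in> ?S" using w by auto
        then show "wv (w j) \<otimes> a \<in> (\<lambda>s. s \<otimes> a) ` ?S" by (rule imageI)
      qed
      finally have "wv (w ?m) \<in> span (colon L a \<union> ?S)"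
        using L(1) a by (intro span_colon) auto
      with w(3) show False by blast
    qed
    then show "\<exists>j\<in>J. wv (w j) \<otimes> a \<notin> span (L \<union> (\<lambda>j. wv (w j) \<otimes> a) ` (J - {j}))"
      using J by (intro bexI[of _ ?m]) auto
  qed
  then have "finite (UNIV :: nat set)"
    using L a by (intro finite_codim_indep[OF L(2)]) (auto simp: left_ideal_def)
  then show False by simp
qed

text \<open>
  Each factor of the chain contains an infinite-dimensional cyclic module, so it contributes at
  least \<open>n + 1\<close> to the dimension of the span of the words of length at most \<open>n + s\<close>, which
  grows only like \<open>C n\<close>.
\<close>

lemma chain_length_le:
  assumes C: "\<And>m. card {w. normal w \<and> length w = m} \<le> C"
    and L: "\<And>i. i \<le> t \<Longrightarrow> left_ideal (L i)" and mono: "\<And>i. i < t \<Longrightarrow> L i \<subseteq> L (Suc i)"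
    and l: "\<And>i. i < t \<Longrightarrow> l i \<in> L (Suc i)" and nf: "\<And>i. i < t \<Longrightarrow> \<not> finite_codim (colon (L i) (l i))"
  shows "t \<le> C"
proof -
  have monoL: "L i \<subseteq> L i'" if "i \<le> i'" "i' \<le> t" for i i'
    using that
  proof (induction i' rule: dec_induct)
    case (step k)
    then show ?case using mono[of k] by auto
  qed simp
  have lc: "l i \<in> carrier A" if "i < t" for i using left_ideal_carrier[OF L l] that by simp
  have "\<forall>i\<in>{..<t}. \<exists>w. \<forall>j. w j \<in> wds \<and> length (w j) = j \<and>
      wv (w j) \<notin> span (colon (L i) (l i) \<union> wv ` {u \<in> wds. length u < j})"
  proof
    fix i assume "i \<in> {..<t}"
    then have "\<forall>j. \<exists>w. w \<in> wds \<and> length w = j \<and>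
        wv w \<notin> span (colon (L i) (l i) \<union> wv ` {u \<in> wds. length u < j})"
      using escaping_word[OF left_ideal_colon[OF L lc] nf] by (simp add: Bex_def)
    then show "\<exists>w. \<forall>j. w j \<in> wds \<and> length (w j) = j \<and>
        wv (w j) \<notin> span (colon (L i) (l i) \<union> wv ` {u \<in> wds. length u < j})"
      by (rule choice)
  qed
  then obtain w where "\<forall>i\<in>{..<t}. \<forall>j. w i j \<in> wds \<and> length (w i j) = j \<and>
    wv (w i j) \<notin> span (colon (L i) (l i) \<union> wv ` {u \<in> wds. length u < j})"
    by (rule bchoice[THEN exE])
  then have w: "w i j \<in> wds" "length (w i j) = j"
    "wv (w i j) \<notin> span (colon (L i) (l i) \<union> wv ` {u \<in> wds. length u < j})" if "i < t" for i j
    using that by auto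
  let ?f = "\<lambda>(i, j). wv (w i j) \<otimes> l i"
  have indep: "indep_over {} ?f ({..<t} \<times> UNIV)"
    unfolding indep_over_def
  proof (intro allI impI, elim conjE)
    fix J :: "(nat \<times> nat) set" assume J: "J \<subseteq> {..<t} \<times> UNIV" "finite J" "J \<noteq> {}"
    \<comment> \<open>The leading member sits at the highest level and has the longest word there.
      Products from lower levels lie in \<open>L i0\<close>, because \<open>l i\<close> belongs to
      \<open>L (Suc i)\<close>.\<close>
    define i0 where "i0 = Max (fst ` J)"
    have "i0 \<in> fst ` J" unfolding i0_def using J by (intro Max_in) auto
    have i0: "i \<le> i0" if "(i, j) \<in> J" for i j
      unfolding i0_def using J that by (intro Max_ge) (auto intro: rev_image_eqI)
    have i0t: "i0 < t" using \<open>i0 \<in> fst ` J\<close> J by auto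
    define Js where "Js = {j. (i0, j) \<in> J}"
    have Js: "finite Js" "Js \<noteq> {}"
      using finite_subset[of Js "snd ` J"] J \<open>i0 \<in> fst ` J\<close> by (force simp: Js_def)+
    define j0 where "j0 = Max Js"
    have j0: "(i0, j0) \<in> J" using Max_in[OF Js] by (simp add: Js_def j0_def)
    have j0m: "j \<le> j0" if "(i0, j) \<in> J" for j
      unfolding j0_def using Js that by (intro Max_ge) (auto simp: Js_def)
    let ?S = "wv ` {u \<in> wds. length u < j0}"
    have Li0: "left_ideal (L i0)" using L i0t by simp
    have "?f (i0, j0) \<notin> span ({} \<union> ?f ` (J - {(i0, j0)}))"
    proof
      assume "?f (i0, j0) \<in> span ({} \<union> ?f ` (J - {(i0, j0)}))"
      also have "\<dots> \<subseteq> span (L i0 \<union> (\<lambda>s. s \<otimes> l i0) ` ?S)"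
      proof (rule span_is_monotone, rule subsetI)
        fix x assume "x \<in> {} \<union> ?f ` (J - {(i0, j0)})"
        then obtain i j where ij: "(i, j) \<in> J" "(i, j) \<noteq> (i0, j0)" and x: "x = wv (w i j) \<otimes> l i"
          by auto
        show "x \<in> L i0 \<union> (\<lambda>s. s \<otimes> l i0) ` ?S"
        proof (cases "i = i0")
          case True
          then have "j < j0" using ij j0m[of j] by auto
          then have "wv (w i0 j) \<in> ?S" using w[OF i0t] by auto
          then show ?thesis unfolding x True by blast
        next
          case False
          then have "i < i0" using i0[OF ij(1)] by simp
          then have "l i \<in> L i0" using l[of i] monoL[of "Suc i" i0] i0t by auto
          then show ?thesis unfolding x using left_ideal_mult[OF Li0] by simp
        qed
      qed
      finally have "wv (w i0 j0) \<in> span (colon (L i0) (l i0) \<union> ?S)"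
        using Li0 lc[OF i0t] by (intro span_colon) auto
      with w(3)[OF i0t] show False by blast
    qed
    with j0 show "\<exists>x\<in>J. ?f x \<notin> span ({} \<union> ?f ` (J - {x}))" by blast
  qed
  \<comment> \<open>The finitely many factors \<open>l i\<close> are combinations of words of some
    bounded length s, so multiplying by them shifts lengths only by a constant.\<close>
  have "finite (l ` {..<t})" "l ` {..<t} \<subseteq> carrier A" using lc by auto
  then obtain s where s: "l ` {..<t} \<subseteq> span (wv ` {w \<in> wds. length w \<le> s})"
    using finite_subset_words by blast
  have bound: "t * (n + 1) \<le> C * (n + s + 1)" for n
  proof -
    let ?N = "{w. normal w \<and> length w \<le> n + s}"
    have im: "?f ` ({..<t} \<times> {..n}) \<subseteq> span ({} \<union> wv ` ?N)"
    proof clarsimp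
      fix i j assume ij: "i < t" "j \<le> n"
      have "wv (w i j) \<otimes> l i \<in> span (wv ` {w \<in> wds. length w \<le> n + s})"
      proof (rule span_mult_left)
        show "l i \<in> span (wv ` {w \<in> wds. length w \<le> s})" using s ij by auto
        fix z assume "z \<in> wv ` {w \<in> wds. length w \<le> s}"
        then obtain u where u: "u \<in> wds" "length u \<le> s" "z = wv u" by auto
        then have "w i j @ u \<in> {w \<in> wds. length w \<le> n + s}" using w[OF ij(1)] ij(2) by (simp add: add_mono)
        then have "wv (w i j @ u) \<in> wv ` {w \<in> wds. length w \<le> n + s}" by (rule imageI)
        then show "wv (w i j) \<otimes> z \<in> span (wv ` {w \<in> wds. length w \<le> n + s})"
          using u by (intro span_base) (auto simp: wv_append)
      qed auto
      then show "wv (w i j) \<otimes> l i \<in> span (wv ` ?N)" using words_span_normal by blast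
    qed
    have "indep_over {} ?f ({..<t} \<times> {..n})" using indep by (rule indep_over_subset) auto
    then have "card ({..<t} \<times> {..n}) \<le> card (wv ` ?N)"
      using steinitz_card_le[OF finite_imageI[OF finite_normal_length_le] wv_image_closed empty_subsetI im]
      by blast
    also have "\<dots> \<le> card ?N" by (intro card_image_le finite_normal_length_le)
    also have "\<dots> \<le> (\<Sum>m\<le>n + s. C)" unfolding card_normal_length_le by (intro sum_mono C)
    finally show ?thesis by (simp add: algebra_simps)
  qed
  show "t \<le> C"
  proof (rule ccontr)
    assume "\<not> t \<le> C"
    \<comment> \<open>For n = C s and t = C + 1 the linear estimate already fails, by exactly
      1.\<close>
    then have "(C + 1) * (C * s + 1) \<le> t * (C * s + 1)" by (intro mult_le_mono1) simp
    also have "\<dots> \<le> C * (C * s + s + 1)" by (rule bound)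
    finally show False by (simp add: algebra_simps)
  qed
qed

text \<open>\<open>core\<close> makes the simple module A/M faithful, so a nonzero annihilator of
  finitely many classes can be cut down by one more class. Each cut has a factor containing a cyclic
  module that maps onto the infinite-dimensional A/M, and \<open>chain_length_le\<close> permits at
  most \<open>C\<close> of them.\<close>

lemma maximal_left_ideal_ann_mod_zero:
  assumes C: "\<And>m. card {w. normal w \<and> length w = m} \<le> C"
    and M: "maximal_left_ideal M" and nf: "\<not> finite_codim M"
    and core: "\<And>a. a \<in> carrier A \<Longrightarrow> (\<And>e. e \<in> carrier A \<Longrightarrow> a \<otimes> e \<in> M) \<Longrightarrow> a = \<zero>"
  shows "\<exists>E. finite E \<and> E \<subseteq> carrier A \<and> ann_mod M E = {\<zero>}"
proof (rule ccontr)
  assume n: "\<not> ?thesis"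
  have Ml: "left_ideal M" using M by (simp add: maximal_left_ideal_def)
  have "\<exists>e a. \<forall>i<t. e i \<in> carrier A \<and> a i \<in> ann_mod M (e ` {..<i}) \<and> a i \<otimes> e i \<ominus> \<one> \<in> M" for t :: nat
  proof (induction t)
    case (Suc t)
    then obtain e a where ea: "\<And>i. i < t \<Longrightarrow> e i \<in> carrier A \<and> a i \<in> ann_mod M (e ` {..<i}) \<and> a i \<otimes> e i \<ominus> \<one> \<in> M"
      by blast
    let ?E = "e ` {..<t}"
    have E: "finite ?E" "?E \<subseteq> carrier A" using ea by auto
    have li: "left_ideal (ann_mod M ?E)" using Ml E(2) by (rule left_ideal_ann_mod)
    have "ann_mod M ?E \<noteq> {\<zero>}" using n E by blast
    then obtain a' where a': "a' \<in> ann_mod M ?E" "a' \<noteq> \<zero>" using left_ideal_zero[OF li] by blast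
    then obtain e' where e': "e' \<in> carrier A" "a' \<otimes> e' \<notin> M"
      using core[of a'] left_ideal_carrier[OF li] by blast
    obtain b where b: "b \<in> ann_mod M ?E" "b \<otimes> e' \<ominus> \<one> \<in> M"
      using maximal_left_ideal_mult_one[OF M e'(1) li a'(1) e'(2)] by blast
    have eq: "(e(t := e')) ` {..<i} = e ` {..<i}" if "i \<le> t" for i
      using that by (intro image_cong) auto
    show ?case
    proof (rule exI[of _ "e(t := e')"], rule exI[of _ "a(t := b)"], intro allI impI)
      fix i assume "i < Suc t"
      then consider "i < t" | "i = t" by linarith
      then show "(e(t := e')) i \<in> carrier A \<and> (a(t := b)) i \<in> ann_mod M ((e(t := e')) ` {..<i}) \<and>
          (a(t := b)) i \<otimes> (e(t := e')) i \<ominus> \<one> \<in> M"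
      proof cases
        case 1
        then show ?thesis using ea[of i] eq[of i] by (simp del: fun_upd_image)
      next
        case 2
        then show ?thesis using b e' eq[of t] by (simp del: fun_upd_image)
      qed
    qed
  qed simp
  then obtain e a where ea: "\<And>i. i < Suc C \<Longrightarrow> e i \<in> carrier A \<and> a i \<in> ann_mod M (e ` {..<i}) \<and> a i \<otimes> e i \<ominus> \<one> \<in> M"
    by blast
  \<comment> \<open>Annihilators shrink as classes are added; reversing the index gives the
    ascending chain that \<open>chain_length_le\<close> expects.\<close>
  define L where "L i = ann_mod M (e ` {..<Suc C - i})" for i
  have Lc: "left_ideal (L i)" for i
    unfolding L_def using ea Ml by (intro left_ideal_ann_mod) auto
  have "Suc C \<le> C"
  proof (rule chain_length_le[OF C, of "Suc C" L "\<lambda>i. a (C - i)"])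
    fix i assume i: "i < Suc C"
    have *: "Suc C - i = Suc (C - i)" using i by simp
    show "L i \<subseteq> L (Suc i)"
      unfolding L_def ann_mod_def by auto
    show "a (C - i) \<in> L (Suc i)" using ea[of "C - i"] by (simp add: L_def)
    have a: "a (C - i) \<in> carrier A" "e (C - i) \<in> carrier A" "a (C - i) \<otimes> e (C - i) \<ominus> \<one> \<in> M"
      using ea[of "C - i"] by (auto simp: ann_mod_def)
    have "colon (L i) (a (C - i)) \<subseteq> M"
    proof
      fix b assume "b \<in> colon (L i) (a (C - i))"
      then have "b \<in> carrier A" "b \<otimes> a (C - i) \<otimes> e (C - i) \<in> M"
        by (auto simp: colon_def L_def * ann_mod_def)
      then show "b \<in> M" using colon_unit_mod[OF Ml a] by blast
    qed
    then show "\<not> finite_codim (colon (L i) (a (C - i)))" using nf finite_codim_mono by blast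
  qed (rule Lc)
  then show False by simp
qed

text \<open>By the choice of \<open>E\<close>, A embeds in a finite power of the
  infinite-dimensional simple module A/M, so all composition factors of A are copies of A/M and a
  finite-dimensional quotient A/I must vanish. Concretely, each element is moved within its class
  modulo \<open>I\<close> into the annihilator of \<open>E\<close>, one member of \<open>E\<close>
  at a time.\<close>

lemma finite_codim_left_ideal_eq_carrier:
  assumes M: "maximal_left_ideal M" and nf: "\<not> finite_codim M"
    and E: "finite E" "E \<subseteq> carrier A" "ann_mod M E = {\<zero>}"
    and I: "left_ideal I" "finite_codim I"
  shows "carrier A \<subseteq> I"
proof -
  have Ml: "left_ideal M" using M by (simp add: maximal_left_ideal_def)
  have "\<forall>x\<in>carrier A. \<exists>i\<in>I. x \<ominus> i \<in> ann_mod M E"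
    using E(1,2)
  proof (induction E)
    case empty
    show ?case using left_ideal_zero[OF I(1)] by (intro ballI bexI[of _ \<zero>]) (auto simp: ann_mod_empty)
  next
    case (insert e E)
    have E: "E \<subseteq> carrier A" and e: "e \<in> carrier A" using insert by auto
    have li: "left_ideal (ann_mod M E)" using Ml E by (rule left_ideal_ann_mod)
    show ?case
    proof
      fix x assume x: "x \<in> carrier A"
      then obtain i where i: "i \<in> I" "x \<ominus> i \<in> ann_mod M E" using insert by blast
      define a where "a = x \<ominus> i"
      have ic: "i \<in> carrier A" using i left_ideal_carrier[OF I(1)] by blast
      have a: "a \<in> ann_mod M E" "a \<in> carrier A" using i x ic by (auto simp: a_def)
      show "\<exists>i\<in>I. x \<ominus> i \<in> ann_mod M (insert e E)"
      proof (cases "a \<otimes> e \<in> M")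
        case True
        then show ?thesis using i a by (intro bexI[of _ i]) (auto simp: ann_mod_insert colon_def a_def)
      next
        case False
        have lIA: "left_ideal (I \<inter> ann_mod M E)" using I(1) li by (rule left_ideal_Int)
        \<comment> \<open>Otherwise some \<open>colon I a0\<close>, which has finite codimension
          together with \<open>I\<close>, would be contained in \<open>M\<close>.\<close>
        have "\<exists>b\<in>I \<inter> ann_mod M E. b \<otimes> e \<notin> M"
        proof (rule ccontr)
          assume n: "\<not> ?thesis"
          obtain a0 where a0: "a0 \<in> ann_mod M E" "a0 \<otimes> e \<ominus> \<one> \<in> M"
            using maximal_left_ideal_mult_one[OF M e li a(1) False] by blast
          have a0c: "a0 \<in> carrier A" using a0 left_ideal_carrier[OF li] by blast
          have "colon I a0 \<subseteq> M"
          proof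
            fix b assume b: "b \<in> colon I a0"
            then have bc: "b \<in> carrier A" "b \<otimes> a0 \<in> I" by (auto simp: colon_def)
            then have "b \<otimes> a0 \<otimes> e \<in> M" using n left_ideal_mult[OF li bc(1) a0(1)] by blast
            then show "b \<in> M" using colon_unit_mod[OF Ml a0c e a0(2) bc(1)] by blast
          qed
          then show False using finite_codim_colon[OF I a0c] finite_codim_mono nf by blast
        qed
        then obtain b where b: "b \<in> I \<inter> ann_mod M E" "b \<otimes> e \<ominus> \<one> \<in> M"
          using maximal_left_ideal_mult_one[OF M e lIA] by blast
        have bc: "b \<in> carrier A" using b left_ideal_carrier[OF I(1)] by blast
        have ae: "a \<otimes> e \<in> carrier A" using a e by simp
        \<comment> \<open>Since \<open>b\<close> sends the class of \<open>e\<close> to that of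
          \<open>\<one>\<close>, the product (a e) b acts on \<open>e\<close> as \<open>a\<close>
          does. Subtracting it kills \<open>e\<close> without changing the class modulo
          \<open>I\<close>.\<close>
        have 1: "(a \<otimes> e) \<otimes> b \<in> I" "(a \<otimes> e) \<otimes> b \<in> ann_mod M E"
          using left_ideal_mult[OF I(1) ae] left_ideal_mult[OF li ae] b by auto
        have "\<ominus> ((a \<otimes> e) \<otimes> (b \<otimes> e \<ominus> \<one>)) \<in> M"
          using left_ideal_mult[OF Ml ae b(2)] submodule_uminus[OF left_ideal_submodule[OF Ml]] by blast
        also have "\<ominus> ((a \<otimes> e) \<otimes> (b \<otimes> e \<ominus> \<one>)) = (a \<ominus> (a \<otimes> e) \<otimes> b) \<otimes> e"
          using a e bc by (simp add: a_minus_def r_distr l_distr r_minus l_minus minus_add minus_minus m_assoc a_comm)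
        finally have "a \<ominus> (a \<otimes> e) \<otimes> b \<in> ann_mod M (insert e E)"
          using left_ideal_minus[OF li a(1) 1(2)] a ae bc by (simp add: ann_mod_insert colon_def)
        moreover have "a \<ominus> (a \<otimes> e) \<otimes> b = x \<ominus> (i \<oplus> (a \<otimes> e) \<otimes> b)"
          unfolding a_def[symmetric] using x ic ae bc unfolding a_def
          by (simp add: a_minus_def minus_add a_assoc)
        moreover have "i \<oplus> (a \<otimes> e) \<otimes> b \<in> I" using left_ideal_add[OF I(1) i(1) 1(1)] .
        ultimately show ?thesis by auto
      qed
    qed
  qed
  then have *: "\<exists>i\<in>I. x \<ominus> i = \<zero>" if "x \<in> carrier A" for x using that E(3) by blast
  show ?thesis
  proof
    fix x assume x: "x \<in> carrier A"
    then obtain i where i: "i \<in> I" "x \<ominus> i = \<zero>" using * by blast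
    then have "x = i" using x left_ideal_carrier[OF I(1)] by (simp add: r_right_minus_eq)
    with i show "x \<in> I" by simp
  qed
qed

text \<open>
  Distinct \<open>\<mu>\<^sub>1, \<mu>\<^sub>2, \<dots>\<close> for which \<open>y - \<mu>\<^sub>i\<close> has no left inverse give the strictly descending
  chain of left ideals generated by the products \<open>(y - \<mu>\<^sub>1) \<cdots> (y - \<mu>\<^sub>i)\<close>.
\<close>

lemma shift_invertible_cofinite:
  assumes C: "\<And>m. card {w. normal w \<and> length w = m} \<le> C"
    and no: "\<And>I. left_ideal I \<Longrightarrow> finite_codim I \<Longrightarrow> carrier A \<subseteq> I"
    and y: "y \<in> carrier A"
  shows "finite {\<mu> \<in> carrier K. \<not> (\<exists>b\<in>carrier A. b \<otimes> shift y \<mu> = \<one>)}" (is "finite ?B")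
proof (rule ccontr)
  assume "infinite ?B"
  from infinite_arbitrarily_large[OF this, of "Suc C"]
  obtain F where F: "F \<subseteq> ?B" "finite F" "card F = Suc C" by (elim exE conjE)
  obtain \<mu>s where \<mu>s: "set \<mu>s = F" "distinct \<mu>s" using finite_distinct_list[OF F(2)] by blast
  have len: "length \<mu>s = Suc C" using \<mu>s F distinct_card by fastforce
  have sub: "set \<mu>s \<subseteq> carrier K" using \<mu>s F by blast
  \<comment> \<open>Dropping factors from the front of the list makes the principal left ideals
    ascend with i.\<close>
  define p where "p i = shift_prod y (drop i \<mu>s)" for i
  have dsub: "set (drop i \<mu>s) \<subseteq> carrier K" for i using sub set_drop_subset by fast
  have pk: "p i \<in> kpoly y" for i unfolding p_def using shift_prod_kpoly[OF y dsub] .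
  have pc: "p i \<in> carrier A" for i using kpoly_closed[OF y pk] .
  have step: "p i = p (Suc i) \<otimes> shift y (\<mu>s ! i)" if "i < Suc C" for i
  proof -
    have "drop i \<mu>s = \<mu>s ! i # drop (Suc i) \<mu>s" using that len by (simp add: Cons_nth_drop_Suc)
    then have "p i = shift y (\<mu>s ! i) \<otimes> p (Suc i)" by (simp add: p_def shift_prod_Cons)
    also have "\<dots> = p (Suc i) \<otimes> shift y (\<mu>s ! i)"
      using kpoly_shift(2)[OF y pk, of "\<mu>s ! i"] sub that len by (auto simp: nth_mem subset_iff)
    finally show ?thesis .
  qed
  define L where "L i = {b \<otimes> p i |b. b \<in> carrier A}" for i
  have Ll: "left_ideal (L i)" for i unfolding L_def using pc by (rule left_ideal_principal)
  have "Suc C \<le> C"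
  proof (rule chain_length_le[OF C, of "Suc C" L "\<lambda>i. p (Suc i)"])
    fix i assume i: "i < Suc C"
    have \<mu>: "\<mu>s ! i \<in> carrier K" "\<mu>s ! i \<in> ?B" using i len \<mu>s F by (auto simp: nth_mem subset_iff)
    have "p (Suc i) = \<one> \<otimes> p (Suc i)" using pc by simp
    then show "p (Suc i) \<in> L (Suc i)" unfolding L_def by blast
    have "p i \<in> L (Suc i)"
    proof -
      have "p i = shift y (\<mu>s ! i) \<otimes> p (Suc i)"
        using step[OF i] kpoly_shift(2)[OF y pk \<mu>(1)] by simp
      then show ?thesis unfolding L_def using y \<mu> by auto
    qed
    then show "L i \<subseteq> L (Suc i)" using left_ideal_mult[OF Ll] unfolding L_def[of i] by blast
    \<comment> \<open>By \<open>no\<close>, finite codimension would make \<open>p (Suc i)\<close> a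
      left multiple of \<open>p i\<close>; cancelling the coprime factors by
      \<open>shift_prod_cancel\<close>, with the whole algebra as \<open>N\<close>, would give a
      left inverse that is excluded.\<close>
    show "\<not> finite_codim (colon (L i) (p (Suc i)))"
    proof
      assume "finite_codim (colon (L i) (p (Suc i)))"
      then have "\<one> \<in> colon (L i) (p (Suc i))"
        using no[OF left_ideal_colon[OF Ll pc]] by auto
      then obtain b where b: "b \<in> carrier A" "p (Suc i) = b \<otimes> p i"
        using pc by (auto simp: colon_def L_def)
      then have "p (Suc i) = (b \<otimes> p (Suc i)) \<otimes> shift y (\<mu>s ! i)"
        using step[OF i] pc y \<mu> by (simp add: m_assoc)
      moreover have "\<mu>s ! i \<notin> set (drop (Suc i) \<mu>s)"
        using \<mu>s(2) i len by (auto simp: in_set_conv_nth nth_eq_iff_index_eq)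
      moreover have "submodule K (carrier A) A" using left_ideal_submodule[OF left_ideal_carrier_self] .
      moreover have "kpoly y \<subseteq> carrier A" using kpoly_closed[OF y] by blast
      ultimately have "\<exists>q\<in>carrier A. \<one> = q \<otimes> shift y (\<mu>s ! i)"
        using shift_prod_cancel[OF y \<mu>(1) _ _ dsub] b pc unfolding p_def by (metis m_closed)
      then show False using \<mu>(2) by force
    qed
  qed (rule Ll)
  then show False by simp
qed

text \<open>The assumption \<open>core\<close> says that A/M is faithful. Infinite codimension of
  \<open>M\<close> is refuted first, by making every element algebraic. With A/M finite-dimensional,
  the joint annihilator of finitely many representatives has finite codimension and is zero by
  faithfulness.\<close>

theorem maximal_left_ideal_core_zero_finite:
  assumes unc: "uncountable (carrier K)"
    and n: "n \<ge> 1" and few: "card {w. normal w \<and> length w = n} \<le> n"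
    and M: "maximal_left_ideal M"
    and core: "\<And>a. a \<in> carrier A \<Longrightarrow> (\<And>e. e \<in> carrier A \<Longrightarrow> a \<otimes> e \<in> M) \<Longrightarrow> a = \<zero>"
  shows "\<exists>W. finite W \<and> W \<subseteq> carrier A \<and> carrier A \<subseteq> span W"
proof -
  have Ml: "left_ideal M" using M by (simp add: maximal_left_ideal_def)
  have fM: "finite_codim M"
  proof (rule ccontr)
    assume nf: "\<not> finite_codim M"
    obtain C where C: "\<And>m. card {w. normal w \<and> length w = m} \<le> C" using normal_bounded[OF n few] by blast
    obtain E where E: "finite E" "E \<subseteq> carrier A" "ann_mod M E = {\<zero>}"
      using maximal_left_ideal_ann_mod_zero[OF C M nf core] by blast
    have no: "carrier A \<subseteq> I" if "left_ideal I" "finite_codim I" for I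
      using finite_codim_left_ideal_eq_carrier[OF M nf E that] .
    have alg: "algebraic_over y" if y: "y \<in> carrier A" for y
    proof (rule amitsur[OF y, of "\<lambda>n. wv ` {w \<in> wds. length w \<le> n}"])
      have "finite {\<mu> \<in> carrier K. \<not> (\<exists>b\<in>carrier A. b \<otimes> shift y \<mu> = \<one>)}" (is "finite ?B")
        using shift_invertible_cofinite[OF C no y] .
      then have "uncountable (carrier K - ?B)"
        using unc by (simp add: uncountable_minus_countable countable_finite)
      then show "uncountable {\<mu> \<in> carrier K. \<exists>b\<in>carrier A. b \<otimes> shift y \<mu> = \<one>}"
        by (rule contrapos_nn) (erule countable_subset[rotated], blast)
    qed (use finite_words_length carrier_words_length in auto)
    have "finite {w. normal w}" using normal_finite_of_algebraic[OF n few alg] .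
    then have "finite_codim {\<zero>}"
      unfolding finite_codim_def using carrier_normal_span span_is_monotone[of "wv ` {w. normal w}" "{\<zero>} \<union> wv ` {w. normal w}"]
      by (intro exI[of _ "wv ` {w. normal w}"]) auto
    moreover have "left_ideal {\<zero>}" by (auto simp: left_ideal_def)
    \<comment> \<open>The zero left ideal now has finite codimension and must be everything, which
      contradicts that \<open>\<one>\<close> lies outside \<open>M\<close>.\<close>
    ultimately have "carrier A \<subseteq> {\<zero>}" using no by blast
    then have "\<one> = \<zero>" by blast
    then show False using M left_ideal_zero[OF Ml] by (simp add: maximal_left_ideal_def)
  qed
  then obtain W where W: "finite W" "W \<subseteq> carrier A" "carrier A \<subseteq> span (M \<union> W)"
    by (auto simp: finite_codim_def)
  have Mc: "M \<union> W \<subseteq> carrier A" using W Ml by (auto simp: left_ideal_def)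
  have "ann_mod M W \<subseteq> {\<zero>}"
  proof
    fix a assume a: "a \<in> ann_mod M W"
    then have ac: "a \<in> carrier A" by (simp add: ann_mod_def)
    have "a = \<zero>"
    proof (rule core[OF ac])
      fix e assume "e \<in> carrier A"
      then have "e \<in> span (M \<union> W)" using W by blast
      then have "a \<otimes> e \<in> span M"
      proof (rule span_mult_left[OF _ Mc ac])
        fix s assume "s \<in> M \<union> W"
        then have "a \<otimes> s \<in> M" using a left_ideal_mult[OF Ml ac] by (auto simp: ann_mod_def)
        then show "a \<otimes> s \<in> span M" using Mc by (intro span_base) auto
      qed (use Mc in auto)
      then show "a \<otimes> e \<in> M" using span_eq_self[OF left_ideal_submodule[OF Ml]] by simp
    qed
    then show "a \<in> {\<zero>}" by simp
  qed
  moreover have "finite_codim (ann_mod M W)"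
    using finite_codim_ann_mod[OF Ml W(1,2)] finite_codim_colon[OF Ml fM] by blast
  ultimately have "finite_codim {\<zero>}" by (rule finite_codim_mono[rotated])
  then obtain X where X: "finite X" "X \<subseteq> carrier A" "carrier A \<subseteq> span ({\<zero>} \<union> X)"
    by (auto simp: finite_codim_def)
  then show ?thesis by (intro exI[of _ "{\<zero>} \<union> X"]) auto
qed

end

section \<open>Quotients\<close>

context k_algebra
begin

lemma span_powers_sum:
  assumes x: "x \<in> carrier A"
  shows "s \<in> span (powers x n) \<Longrightarrow>
    \<exists>a :: nat \<Rightarrow> 'a. range a \<subseteq> carrier K \<and> s = (\<Oplus>i\<in>{..<n}. a i \<odot> x [^] i)"
proof (induction n arbitrary: s)
  case 0
  then have "s = \<zero>" by (simp add: powers_def span_empty)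
  then show ?case by (intro exI[of _ "\<lambda>_. \<zero>\<^bsub>K\<^esub>"]) auto
next
  case (Suc n)
  obtain c t where ct: "c \<in> carrier K" "t \<in> span (powers x n)" "s = c \<odot> x [^] n \<oplus> t"
    using Suc.prems unfolding powers_Suc by (rule span_insertE) (use x powers_closed in auto)
  obtain a where a: "range a \<subseteq> carrier K" "t = (\<Oplus>i\<in>{..<n}. a i \<odot> x [^] i)"
    using Suc.IH[OF ct(2)] by blast
  have ac: "a i \<in> carrier K" for i using a by auto
  let ?a = "a(n := c)"
  have "(\<Oplus>i\<in>{..<Suc n}. ?a i \<odot> x [^] i) = ?a n \<odot> x [^] n \<oplus> (\<Oplus>i\<in>{..<n}. ?a i \<odot> x [^] i)"
    unfolding lessThan_Suc using ac ct x by (intro finsum_insert) auto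
  also have "(\<Oplus>i\<in>{..<n}. ?a i \<odot> x [^] i) = t"
    unfolding a(2) using ac x by (intro finsum_cong') auto
  finally have "s = (\<Oplus>i\<in>{..<Suc n}. ?a i \<odot> x [^] i)" using ct by simp
  moreover have "range ?a \<subseteq> carrier K" using ac ct by auto
  ultimately show ?case by blast
qed

text \<open>Links the relation among powers with evaluation of polynomials: one direction divides by
  the leading coefficient, the other writes down the monic polynomial with the negated coefficients
  of the relation.\<close>

lemma algebraic_element_iff:
  assumes x: "x \<in> carrier A"
  shows "algebraic_element K A x \<longleftrightarrow> algebraic_over x"
proof
  interpret UP: UP_ring K "UP K" by unfold_locales
  assume "algebraic_element K A x"
  then obtain p where p: "p \<in> carrier (UP K)" "p \<noteq> \<zero>\<^bsub>UP K\<^esub>"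
    and ev: "UnivPoly.eval K A (\<lambda>c. c \<odot> \<one>) x p = \<zero>"
    by (auto simp: algebraic_element_def)
  define n where "n = deg K p"
  let ?c = "coeff (UP K) p"
  have cc: "?c i \<in> carrier K" for i using p(1) by (rule UP.coeff_closed)
  have c0: "?c n \<noteq> \<zero>\<^bsub>K\<^esub>" unfolding n_def using UP.lcoeff_nonzero p by blast
  have "\<zero> = (\<Oplus>i\<in>{..n}. ?c i \<odot> \<one> \<otimes> x [^] i)"
    using ev p by (simp add: UnivPoly.eval_def n_def)
  also have "\<dots> = ?c n \<odot> \<one> \<otimes> x [^] n \<oplus> (\<Oplus>i\<in>{..<n}. ?c i \<odot> \<one> \<otimes> x [^] i)"
    unfolding lessThan_Suc_atMost[symmetric] lessThan_Suc using cc x by (intro finsum_insert) auto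
  finally have eq: "\<zero> = ?c n \<odot> x [^] n \<oplus> (\<Oplus>i\<in>{..<n}. ?c i \<odot> \<one> \<otimes> x [^] i)" (is "_ = _ \<oplus> ?s")
    using cc x by simp
  have s: "?s \<in> span (powers x n)"
  proof (rule submodule_finsum)
    show "submodule K (span (powers x n)) A" using x by (intro span_is_submodule powers_closed)
    fix i assume "i \<in> {..<n}"
    then show "?c i \<odot> \<one> \<otimes> x [^] i \<in> span (powers x n)"
      using cc x powers_span[OF x, of i n] span_smult[OF powers_closed[OF x]] by simp
  qed
  have sc: "?s \<in> carrier A" using span_in_carrier[OF powers_closed[OF x] s] .
  have "\<ominus> ?s = ?c n \<odot> x [^] n"
    by (rule minus_equality[OF eq[symmetric] sc]) (use cc x in simp)
  then have in_span: "?c n \<odot> x [^] n \<in> span (powers x n)"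
    using span_uminus[OF powers_closed[OF x] s] by simp
  note i = smult_inverse_cancel[OF cc c0 nat_pow_closed[OF x, of n]]
  have "inv\<^bsub>K\<^esub> ?c n \<odot> (?c n \<odot> x [^] n) \<in> span (powers x n)"
    by (rule span_smult[OF powers_closed[OF x] i(1) in_span])
  then have "x [^] n \<in> span (powers x n)" by (simp only: i(2))
  then show "algebraic_over x" unfolding algebraic_over_def by blast
next
  interpret UP: UP_ring K "UP K" by unfold_locales
  assume "algebraic_over x"
  then obtain n where "x [^] n \<in> span (powers x n)" by (auto simp: algebraic_over_def)
  then obtain a where a: "range a \<subseteq> carrier K" "x [^] n = (\<Oplus>i\<in>{..<n}. a i \<odot> x [^] i)"
    using span_powers_sum[OF x] by blast
  have ac: "a i \<in> carrier K" for i using a by auto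
  define p where "p i = (if i < n then \<ominus>\<^bsub>K\<^esub> a i else if i = n then \<one>\<^bsub>K\<^esub> else \<zero>\<^bsub>K\<^esub>)" for i
  have "p \<in> up K"
  proof (rule mem_upI)
    show "p i \<in> carrier K" for i using ac by (simp add: p_def)
    show "\<exists>n. bound \<zero>\<^bsub>K\<^esub> n p" by (intro exI[of _ n] bound.intro) (simp add: p_def)
  qed
  then have p: "p \<in> carrier (UP K)" by (simp add: UP_def)
  have cf: "coeff (UP K) p = p" using \<open>p \<in> up K\<close> by (simp add: UP_def)
  have deg: "deg K p = n"
  proof (rule le_antisym)
    show "deg K p \<le> n" by (rule UP.deg_aboveI[OF _ p]) (simp add: cf p_def)
    show "n \<le> deg K p" by (rule UP.deg_belowI[OF _ p]) (simp add: cf p_def)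
  qed
  have "p \<noteq> \<zero>\<^bsub>UP K\<^esub>"
  proof
    assume "p = \<zero>\<^bsub>UP K\<^esub>"
    then have "coeff (UP K) p n = \<zero>\<^bsub>K\<^esub>" by simp
    then show False by (simp add: cf p_def)
  qed
  moreover have "UnivPoly.eval K A (\<lambda>c. c \<odot> \<one>) x p = \<zero>"
  proof -
    have "UnivPoly.eval K A (\<lambda>c. c \<odot> \<one>) x p = (\<Oplus>i\<in>{..n}. p i \<odot> \<one> \<otimes> x [^] i)"
      using p by (simp add: UnivPoly.eval_def cf deg)
    also have "\<dots> = p n \<odot> \<one> \<otimes> x [^] n \<oplus> (\<Oplus>i\<in>{..<n}. p i \<odot> \<one> \<otimes> x [^] i)"
      unfolding lessThan_Suc_atMost[symmetric] lessThan_Suc using ac x by (intro finsum_insert) (auto simp: p_def)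
    also have "(\<Oplus>i\<in>{..<n}. p i \<odot> \<one> \<otimes> x [^] i) = (\<Oplus>i\<in>{..<n}. \<ominus> (a i \<odot> x [^] i))"
      using ac x by (intro finsum_cong') (auto simp: p_def smult_l_minus l_minus)
    also have "\<dots> = \<ominus> (\<Oplus>i\<in>{..<n}. a i \<odot> x [^] i)"
    proof -
      have "(\<Oplus>i\<in>F. \<ominus> (a i \<odot> x [^] i)) = \<ominus> (\<Oplus>i\<in>F. a i \<odot> x [^] i)" if "finite F" for F
        using that by (induction F) (use ac x in \<open>auto simp: minus_add\<close>)
      then show ?thesis by simp
    qed
    also have "\<dots> = \<ominus> (x [^] n)" by (simp flip: a(2))
    finally have "UnivPoly.eval K A (\<lambda>c. c \<odot> \<one>) x p = p n \<odot> \<one> \<otimes> x [^] n \<oplus> \<ominus> (x [^] n)" .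
    moreover have "p n = \<one>\<^bsub>K\<^esub>" by (simp add: p_def)
    ultimately show ?thesis using x by (simp add: r_neg)
  qed
  ultimately show "algebraic_element K A x" using p by (auto simp: algebraic_element_def)
qed

end

text \<open>An arbitrary surjective homomorphism, so that statements about a quotient never open the
  coset construction. The images of the letters generate \<open>B\<close>, and a word has its value
  in \<open>R\<close> and in \<open>B\<close> at the same time.\<close>

locale algebra_quotient = R: generated_algebra K R \<sigma> g + B: k_algebra K B
  for K :: "('k, 'd) ring_scheme" and R :: "('k, 'a, 'm) module_scheme" and \<sigma> g
    and B :: "('k, 'b, 'n) module_scheme" +
  fixes h :: "'a \<Rightarrow> 'b"
  assumes h_surj: "h ` carrier R = carrier B"
    and h_add: "x \<in> carrier R \<Longrightarrow> y \<in> carrier R \<Longrightarrow> h (x \<oplus>\<^bsub>R\<^esub> y) = h x \<oplus>\<^bsub>B\<^esub> h y"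
    and h_mult: "x \<in> carrier R \<Longrightarrow> y \<in> carrier R \<Longrightarrow> h (x \<otimes>\<^bsub>R\<^esub> y) = h x \<otimes>\<^bsub>B\<^esub> h y"
    and h_one: "h \<one>\<^bsub>R\<^esub> = \<one>\<^bsub>B\<^esub>"
    and h_smult: "c \<in> carrier K \<Longrightarrow> x \<in> carrier R \<Longrightarrow> h (c \<odot>\<^bsub>R\<^esub> x) = c \<odot>\<^bsub>B\<^esub> h x"
begin

lemma h_closed: "x \<in> carrier R \<Longrightarrow> h x \<in> carrier B"
  using h_surj by blast

lemma h_zero: "h \<zero>\<^bsub>R\<^esub> = \<zero>\<^bsub>B\<^esub>"
proof -
  have "h (\<zero>\<^bsub>K\<^esub> \<odot>\<^bsub>R\<^esub> \<zero>\<^bsub>R\<^esub>) = \<zero>\<^bsub>K\<^esub> \<odot>\<^bsub>B\<^esub> h \<zero>\<^bsub>R\<^esub>" by (rule h_smult) auto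
  then show ?thesis using h_closed by simp
qed

lemma h_minus:
  assumes "x \<in> carrier R" "y \<in> carrier R" shows "h (x \<ominus>\<^bsub>R\<^esub> y) = h x \<ominus>\<^bsub>B\<^esub> h y"
proof -
  have "h x = h (x \<ominus>\<^bsub>R\<^esub> y) \<oplus>\<^bsub>B\<^esub> h y"
    using assms h_add[of "x \<ominus>\<^bsub>R\<^esub> y" y] by (simp add: R.minus_add_self)
  then show ?thesis using assms h_closed
    by (simp add: a_minus_def B.a_assoc B.r_neg)
qed

lemma h_span:
  assumes "x \<in> R.span S" "S \<subseteq> carrier R" shows "h x \<in> B.span (h ` S)"
proof -
  have c: "h ` S \<subseteq> carrier B" using assms(2) h_closed by blast
  show ?thesis using assms
  proof (induction rule: R.span_induct)
    case (base s)
    then show ?case using B.span_base[OF c] by blast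
  qed (use c in \<open>auto simp: h_zero h_add h_smult intro: B.span_zero B.span_add B.span_smult\<close>)
qed

lemma h_span_lift:
  assumes "y \<in> B.span (h ` S)" "S \<subseteq> carrier R" shows "\<exists>x\<in>R.span S. h x = y"
proof -
  have c: "h ` S \<subseteq> carrier B" using assms(2) h_closed by blast
  note sc = R.span_in_carrier[OF assms(2)]
  show ?thesis using assms(1) c
  proof (induction rule: B.span_induct)
    case (base s)
    then show ?case using R.span_base[OF assms(2)] by blast
  next
    case zero
    then show ?case using R.span_zero[OF assms(2)] h_zero by blast
  next
    case (add u v)
    then obtain x y where "x \<in> R.span S" "y \<in> R.span S" "h x = u" "h y = v" by blast
    then show ?case using sc R.span_add[OF assms(2)] by (intro bexI[of _ "x \<oplus>\<^bsub>R\<^esub> y"]) (auto simp: h_add)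
  next
    case (smult c u)
    then obtain x where "x \<in> R.span S" "h x = u" by blast
    then show ?case using sc smult R.span_smult[OF assms(2)]
      by (intro bexI[of _ "c \<odot>\<^bsub>R\<^esub> x"]) (auto simp: h_smult)
  qed
qed

lemma h_word: "word_value B (h \<circ> \<sigma>) w = h (R.wv w)"
  by (induction w) (auto simp: word_value_def h_one h_mult R.wv_closed[unfolded word_value_def])

sublocale B: generated_algebra K B "h \<circ> \<sigma>" g
proof unfold_locales
  show "range (h \<circ> \<sigma>) \<subseteq> carrier B" using h_closed by auto
  show "carrier B \<subseteq> B.span (word_value B (h \<circ> \<sigma>) ` lists {..<g})"
  proof
    fix y assume "y \<in> carrier B"
    then obtain x where x: "x \<in> carrier R" "y = h x" using h_surj by blast
    then have "h x \<in> B.span (h ` R.wv ` lists {..<g})" using R.generated by (intro h_span) auto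
    also have "h ` R.wv ` lists {..<g} = word_value B (h \<circ> \<sigma>) ` lists {..<g}"
      by (simp add: image_image h_word)
    finally show "y \<in> B.span (word_value B (h \<circ> \<sigma>) ` lists {..<g})" using x by simp
  qed
qed

lemma h_pow: "x \<in> carrier R \<Longrightarrow> h (x [^]\<^bsub>R\<^esub> (n::nat)) = h x [^]\<^bsub>B\<^esub> n"
  by (induction n) (auto simp: h_one h_mult)

lemma h_powers: "x \<in> carrier R \<Longrightarrow> h ` R.powers x n = B.powers (h x) n"
  by (auto simp: R.powers_def B.powers_def h_pow image_image)

text \<open>Linear combinations of powers lift along \<open>h\<close>, so algebraicity of an image
  means that the kernel contains a monic value.\<close>

lemma algebraic_over_h:
  assumes x: "x \<in> carrier R"
  shows "B.algebraic_over (h x) \<longleftrightarrow> (\<exists>n. \<exists>p\<in>R.monic x n. h p = \<zero>\<^bsub>B\<^esub>)"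
proof -
  have "\<zero>\<^bsub>B\<^esub> \<in> B.monic (h x) n \<longleftrightarrow> (\<exists>p\<in>R.monic x n. h p = \<zero>\<^bsub>B\<^esub>)" for n
  proof
    assume "\<zero>\<^bsub>B\<^esub> \<in> B.monic (h x) n"
    then obtain s where s: "s \<in> B.span (B.powers (h x) n)" "\<zero>\<^bsub>B\<^esub> = h x [^]\<^bsub>B\<^esub> n \<oplus>\<^bsub>B\<^esub> s"
      by (auto simp: B.monic_def)
    then obtain t where t: "t \<in> R.span (R.powers x n)" "h t = s"
      using h_span_lift[of s "R.powers x n"] R.powers_closed[OF x] by (auto simp: h_powers x)
    have "t \<in> carrier R" using R.span_in_carrier[OF R.powers_closed[OF x] t(1)] .
    then have "h (x [^]\<^bsub>R\<^esub> n \<oplus>\<^bsub>R\<^esub> t) = \<zero>\<^bsub>B\<^esub>" using s t x by (simp add: h_add h_pow)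
    then show "\<exists>p\<in>R.monic x n. h p = \<zero>\<^bsub>B\<^esub>" using t by (auto simp: R.monic_def)
  next
    assume "\<exists>p\<in>R.monic x n. h p = \<zero>\<^bsub>B\<^esub>"
    then obtain t where t: "t \<in> R.span (R.powers x n)" "h (x [^]\<^bsub>R\<^esub> n \<oplus>\<^bsub>R\<^esub> t) = \<zero>\<^bsub>B\<^esub>"
      by (auto simp: R.monic_def)
    have "t \<in> carrier R" using R.span_in_carrier[OF R.powers_closed[OF x] t(1)] .
    then have "\<zero>\<^bsub>B\<^esub> = h x [^]\<^bsub>B\<^esub> n \<oplus>\<^bsub>B\<^esub> h t" using t x by (simp add: h_add h_pow)
    moreover have "h t \<in> B.span (B.powers (h x) n)"
      using h_span[OF t(1) R.powers_closed[OF x]] by (simp add: h_powers x)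
    ultimately show "\<zero>\<^bsub>B\<^esub> \<in> B.monic (h x) n" by (auto simp: B.monic_def)
  qed
  then show ?thesis using B.algebraic_over_iff_monic[OF h_closed[OF x]] by simp
qed

lemma regular_power_cancel:
  assumes c: "c \<in> carrier R" and reg: "\<And>r. r \<in> carrier R \<Longrightarrow> c \<otimes>\<^bsub>R\<^esub> r = \<zero>\<^bsub>R\<^esub> \<Longrightarrow> r = \<zero>\<^bsub>R\<^esub>"
    and ab: "a \<in> carrier R" "b \<in> carrier R"
  shows "c [^]\<^bsub>R\<^esub> (i::nat) \<otimes>\<^bsub>R\<^esub> a = c [^]\<^bsub>R\<^esub> i \<otimes>\<^bsub>R\<^esub> b \<Longrightarrow> a = b"
proof (induction i)
  case (Suc i)
  have "c \<otimes>\<^bsub>R\<^esub> (c [^]\<^bsub>R\<^esub> i \<otimes>\<^bsub>R\<^esub> z) = c [^]\<^bsub>R\<^esub> Suc i \<otimes>\<^bsub>R\<^esub> z" if "z \<in> carrier R" for z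
    unfolding R.nat_pow_Suc2[OF c] using that c by (simp add: R.m_assoc)
  then have "c \<otimes>\<^bsub>R\<^esub> (c [^]\<^bsub>R\<^esub> i \<otimes>\<^bsub>R\<^esub> a) = c \<otimes>\<^bsub>R\<^esub> (c [^]\<^bsub>R\<^esub> i \<otimes>\<^bsub>R\<^esub> b)"
    using Suc.prems ab by simp
  then have "c \<otimes>\<^bsub>R\<^esub> (c [^]\<^bsub>R\<^esub> i \<otimes>\<^bsub>R\<^esub> a \<ominus>\<^bsub>R\<^esub> c [^]\<^bsub>R\<^esub> i \<otimes>\<^bsub>R\<^esub> b) = \<zero>\<^bsub>R\<^esub>"
    using c ab by (simp add: a_minus_def R.r_distr R.r_minus R.r_neg)
  then have "c [^]\<^bsub>R\<^esub> i \<otimes>\<^bsub>R\<^esub> a \<ominus>\<^bsub>R\<^esub> c [^]\<^bsub>R\<^esub> i \<otimes>\<^bsub>R\<^esub> b = \<zero>\<^bsub>R\<^esub>" by (rule reg[rotated]) (use c ab in auto)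
  then show ?case using Suc.IH c ab by (simp add: R.r_right_minus_eq)
qed (use ab in simp)

text \<open>
  Since \<open>c R\<close> maps to \<open>0\<close> and left multiplication by \<open>c\<close> is injective, \<open>n\<close> translates
  \<open>c\<^sup>i w\<close> of the normal words of the quotient are independent in \<open>R\<close>: passing to the quotient
  drops the growth exponent by at least one.
\<close>

theorem few_normal_words:
  assumes gk: "GKdim K R < 3" and c: "c \<in> carrier R" "h c = \<zero>\<^bsub>B\<^esub>"
    and reg: "\<And>r. r \<in> carrier R \<Longrightarrow> c \<otimes>\<^bsub>R\<^esub> r = \<zero>\<^bsub>R\<^esub> \<Longrightarrow> r = \<zero>\<^bsub>R\<^esub>"
  shows "\<exists>n\<ge>1. card {w. B.normal w \<and> length w = n} \<le> n"
proof (rule ccontr)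
  assume "\<not> ?thesis"
  then have "1 \<le> m \<longrightarrow> \<not> card {w. B.normal w \<and> length w = m} \<le> m" for m by blast
  then have many: "m \<le> card {w. B.normal w \<and> length w = m}" for m
    by (cases m) (auto simp: not_le intro: less_imp_le)
  \<comment> \<open>With \<open>c\<close> among the generators,
    \<open>c [^] i \<otimes> wv w\<close> has degree i plus the length of w.\<close>
  let ?W = "insert c (\<sigma> ` {..<g})"
  let ?V = "R.span ?W"
  have Wc: "finite ?W" "?W \<subseteq> carrier R" using c by auto
  have Vc: "?V \<subseteq> carrier R" using Wc by (intro R.span_is_subset2)
  have WV: "?W \<subseteq> ?V" using Wc by (intro R.in_own_span)
  let ?f = "\<lambda>(i, w). c [^]\<^bsub>R\<^esub> (i::nat) \<otimes>\<^bsub>R\<^esub> R.wv w"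
  have indep: "R.indep_over {} ?f (UNIV \<times> {w. B.normal w})"
    unfolding R.indep_over_def
  proof (intro allI impI, elim conjE)
    fix J :: "(nat \<times> nat list) set" assume J: "J \<subseteq> UNIV \<times> {w. B.normal w}" "finite J" "J \<noteq> {}"
    \<comment> \<open>The leading member has the least power of \<open>c\<close> and, among these,
      the largest word. After cancelling that power, all other members are values of smaller words
      or multiples of \<open>c\<close>, and the latter die in the quotient.\<close>
    define i0 where "i0 = Min (fst ` J)"
    have "i0 \<in> fst ` J" unfolding i0_def using J by (intro Min_in) auto
    have i0: "i0 \<le> i" if "(i, w) \<in> J" for i w
      unfolding i0_def using J that by (intro Min_le) (auto intro: rev_image_eqI)
    define Js where "Js = {w. (i0, w) \<in> J}"
    have Js: "finite Js" "Js \<noteq> {}"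
      using finite_subset[of Js "snd ` J"] J \<open>i0 \<in> fst ` J\<close> by (force simp: Js_def)+
    define w0 where "w0 = Max Js"
    have w0: "(i0, w0) \<in> J" using Max_in[OF Js] by (simp add: Js_def w0_def)
    have w0m: "w \<le> w0" if "(i0, w) \<in> J" for w
      unfolding w0_def using Js that by (intro Max_ge) (auto simp: Js_def)
    let ?S = "R.wv ` {u \<in> lists {..<g}. u < w0} \<union> {c \<otimes>\<^bsub>R\<^esub> r |r. r \<in> carrier R}"
    have Sc: "?S \<subseteq> carrier R" using c by auto
    have "?f (i0, w0) \<notin> R.span ({} \<union> ?f ` (J - {(i0, w0)}))"
    proof
      assume "?f (i0, w0) \<in> R.span ({} \<union> ?f ` (J - {(i0, w0)}))"
      also have "\<dots> \<subseteq> R.span ((\<lambda>s. c [^]\<^bsub>R\<^esub> i0 \<otimes>\<^bsub>R\<^esub> s) ` ?S)"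
      proof (rule R.span_is_monotone, rule subsetI)
        fix x assume "x \<in> {} \<union> ?f ` (J - {(i0, w0)})"
        then obtain i w where iw: "(i, w) \<in> J" "(i, w) \<noteq> (i0, w0)"
          and x: "x = c [^]\<^bsub>R\<^esub> i \<otimes>\<^bsub>R\<^esub> R.wv w" by auto
        show "x \<in> (\<lambda>s. c [^]\<^bsub>R\<^esub> i0 \<otimes>\<^bsub>R\<^esub> s) ` ?S"
        proof (cases "i = i0")
          case True
          then have "w < w0" using iw w0m[of w] by auto
          moreover have "w \<in> lists {..<g}" using iw J B.normal_wds by blast
          ultimately have "R.wv w \<in> ?S" by blast
          then show ?thesis unfolding x True by (rule imageI)
        next
          case False
          then have i: "i = i0 + Suc (i - i0 - 1)" using i0[OF iw(1)] by simp
          have "x = c [^]\<^bsub>R\<^esub> i0 \<otimes>\<^bsub>R\<^esub> (c [^]\<^bsub>R\<^esub> Suc (i - i0 - 1) \<otimes>\<^bsub>R\<^esub> R.wv w)"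
            unfolding x by (subst i) (use c in \<open>simp add: R.m_assoc flip: R.nat_pow_mult del: R.nat_pow_Suc\<close>)
          also have "c [^]\<^bsub>R\<^esub> Suc (i - i0 - 1) \<otimes>\<^bsub>R\<^esub> R.wv w = c \<otimes>\<^bsub>R\<^esub> (c [^]\<^bsub>R\<^esub> (i - i0 - 1) \<otimes>\<^bsub>R\<^esub> R.wv w)"
            unfolding R.nat_pow_Suc2[OF c(1)] using c by (simp add: R.m_assoc)
          finally have x': "x = c [^]\<^bsub>R\<^esub> i0 \<otimes>\<^bsub>R\<^esub> (c \<otimes>\<^bsub>R\<^esub> (c [^]\<^bsub>R\<^esub> (i - i0 - 1) \<otimes>\<^bsub>R\<^esub> R.wv w))" .
          have "c \<otimes>\<^bsub>R\<^esub> (c [^]\<^bsub>R\<^esub> (i - i0 - 1) \<otimes>\<^bsub>R\<^esub> R.wv w) \<in> ?S" using c by auto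
          then show ?thesis unfolding x' by (rule imageI)
        qed
      qed
      finally have in_span: "?f (i0, w0) \<in> R.span ((\<lambda>s. c [^]\<^bsub>R\<^esub> i0 \<otimes>\<^bsub>R\<^esub> s) ` ?S)" .
      obtain y where y: "y \<in> R.span ?S" "?f (i0, w0) = c [^]\<^bsub>R\<^esub> i0 \<otimes>\<^bsub>R\<^esub> y"
        using R.span_image_mult_left[OF in_span Sc R.nat_pow_closed[OF c(1)]] by (elim bexE)
      have yc: "y \<in> carrier R" using R.span_in_carrier[OF Sc y(1)] .
      have "R.wv w0 = y" using y(2) regular_power_cancel[OF c(1) reg R.wv_closed yc] by simp
      then have "h (R.wv w0) \<in> B.span (h ` ?S)" using h_span[OF y(1) Sc] by simp
      also have "\<dots> \<subseteq> B.span (B.wv ` {u \<in> lists {..<g}. u < w0})"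
      proof (rule B.span_subset_span)
        show "h ` ?S \<subseteq> B.span (B.wv ` {u \<in> lists {..<g}. u < w0})"
        proof
          fix z assume "z \<in> h ` ?S"
          then consider u where "u \<in> lists {..<g}" "u < w0" "z = h (R.wv u)"
            | r where "r \<in> carrier R" "z = h (c \<otimes>\<^bsub>R\<^esub> r)" by blast
          then show "z \<in> B.span (B.wv ` {u \<in> lists {..<g}. u < w0})"
          proof cases
            case 1
            then show ?thesis by (intro B.span_base[OF B.wv_image_closed]) (auto simp flip: h_word)
          next
            case 2
            then have "z = \<zero>\<^bsub>B\<^esub>" using c h_closed by (simp add: h_mult)
            then show ?thesis by (simp add: B.span_zero)
          qed
        qed
      qed simp
      finally have "B.wv w0 \<in> B.span (B.wv ` {u \<in> lists {..<g}. u < w0})" by (simp add: h_word)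
      moreover have "B.normal w0" using w0 J by blast
      ultimately show False by (simp add: B.normal_def)
    qed
    with w0 show "\<exists>x\<in>J. ?f x \<notin> R.span ({} \<union> ?f ` (J - {x}))" by blast
  qed
  have "n ^ 3 \<le> 2 * growth K R ?V (2 * n)" for n
  proof -
    let ?N = "{w. B.normal w \<and> length w \<le> n}"
    let ?I = "{..n} \<times> ?N"
    have im: "?f ` ?I \<subseteq> R.growth_space ?V (2 * n)"
    proof
      fix z assume "z \<in> ?f ` ?I"
      then obtain i w where iw: "i \<le> n" "B.normal w" "length w \<le> n" "z = c [^]\<^bsub>R\<^esub> i \<otimes>\<^bsub>R\<^esub> R.wv w" by auto
      have "z \<in> space_power K R ?V (i + length w)"
        unfolding iw(4) using WV B.normal_wds[OF iw(2)] by (intro R.power_word_growth[OF Vc]) auto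
      then show "z \<in> R.growth_space ?V (2 * n)"
        using iw by (intro R.space_power_growth_space[OF Vc]) auto
    qed
    have ind: "R.indep_over {} ?f ?I" using indep by (rule R.indep_over_subset) auto
    have "card ?I \<le> growth K R ?V (2 * n)" using R.card_le_growth[OF order_refl Wc im ind] by simp
    \<comment> \<open>There are n + 1 powers of \<open>c\<close> and at least 0 + 1 + ... + n normal
      words, hence at least half of n (n + 1) (n + 1) products.\<close>
    moreover have "n ^ 3 \<le> 2 * card ?I"
    proof -
      have "(\<Sum>m\<le>n. m) \<le> card ?N" unfolding B.card_normal_length_le by (intro sum_mono many)
      moreover have "2 * (\<Sum>m\<le>n. m) = n * (n + 1)"
        by (induction n) (auto simp: algebra_simps)
      ultimately have "n * (n + 1) \<le> 2 * card ?N" by linarith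
      then have "(n + 1) * (n * (n + 1)) \<le> (n + 1) * (2 * card ?N)" by (rule mult_le_mono2)
      also have "\<dots> = 2 * card ?I" by (simp add: card_cartesian_product)
      finally show ?thesis by (simp add: power3_eq_cube algebra_simps)
    qed
    ultimately show ?thesis by simp
  qed
  then have "3 \<le> limsup (\<lambda>n. ereal (log (real n) (real (growth K R ?V n))))"
    by (rule limsup_log_ge_3)
  also have "\<dots> \<le> GKdim K R" using Wc by (rule R.limsup_le_GKdim)
  finally show False using gk by simp
qed

end

section \<open>Regular elements in prime Goldie rings\<close>

context ring
begin

lemma add_subgroupI:
  assumes "I \<subseteq> carrier R" "\<zero> \<in> I" "\<And>x y. x \<in> I \<Longrightarrow> y \<in> I \<Longrightarrow> x \<oplus> y \<in> I" "\<And>x. x \<in> I \<Longrightarrow> \<ominus> x \<in> I"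
  shows "subgroup I (add_monoid R)"
  using assms by (intro add.subgroupI) (auto simp: a_inv_def)

lemma two_sided_idealI:
  assumes "I \<subseteq> carrier R" "\<zero> \<in> I" "\<And>x y. x \<in> I \<Longrightarrow> y \<in> I \<Longrightarrow> x \<oplus> y \<in> I"
    and l: "\<And>a x. x \<in> I \<Longrightarrow> a \<in> carrier R \<Longrightarrow> a \<otimes> x \<in> I"
    and r: "\<And>a x. x \<in> I \<Longrightarrow> a \<in> carrier R \<Longrightarrow> x \<otimes> a \<in> I"
  shows "ideal I R"
proof (rule idealI[OF ring_axioms add_subgroupI])
  fix x assume x: "x \<in> I"
  have "\<ominus> \<one> \<otimes> x \<in> I" using l[OF x] by simp
  then show "\<ominus> x \<in> I" using x assms(1) by (simp add: l_minus subset_iff)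
qed (use assms in auto)

lemma ideal_closed:
  assumes "ideal I R"
  shows "I \<subseteq> carrier R" "\<zero> \<in> I" "\<And>x y. x \<in> I \<Longrightarrow> y \<in> I \<Longrightarrow> x \<oplus> y \<in> I"
    "\<And>a x. x \<in> I \<Longrightarrow> a \<in> carrier R \<Longrightarrow> a \<otimes> x \<in> I" "\<And>a x. x \<in> I \<Longrightarrow> a \<in> carrier R \<Longrightarrow> x \<otimes> a \<in> I"
proof -
  interpret I: ideal I R by fact
  show "I \<subseteq> carrier R" by (rule I.a_subset)
  show "\<zero> \<in> I" by (rule I.zero_closed)
  show "\<And>x y. x \<in> I \<Longrightarrow> y \<in> I \<Longrightarrow> x \<oplus> y \<in> I" by (rule I.a_closed)
  show "\<And>a x. x \<in> I \<Longrightarrow> a \<in> carrier R \<Longrightarrow> a \<otimes> x \<in> I" by (rule I.I_l_closed)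
  show "\<And>a x. x \<in> I \<Longrightarrow> a \<in> carrier R \<Longrightarrow> x \<otimes> a \<in> I" by (rule I.I_r_closed)
qed

text \<open>The elementwise form of primeness. Taking \<open>?I\<close> as the set of all r with r R
  b = 0 and \<open>?J\<close> as its right annihilator gives two ideals with zero product directly,
  without describing ideals generated by elements.\<close>

lemma prime_ring_elements:
  assumes prime: "prime_ring R" and ab: "a \<in> carrier R" "b \<in> carrier R"
    and z: "\<And>s. s \<in> carrier R \<Longrightarrow> a \<otimes> s \<otimes> b = \<zero>"
  shows "a = \<zero> \<or> b = \<zero>"
proof -
  let ?I = "{r \<in> carrier R. \<forall>s\<in>carrier R. r \<otimes> s \<otimes> b = \<zero>}"
  let ?J = "{t \<in> carrier R. \<forall>r\<in>?I. r \<otimes> t = \<zero>}"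
  have I: "ideal ?I R"
  proof (rule two_sided_idealI)
    fix c x assume x: "x \<in> ?I" and c: "c \<in> carrier R"
    show "c \<otimes> x \<in> ?I" using x c ab by (auto simp: m_assoc)
    have "x \<otimes> c \<otimes> s \<otimes> b = \<zero>" if "s \<in> carrier R" for s
    proof -
      have "x \<otimes> (c \<otimes> s) \<otimes> b = \<zero>" using x c that by blast
      then show ?thesis using x c that by (simp add: m_assoc)
    qed
    then show "x \<otimes> c \<in> ?I" using x c by simp
  qed (use ab in \<open>auto simp: l_distr\<close>)
  have J: "ideal ?J R"
  proof (rule two_sided_idealI)
    fix c x assume x: "x \<in> ?J" and c: "c \<in> carrier R"
    have "r \<otimes> (c \<otimes> x) = \<zero>" if r: "r \<in> ?I" for r
    proof -
      have "r \<otimes> c \<in> ?I" using ideal_closed(5)[OF I r c] .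
      then have "(r \<otimes> c) \<otimes> x = \<zero>" using x by blast
      moreover have "r \<otimes> (c \<otimes> x) = (r \<otimes> c) \<otimes> x" using r c x by (intro m_assoc[symmetric]) auto
      ultimately show ?thesis by simp
    qed
    then show "c \<otimes> x \<in> ?J" using x c by simp
    have "r \<otimes> (x \<otimes> c) = \<zero>" if r: "r \<in> ?I" for r
    proof -
      have "r \<otimes> x = \<zero>" using r x by blast
      moreover have "r \<otimes> (x \<otimes> c) = (r \<otimes> x) \<otimes> c" using r c x by (intro m_assoc[symmetric]) auto
      ultimately show ?thesis using c by simp
    qed
    then show "x \<otimes> c \<in> ?J" using x c by simp
  qed (auto simp: r_distr)
  have "?I <#> ?J \<subseteq> {\<zero>}" by (auto simp: set_mult_def)
  then have "?I \<subseteq> {\<zero>} \<or> ?J \<subseteq> {\<zero>}" using prime I J by (simp add: prime_ring_def prime_ideal_def)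
  moreover have "a \<in> ?I" using ab z by simp
  moreover have "b \<in> ?J"
  proof -
    have "r \<otimes> b = \<zero>" if "r \<in> ?I" for r
    proof -
      have "r \<otimes> \<one> \<otimes> b = \<zero>" using that by blast
      then show ?thesis using that by simp
    qed
    then show ?thesis using ab by simp
  qed
  ultimately show ?thesis by blast
qed

definition rann :: "'a \<Rightarrow> 'a set" where "rann a = right_annihilator R {a}"

lemma mem_rann: "r \<in> rann a \<longleftrightarrow> r \<in> carrier R \<and> a \<otimes> r = \<zero>"
  by (simp add: rann_def right_annihilator_def)

lemma rann_chain:
  assumes acc: "acc_right_annihilators R" and a: "\<And>n. a n \<in> carrier R"
    and mono: "\<And>n. rann (a n) \<subseteq> rann (a (Suc n))"
  shows "\<exists>N. \<forall>n\<ge>N. rann (a n) = rann (a N)"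
proof -
  have "(\<forall>n. rann (a n) \<in> right_annihilator R ` Pow (carrier R)) \<and> (\<forall>n. rann (a n) \<subseteq> rann (a (Suc n)))"
    using a mono by (auto simp: rann_def)
  with acc[unfolded acc_right_annihilators_def, rule_format, of "\<lambda>n. rann (a n)"] show ?thesis by blast
qed

lemma maximal_rann:
  assumes acc: "acc_right_annihilators R" and X: "X \<subseteq> carrier R" "X \<noteq> {}"
  shows "\<exists>a\<in>X. \<forall>b\<in>X. rann a \<subseteq> rann b \<longrightarrow> rann b = rann a"
proof (rule ccontr)
  assume "\<not> ?thesis"
  then have "\<forall>a\<in>X. \<exists>b. b \<in> X \<and> rann a \<subset> rann b" by blast
  then obtain f where f: "\<forall>a\<in>X. f a \<in> X \<and> rann a \<subset> rann (f a)" by (rule bchoice[THEN exE])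
  obtain a0 where a0: "a0 \<in> X" using X by blast
  define s where "s n = (f ^^ n) a0" for n
  have s: "s n \<in> X" for n by (induction n) (use a0 f in \<open>auto simp: s_def\<close>)
  have lt: "rann (s n) \<subset> rann (s (Suc n))" for n using f s[of n] by (simp add: s_def)
  have "\<exists>N. \<forall>n\<ge>N. rann (s n) = rann (s N)"
    using s X lt by (intro rann_chain[OF acc]) auto
  then obtain N where "rann (s (Suc N)) = rann (s N)" by (meson le_SucI order_refl)
  then show False using lt[of N] by blast
qed

text \<open>Transfers nilpotence from \<open>t \<otimes> r\<close> to \<open>r \<otimes> t\<close>,
  that is, from a set closed under right multiplication to the left ideal generated by
  \<open>t\<close>.\<close>

lemma nilpotent_flip:
  assumes "r \<in> carrier R" "t \<in> carrier R"
  shows "(r \<otimes> t) [^] Suc n = r \<otimes> ((t \<otimes> r) [^] n \<otimes> t)"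
proof (induction n)
  case (Suc n)
  have "(r \<otimes> t) [^] Suc (Suc n) = (r \<otimes> t) [^] Suc n \<otimes> (r \<otimes> t)" by simp
  also have "\<dots> = r \<otimes> ((t \<otimes> r) [^] n \<otimes> t) \<otimes> (r \<otimes> t)" by (simp only: Suc)
  also have "\<dots> = r \<otimes> (((t \<otimes> r) [^] n \<otimes> (t \<otimes> r)) \<otimes> t)" using assms by (simp add: m_assoc)
  finally show ?case by simp
qed (use assms in simp)

text \<open>
  Utumi's argument for Levitzki's theorem: if a right ideal were nil, an element \<open>b\<close> of a nil left
  ideal with maximal right annihilator would satisfy \<open>b t b = 0\<close> for all \<open>t\<close>.
\<close>

lemma exists_non_nilpotent:
  assumes prime: "prime_ring R" and acc: "acc_right_annihilators R"
    and T: "T \<subseteq> carrier R" "\<And>t r. t \<in> T \<Longrightarrow> r \<in> carrier R \<Longrightarrow> t \<otimes> r \<in> T"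
    and t0: "t0 \<in> T" "t0 \<noteq> \<zero>"
  shows "\<exists>a\<in>T. \<forall>n::nat. a [^] n \<noteq> \<zero>"
proof (rule ccontr)
  assume "\<not> ?thesis"
  then have nil: "\<exists>n::nat. a [^] n = \<zero>" if "a \<in> T" for a using that by blast
  have t0c: "t0 \<in> carrier R" using t0 T by blast
  \<comment> \<open>The nonzero members of the left ideal generated by \<open>t0\<close>; they are
    nilpotent by the flip, since \<open>t0\<close> lies in the nil set \<open>T\<close>.\<close>
  define X where "X = {r \<otimes> t0 |r. r \<in> carrier R} - {\<zero>}"
  have "t0 = \<one> \<otimes> t0" using t0c by simp
  then have "t0 \<in> X" using t0 one_closed unfolding X_def by blast
  moreover have "X \<subseteq> carrier R" using t0c by (auto simp: X_def)
  ultimately obtain b where b: "b \<in> X" "\<And>c. c \<in> X \<Longrightarrow> rann b \<subseteq> rann c \<Longrightarrow> rann c = rann b"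
    using maximal_rann[OF acc, of X] by blast
  obtain r0 where r0: "r0 \<in> carrier R" "b = r0 \<otimes> t0" and b0: "b \<noteq> \<zero>" using b by (auto simp: X_def)
  have bc: "b \<in> carrier R" using r0 t0c by simp
  have "b \<otimes> t \<otimes> b = \<zero>" if t: "t \<in> carrier R" for t
  proof (cases "t \<otimes> b = \<zero>")
    case True
    then show ?thesis using bc t by (simp add: m_assoc)
  next
    case False
    define u where "u = t \<otimes> b"
    have u: "u = (t \<otimes> r0) \<otimes> t0" using r0 t t0c by (simp add: u_def m_assoc)
    have uc: "u \<in> carrier R" using t bc by (simp add: u_def)
    have "t0 \<otimes> (t \<otimes> r0) \<in> T" using T(2)[OF t0(1)] t r0 by simp
    then obtain n :: nat where "(t0 \<otimes> (t \<otimes> r0)) [^] n = \<zero>" using nil by blast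
    then have "u [^] Suc n = \<zero>" unfolding u using nilpotent_flip[of "t \<otimes> r0" t0 n] t r0 t0c by simp
    then have ex: "\<exists>n::nat. u [^] n = \<zero>" by blast
    define n where "n = (LEAST n::nat. u [^] n = \<zero>)"
    have n: "u [^] n = \<zero>" unfolding n_def using ex by (rule LeastI_ex)
    have min: "u [^] m \<noteq> \<zero>" if "m < n" for m using not_less_Least[of m "\<lambda>n. u [^] n = \<zero>"] that by (simp add: n_def)
    have "n \<noteq> 0"
    proof
      assume "n = 0"
      then have "\<one> = \<zero>" using n by simp
      then show False using False uc by (metis l_null l_one u_def)
    qed
    moreover have "n \<noteq> 1" using n False uc by (auto simp: u_def[symmetric])
    ultimately obtain m where m: "n = Suc (Suc m)" by (metis One_nat_def not0_implies_Suc)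
    \<comment> \<open>The last nonzero power of \<open>u\<close> is still a left multiple of
      \<open>b\<close>, so by maximality it has the same right annihilator as \<open>b\<close>. That
      annihilator contains \<open>u\<close>.\<close>
    have v: "u [^] Suc m = (u [^] m \<otimes> t) \<otimes> b" using uc t bc by (simp add: u_def m_assoc)
    have "u [^] Suc m = (u [^] m \<otimes> t \<otimes> r0) \<otimes> t0" unfolding v r0(2) using uc t r0 t0c by (simp add: m_assoc)
    then have "u [^] Suc m \<in> {r \<otimes> t0 |r. r \<in> carrier R}" using uc t r0 by blast
    then have "u [^] Suc m \<in> X" using min[of "Suc m"] m by (simp add: X_def)
    moreover have "rann b \<subseteq> rann (u [^] Suc m)"
    proof
      fix r assume r: "r \<in> rann b"
      then have "(u [^] m \<otimes> t) \<otimes> (b \<otimes> r) = \<zero>" using uc t by (simp add: mem_rann)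
      then show "r \<in> rann (u [^] Suc m)" unfolding v using r uc t bc by (simp add: mem_rann m_assoc)
    qed
    ultimately have "rann (u [^] Suc m) = rann b" using b(2) by blast
    moreover have "u \<in> rann (u [^] Suc m)" using n m uc by (simp add: mem_rann)
    ultimately have "b \<otimes> u = \<zero>" by (simp add: mem_rann)
    then show ?thesis using t bc by (simp add: u_def m_assoc)
  qed
  then have "b = \<zero>" using prime_ring_elements[OF prime bc bc] by blast
  then show False using b0 by simp
qed

text \<open>The right annihilators of the powers of a non-nilpotent element form an ascending chain,
  and a power beyond the point of stabilisation is as required. The exponent \<open>Suc N\<close>
  keeps the power in \<open>T\<close> also when N = 0.\<close>

lemma exists_stable_rann:
  assumes prime: "prime_ring R" and acc: "acc_right_annihilators R"
    and T: "T \<subseteq> carrier R" "\<And>t r. t \<in> T \<Longrightarrow> r \<in> carrier R \<Longrightarrow> t \<otimes> r \<in> T"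
    and t0: "t0 \<in> T" "t0 \<noteq> \<zero>"
  shows "\<exists>a\<in>T. a \<noteq> \<zero> \<and> rann (a \<otimes> a) = rann a"
proof -
  obtain a where a: "a \<in> T" "\<And>n::nat. a [^] n \<noteq> \<zero>" using exists_non_nilpotent[OF assms] by blast
  have ac: "a \<in> carrier R" using a T by blast
  have "\<exists>N. \<forall>n\<ge>N. rann (a [^] n) = rann (a [^] (N::nat))"
  proof (rule rann_chain[OF acc])
    fix n :: nat
    show "rann (a [^] n) \<subseteq> rann (a [^] Suc n)"
      unfolding nat_pow_Suc2[OF ac] using ac by (auto simp: mem_rann m_assoc)
  qed (use ac in simp)
  then obtain N :: nat where N: "\<And>n. n \<ge> N \<Longrightarrow> rann (a [^] n) = rann (a [^] N)" by blast
  let ?b = "a [^] Suc N"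
  have "?b \<in> T" unfolding nat_pow_Suc2[OF ac] using T(2)[OF a(1)] ac by simp
  moreover have "?b \<otimes> ?b = a [^] (Suc N + Suc N)" using ac by (simp only: nat_pow_mult)
  then have "rann (?b \<otimes> ?b) = rann ?b" using N[of "Suc N + Suc N"] N[of "Suc N"] by simp
  ultimately show ?thesis using a(2) by blast
qed

text \<open>Multiplying on the left by the \<open>a\<close> of least index kills all other terms,
  and stability of its annihilator removes the additional factor. This serves twice: for directness
  of the sum of the right ideals generated by the \<open>a i\<close>, and for injectivity of
  multiplication by their sum.\<close>

lemma triangular_sum_zero:
  fixes a :: "nat \<Rightarrow> 'a"
  assumes "finite F" and a: "\<And>i. i \<in> F \<Longrightarrow> a i \<in> carrier R" and st: "\<And>i. i \<in> F \<Longrightarrow> rann (a i \<otimes> a i) = rann (a i)"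
    and tri: "\<And>i j. i \<in> F \<Longrightarrow> j \<in> F \<Longrightarrow> i < j \<Longrightarrow> a i \<otimes> a j = \<zero>"
    and y: "\<And>i. i \<in> F \<Longrightarrow> y i \<in> carrier R" and sum: "(\<Oplus>i\<in>F. a i \<otimes> y i) = \<zero>"
  shows "\<forall>i\<in>F. a i \<otimes> y i = \<zero>"
  using assms
proof (induction F rule: finite_linorder_min_induct)
  case (insert b F)
  have bF: "b \<notin> F" using insert.hyps by auto
  have ab: "a b \<in> carrier R" "y b \<in> carrier R" using insert.prems(1,4) by simp_all
  have aF: "a i \<in> carrier R" "y i \<in> carrier R" if "i \<in> F" for i using insert.prems(1,4) that by simp_all
  have fc: "(\<lambda>i. a i \<otimes> y i) \<in> F \<rightarrow> carrier R" using aF by auto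
  have split: "a b \<otimes> y b \<oplus> (\<Oplus>i\<in>F. a i \<otimes> y i) = \<zero>"
    using insert.prems(5) insert.hyps bF fc ab by (simp add: finsum_insert)
  have "a b \<otimes> (\<Oplus>i\<in>F. a i \<otimes> y i) = (\<Oplus>i\<in>F. a b \<otimes> (a i \<otimes> y i))"
    using insert.hyps ab fc by (intro finsum_rdistr)
  also have "\<dots> = (\<Oplus>i\<in>F. \<zero>)"
  proof (rule finsum_cong')
    fix i assume i: "i \<in> F"
    have "a b \<otimes> a i = \<zero>" using insert.prems(3)[of b i] insert.hyps i by auto
    then show "a b \<otimes> (a i \<otimes> y i) = \<zero>" using ab aF[OF i] by (simp flip: m_assoc)
  qed auto
  finally have z: "a b \<otimes> (\<Oplus>i\<in>F. a i \<otimes> y i) = \<zero>" by simp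
  have sc: "(\<Oplus>i\<in>F. a i \<otimes> y i) \<in> carrier R" using fc by (rule finsum_closed)
  have "a b \<otimes> (a b \<otimes> y b \<oplus> (\<Oplus>i\<in>F. a i \<otimes> y i)) = \<zero>" using split ab by simp
  then have "a b \<otimes> (a b \<otimes> y b) = \<zero>" using z ab sc by (simp add: r_distr)
  then have "y b \<in> rann (a b \<otimes> a b)" using ab by (simp add: mem_rann m_assoc)
  then have yb: "a b \<otimes> y b = \<zero>" using insert.prems(2)[of b] by (simp add: mem_rann)
  then have "(\<Oplus>i\<in>F. a i \<otimes> y i) = \<zero>" using split sc by simp
  then have "\<forall>i\<in>F. a i \<otimes> y i = \<zero>" using insert.prems by (intro insert.IH) auto
  then show ?case using yb by simp
qed simp

text \<open>Elements of \<open>I\<close> with stable annihilators are collected, each annihilated on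
  the left by its predecessors. An endless collection would give an infinite direct sum of right
  ideals; when it stops, the sum of the collected elements is the required \<open>c\<close>.\<close>

theorem prime_Goldie_regular:
  assumes prime: "prime_ring R" and Goldie: "right_Goldie R" and I: "ideal I R" "I \<noteq> {\<zero>}"
  shows "\<exists>c\<in>I. \<forall>r\<in>carrier R. c \<otimes> r = \<zero> \<longrightarrow> r = \<zero>"
proof -
  have acc: "acc_right_annihilators R" using Goldie by (simp add: right_Goldie_def)
  note Ic = ideal_closed[OF I(1)]
  define T where "T S = {r \<in> I. \<forall>s\<in>S. s \<otimes> r = \<zero>}" for S
  define good where "good n a \<longleftrightarrow> (\<forall>i<n. a i \<in> I \<and> a i \<noteq> \<zero> \<and> rann (a i \<otimes> a i) = rann (a i) \<and>
    (\<forall>j<i. a j \<otimes> a i = \<zero>))" for n :: nat and a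
  have "\<exists>n a. good n a \<and> T (a ` {..<n}) \<subseteq> {\<zero>}"
  proof (rule ccontr)
    assume n: "\<not> ?thesis"
    define ext where "ext S = (SOME t. t \<in> T S \<and> t \<noteq> \<zero> \<and> rann (t \<otimes> t) = rann t)" for S
    \<comment> \<open>Each choice depends on the set of all earlier ones, so the recursion runs over
      these sets and the sequence is read off from them.\<close>
    define S where "S = rec_nat {} (\<lambda>_ S. insert (ext S) S)"
    define a where "a i = ext (S i)" for i
    have S: "S n = a ` {..<n}" for n
      by (induction n) (auto simp: S_def a_def lessThan_Suc)
    have an: "a n = ext (a ` {..<n})" for n
      unfolding S[symmetric] by (rule a_def)
    have ext: "ext (a ` {..<n}) \<in> T (a ` {..<n}) \<and> ext (a ` {..<n}) \<noteq> \<zero> \<and>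
        rann (ext (a ` {..<n}) \<otimes> ext (a ` {..<n})) = rann (ext (a ` {..<n}))" if g: "good n a" for n
    proof -
      let ?S = "a ` {..<n}"
      have Sc: "?S \<subseteq> carrier R" using g Ic(1) by (auto simp: good_def)
      obtain t0 where t0: "t0 \<in> T ?S" "t0 \<noteq> \<zero>" using n g by blast
      have "\<exists>t\<in>T ?S. t \<noteq> \<zero> \<and> rann (t \<otimes> t) = rann t"
      proof (rule exists_stable_rann[OF prime acc _ _ t0])
        show "T ?S \<subseteq> carrier R" using Ic(1) by (auto simp: T_def)
        fix t r assume t: "t \<in> T ?S" "r \<in> carrier R"
        have "s \<otimes> (t \<otimes> r) = \<zero>" if s: "s \<in> ?S" for s
        proof -
          have c: "s \<in> carrier R" "t \<in> carrier R" "s \<otimes> t = \<zero>" using s Sc t Ic(1) by (auto simp: T_def)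
          then have "s \<otimes> (t \<otimes> r) = (s \<otimes> t) \<otimes> r" using t by (intro m_assoc[symmetric]) auto
          then show ?thesis using c t by simp
        qed
        then show "t \<otimes> r \<in> T ?S" using t Ic(5) by (simp add: T_def)
      qed
      then have "\<exists>t. t \<in> T ?S \<and> t \<noteq> \<zero> \<and> rann (t \<otimes> t) = rann t" by blast
      then show ?thesis unfolding ext_def by (rule someI_ex)
    qed
    have good: "good n a" for n
    proof (induction n)
      case (Suc n)
      have "a n \<in> T (a ` {..<n}) \<and> a n \<noteq> \<zero> \<and> rann (a n \<otimes> a n) = rann (a n)"
        by (subst (1 2 3 4 5) an) (rule ext[OF Suc])
      then show ?case using Suc by (auto simp: good_def T_def less_Suc_eq)
    qed (simp add: good_def)
    have a: "a i \<in> carrier R" "a i \<noteq> \<zero>" "rann (a i \<otimes> a i) = rann (a i)" for i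
      using good[of "Suc i"] Ic(1) by (auto simp: good_def)
    have tri: "a i \<otimes> a j = \<zero>" if "i < j" for i j
      using good[of "Suc j"] that by (auto simp: good_def)
    define D where "D n = {a n \<otimes> r |r. r \<in> carrier R}" for n
    have "infinite_direct_sum_of_right_ideals R D"
      unfolding infinite_direct_sum_of_right_ideals_def
    proof (intro conjI allI impI ballI)
      fix n
      show "right_ideal (D n) R"
        unfolding right_ideal_def
      proof (intro conjI ballI additive_subgroup.intro add_subgroupI)
        show "D n \<subseteq> carrier R" using a by (auto simp: D_def)
        have "\<zero> = a n \<otimes> \<zero>" using a by simp
        then show "\<zero> \<in> D n" unfolding D_def by blast
      next
        fix x y assume "x \<in> D n" "y \<in> D n"
        then obtain r s where rs: "r \<in> carrier R" "s \<in> carrier R" "x = a n \<otimes> r" "y = a n \<otimes> s"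
          by (auto simp: D_def)
        then have "x \<oplus> y = a n \<otimes> (r \<oplus> s)" using a by (simp add: r_distr)
        then show "x \<oplus> y \<in> D n" using rs unfolding D_def by blast
      next
        fix x assume "x \<in> D n"
        then obtain r where r: "r \<in> carrier R" "x = a n \<otimes> r" by (auto simp: D_def)
        then have "\<ominus> x = a n \<otimes> (\<ominus> r)" using a by (simp add: r_minus)
        then show "\<ominus> x \<in> D n" using r unfolding D_def by blast
      next
        fix x s assume "x \<in> D n" and s: "s \<in> carrier R"
        then obtain r where r: "r \<in> carrier R" "x = a n \<otimes> r" by (auto simp: D_def)
        then have "x \<otimes> s = a n \<otimes> (r \<otimes> s)" using a s by (simp add: m_assoc)
        then show "x \<otimes> s \<in> D n" using r s unfolding D_def by blast
      qed
      have "a n = a n \<otimes> \<one>" using a by simp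
      then have "a n \<in> D n" unfolding D_def by blast
      then show "D n \<noteq> {\<zero>}" using a(2)[of n] by blast
    next
      fix F x i assume F: "finite F \<and> x \<in> Pi F D \<and> (\<Oplus>i\<in>F. x i) = \<zero>" and i: "i \<in> F"
      then have "\<forall>i\<in>F. \<exists>r. r \<in> carrier R \<and> x i = a i \<otimes> r" by (auto simp: D_def Pi_iff)
      then obtain y where y: "\<forall>i\<in>F. y i \<in> carrier R \<and> x i = a i \<otimes> y i" by (rule bchoice[THEN exE])
      have "(\<Oplus>i\<in>F. x i) = (\<Oplus>i\<in>F. a i \<otimes> y i)" using y a by (intro finsum_cong') auto
      then have "\<forall>i\<in>F. a i \<otimes> y i = \<zero>"
        using F y a tri by (intro triangular_sum_zero) auto
      then show "x i = \<zero>" using y i by simp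
    qed
    then show False using Goldie unfolding right_Goldie_def by blast
  qed
  then obtain n a where g: "good n a" and T0: "T (a ` {..<n}) \<subseteq> {\<zero>}" by blast
  have a: "a i \<in> I" "a i \<in> carrier R" "rann (a i \<otimes> a i) = rann (a i)" if "i < n" for i
    using g Ic(1) that by (auto simp: good_def)
  have tri: "a i \<otimes> a j = \<zero>" if "i < j" "j < n" for i j using g that by (auto simp: good_def)
  define c where "c = (\<Oplus>i\<in>{..<n}. a i)"
  have "(\<Oplus>i\<in>F. a i) \<in> I" if "finite F" "F \<subseteq> {..<n}" for F
    using that
  proof (induction F)
    case (insert i F)
    have "(\<Oplus>i\<in>insert i F. a i) = a i \<oplus> (\<Oplus>i\<in>F. a i)" using insert a by (intro finsum_insert) auto
    then show ?case using insert a Ic(3) by auto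
  qed (use Ic in simp)
  then have cI: "c \<in> I" by (simp add: c_def)
  moreover have "r = \<zero>" if r: "r \<in> carrier R" "c \<otimes> r = \<zero>" for r
  proof -
    have "(\<Oplus>i\<in>{..<n}. a i \<otimes> r) = c \<otimes> r"
      unfolding c_def using a r by (intro finsum_ldistr[symmetric]) auto
    then have ar: "\<forall>i\<in>{..<n}. a i \<otimes> r = \<zero>"
      using r a tri by (intro triangular_sum_zero) auto
    \<comment> \<open>The product lies in \<open>I\<close> and is killed by every
      \<open>a i\<close>, so it falls into the trivial set where the collection stopped. Thus
      \<open>r\<close> annihilates the nonzero ideal \<open>I\<close>, and primeness
      applies.\<close>
    have rq: "r \<otimes> q = \<zero>" if q: "q \<in> I" for q
    proof -
      have qc: "q \<in> carrier R" using q Ic(1) by blast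
      have "a i \<otimes> (r \<otimes> q) = \<zero>" if "i < n" for i
      proof -
        have "a i \<otimes> (r \<otimes> q) = (a i \<otimes> r) \<otimes> q" using a[OF that] r qc by (simp add: m_assoc)
        then show ?thesis using ar that qc by simp
      qed
      then have "r \<otimes> q \<in> T (a ` {..<n})" using Ic(4)[OF q r(1)] by (auto simp: T_def)
      then show ?thesis using T0 by blast
    qed
    obtain q where q: "q \<in> I" "q \<noteq> \<zero>" using I(2) Ic(2) by blast
    have qc: "q \<in> carrier R" using q Ic(1) by blast
    have "r \<otimes> s \<otimes> q = \<zero>" if "s \<in> carrier R" for s
      using rq[OF Ic(4)[OF q(1) that]] r qc that by (simp add: m_assoc)
    then show ?thesis using prime_ring_elements[OF prime r(1) qc] q by blast
  qed
  ultimately show ?thesis by blast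
qed

end

section \<open>The standard identity\<close>

context k_algebra
begin

lemma word_value_cong: "(\<And>i. i \<in> set w \<Longrightarrow> \<sigma> i = \<tau> i) \<Longrightarrow> word_value A \<sigma> w = word_value A \<tau> w"
  by (induction w) (auto simp: word_value_def)

lemma word_value_map: "word_value A \<sigma> (map f w) = word_value A (\<sigma> \<circ> f) w"
  by (induction w) (auto simp: word_value_def)

lemma word_value_linear:
  assumes "range \<sigma> \<subseteq> carrier A" "distinct w" "j \<in> set w"
  shows "\<exists>a\<in>carrier A. \<exists>b\<in>carrier A. \<forall>x\<in>carrier A. word_value A (\<sigma>(j := x)) w = a \<otimes> x \<otimes> b"
proof -
  obtain u v where w: "w = u @ j # v" using assms(3) by (meson split_list)
  have j: "j \<notin> set u" "j \<notin> set v" using assms(2) w by auto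
  have "word_value A (\<sigma>(j := x)) w = word_value A \<sigma> u \<otimes> x \<otimes> word_value A \<sigma> v" if x: "x \<in> carrier A" for x
  proof -
    have r: "range (\<sigma>(j := x)) \<subseteq> carrier A" using assms(1) x by auto
    have eq: "word_value A (\<sigma>(j := x)) u = word_value A \<sigma> u" "word_value A (\<sigma>(j := x)) v = word_value A \<sigma> v"
      using j by (intro word_value_cong; auto)+
    have "word_value A (\<sigma>(j := x)) (j # v) = x \<otimes> word_value A \<sigma> v"
      using eq by (simp add: word_value_def)
    then show ?thesis unfolding w word_value_append[OF r] eq
      using x word_value_closed[OF assms(1)] by (simp add: m_assoc)
  qed
  then show ?thesis using word_value_closed[OF assms(1)] by blast
qed

abbreviation perms :: "nat \<Rightarrow> (nat \<Rightarrow> nat) set" where "perms d \<equiv> {p. p permutes {..<d}}"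

text \<open>The sign is taken in \<open>K\<close> itself; in characteristic 2 both values
  coincide.\<close>

definition sgn_perm :: "(nat \<Rightarrow> nat) \<Rightarrow> 'a" where
  "sgn_perm p = (if evenperm p then \<one>\<^bsub>K\<^esub> else \<ominus>\<^bsub>K\<^esub> \<one>\<^bsub>K\<^esub>)"

definition standard :: "nat \<Rightarrow> (nat \<Rightarrow> 'c) \<Rightarrow> 'c" where
  "standard d \<sigma> = (\<Oplus>p\<in>perms d. sgn_perm p \<odot> word_value A \<sigma> (map p [0..<d]))"

lemma sgn_perm_closed [simp]: "sgn_perm p \<in> carrier K"
  by (simp add: sgn_perm_def)

lemma finite_perms: "finite (perms d)"
  by (rule finite_permutations) simp

text \<open>Composition with the transposition of i and j pairs even with odd permutations, and the
  two terms of a pair cancel. Pairing, as opposed to showing that the sum equals its negative,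
  remains valid in characteristic 2.\<close>

lemma standard_alternating:
  assumes \<sigma>: "range \<sigma> \<subseteq> carrier A" and ij: "i < d" "j < d" "i \<noteq> j" "\<sigma> i = \<sigma> j"
  shows "standard d \<sigma> = \<zero>"
proof -
  let ?\<tau> = "transpose i j"
  let ?t = "\<lambda>p. sgn_perm p \<odot> word_value A \<sigma> (map p [0..<d])"
  let ?E = "{p \<in> perms d. evenperm p}"
  let ?O = "{p \<in> perms d. \<not> evenperm p}"
  have \<tau>: "?\<tau> permutes {..<d}" using ij by (intro permutes_swap_id) auto
  have perm: "permutation p" if "p \<in> perms d" for p
    using that by (auto intro: permutes_imp_permutation)
  have \<tau>p: "permutation ?\<tau>" using perm[of ?\<tau>] \<tau> by simp
  have ev\<tau>: "\<not> evenperm ?\<tau>" using ij by (simp add: evenperm_swap)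
  have evc: "evenperm (?\<tau> \<circ> p) \<longleftrightarrow> \<not> evenperm p" if "p \<in> perms d" for p
    using evenperm_comp[OF \<tau>p perm[OF that]] ev\<tau> by simp
  have pc: "?\<tau> \<circ> p \<in> perms d" if "p \<in> perms d" for p
    using that \<tau> permutes_compose by auto
  have inv: "?\<tau> \<circ> (?\<tau> \<circ> p) = p" for p by (simp add: fun_eq_iff)
  have O: "?O = (\<lambda>p. ?\<tau> \<circ> p) ` ?E"
  proof
    show "?O \<subseteq> (\<lambda>p. ?\<tau> \<circ> p) ` ?E"
    proof
      fix p assume p: "p \<in> ?O"
      then have "?\<tau> \<circ> p \<in> ?E" using pc evc by blast
      then have "?\<tau> \<circ> (?\<tau> \<circ> p) \<in> (\<lambda>p. ?\<tau> \<circ> p) ` ?E" by (rule imageI)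
      then show "p \<in> (\<lambda>p. ?\<tau> \<circ> p) ` ?E" by (simp only: inv)
    qed
  qed (use pc evc in blast)
  have fin: "finite ?E" "finite ?O" using finite_perms by auto
  have wvc: "word_value A \<sigma> w \<in> carrier A" for w using word_value_closed[OF \<sigma>] .
  have \<sigma>\<tau>: "\<sigma> \<circ> ?\<tau> = \<sigma>" using ij(4) by (auto simp: fun_eq_iff transpose_def)
  have wv\<tau>: "word_value A \<sigma> (map (?\<tau> \<circ> p) w) = word_value A \<sigma> (map p w)" for p :: "nat \<Rightarrow> nat" and w
  proof -
    have "\<sigma> \<circ> (?\<tau> \<circ> p) = \<sigma> \<circ> p" using \<sigma>\<tau> by (simp only: comp_assoc[symmetric])
    then show ?thesis by (simp only: word_value_map)
  qed
  have "perms d = ?E \<union> ?O" by auto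
  then have "standard d \<sigma> = (\<Oplus>p\<in>?E \<union> ?O. ?t p)" by (simp only: standard_def)
  also have "\<dots> = (\<Oplus>p\<in>?E. ?t p) \<oplus> (\<Oplus>p\<in>?O. ?t p)"
    using fin wvc by (intro finsum_Un_disjoint) auto
  also have "(\<Oplus>p\<in>?O. ?t p) = (\<Oplus>p\<in>?E. ?t (?\<tau> \<circ> p))"
    unfolding O
  proof (rule finsum_reindex)
    show "inj_on (\<lambda>p. ?\<tau> \<circ> p) ?E" by (rule inj_onI) (metis inv)
  qed (use wvc in auto)
  also have "\<dots> = (\<Oplus>p\<in>?E. \<ominus> word_value A \<sigma> (map p [0..<d]))"
    using wvc evc by (intro finsum_cong') (auto simp: wv\<tau> sgn_perm_def smult_l_minus)
  also have "(\<Oplus>p\<in>?E. ?t p) = (\<Oplus>p\<in>?E. word_value A \<sigma> (map p [0..<d]))"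
    using wvc by (intro finsum_cong') (auto simp: sgn_perm_def)
  also have "(\<Oplus>p\<in>?E. word_value A \<sigma> (map p [0..<d])) \<oplus> (\<Oplus>p\<in>?E. \<ominus> word_value A \<sigma> (map p [0..<d]))
      = (\<Oplus>p\<in>?E. word_value A \<sigma> (map p [0..<d]) \<oplus> \<ominus> word_value A \<sigma> (map p [0..<d]))"
    using wvc by (intro finsum_addf[symmetric]) auto
  also have "\<dots> = (\<Oplus>p\<in>?E. \<zero>)" using wvc by (intro finsum_cong') (auto simp: r_neg)
  also have "\<dots> = \<zero>" by simp
  finally show ?thesis .
qed

text \<open>Each argument occurs exactly once in each word. Writing the terms as
  \<open>a p \<otimes> x \<otimes> b p\<close> shows linearity in that argument and, at the same
  time, that values stay in an ideal with it.\<close>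

lemma standard_linear:
  assumes \<sigma>: "range \<sigma> \<subseteq> carrier A" and j: "j < d"
  obtains a b where "\<forall>p. a p \<in> carrier A \<and> b p \<in> carrier A"
    "\<forall>x\<in>carrier A. standard d (\<sigma>(j := x)) = (\<Oplus>p\<in>perms d. sgn_perm p \<odot> (a p \<otimes> x \<otimes> b p))"
proof -
  have "\<forall>p\<in>perms d. \<exists>ab. fst ab \<in> carrier A \<and> snd ab \<in> carrier A \<and>
      (\<forall>x\<in>carrier A. word_value A (\<sigma>(j := x)) (map p [0..<d]) = fst ab \<otimes> x \<otimes> snd ab)"
  proof
    fix p assume "p \<in> perms d"
    then have p: "p permutes {..<d}" by simp
    have "distinct (map p [0..<d])" using permutes_inj_on[OF p] by (simp add: distinct_map)
    moreover have "set (map p [0..<d]) = {..<d}"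
      using permutes_image[OF p] by (simp add: atLeast0LessThan)
    then have "j \<in> set (map p [0..<d])" using j by (simp del: set_map)
    ultimately obtain a b where "a \<in> carrier A" "b \<in> carrier A"
      "\<forall>x\<in>carrier A. word_value A (\<sigma>(j := x)) (map p [0..<d]) = a \<otimes> x \<otimes> b"
      using word_value_linear[OF \<sigma>] by blast
    then show "\<exists>ab. fst ab \<in> carrier A \<and> snd ab \<in> carrier A \<and>
      (\<forall>x\<in>carrier A. word_value A (\<sigma>(j := x)) (map p [0..<d]) = fst ab \<otimes> x \<otimes> snd ab)"
      by (intro exI[of _ "(a, b)"]) simp
  qed
  then obtain f where f: "\<forall>p\<in>perms d. fst (f p) \<in> carrier A \<and> snd (f p) \<in> carrier A \<and>
      (\<forall>x\<in>carrier A. word_value A (\<sigma>(j := x)) (map p [0..<d]) = fst (f p) \<otimes> x \<otimes> snd (f p))"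
    by (rule bchoice[THEN exE])
  \<comment> \<open>The default \<open>\<zero>\<close> off the permutations makes closure hold for
    every p.\<close>
  let ?a = "\<lambda>p. if p \<in> perms d then fst (f p) else \<zero>"
  let ?b = "\<lambda>p. if p \<in> perms d then snd (f p) else \<zero>"
  show ?thesis
  proof (rule that[of ?a ?b]; intro ballI allI)
    fix x assume x: "x \<in> carrier A"
    show "standard d (\<sigma>(j := x)) = (\<Oplus>p\<in>perms d. sgn_perm p \<odot> (?a p \<otimes> x \<otimes> ?b p))"
      unfolding standard_def using f x by (intro finsum_cong') auto
  qed (use f in auto)
qed

text \<open>In fewer than d dimensions modulo \<open>Q\<close> some argument depends on the others.
  By linearity it may be replaced by another argument, where the value is zero, or by an element of
  \<open>Q\<close>, where each term stays in \<open>Q\<close>.\<close>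

theorem standard_in_ideal:
  assumes Q: "ideal Q A" and W: "finite W" "W \<subseteq> carrier A" "carrier A \<subseteq> span (Q \<union> W)" "card W < d"
    and \<sigma>: "range \<sigma> \<subseteq> carrier A"
  shows "standard d \<sigma> \<in> Q"
proof -
  have Qc: "Q \<subseteq> carrier A" "\<zero> \<in> Q" "\<And>x y. x \<in> Q \<Longrightarrow> y \<in> Q \<Longrightarrow> x \<oplus> y \<in> Q"
    "\<And>a x. x \<in> Q \<Longrightarrow> a \<in> carrier A \<Longrightarrow> a \<otimes> x \<in> Q" "\<And>a x. x \<in> Q \<Longrightarrow> a \<in> carrier A \<Longrightarrow> x \<otimes> a \<in> Q"
    by (fact ideal_closed[OF Q])+
  have Qs: "submodule K Q A" using Qc by (intro left_ideal_submodule) (auto simp: left_ideal_def)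
  have "\<not> indep_over Q \<sigma> {..<d}"
  proof
    assume i: "indep_over Q \<sigma> {..<d}"
    have "\<sigma> ` {..<d} \<subseteq> span (Q \<union> W)" using W(3) \<sigma> by blast
    from steinitz_card_le[OF W(1,2) Qc(1) this i] have "card {..<d} \<le> card W" by simp
    then show False using W by simp
  qed
  then obtain J where J: "J \<subseteq> {..<d}" "J \<noteq> {}" "\<forall>j\<in>J. \<sigma> j \<in> span (Q \<union> \<sigma> ` (J - {j}))"
    unfolding indep_over_def by blast
  then obtain j where j: "j \<in> J" "j < d" by blast
  obtain a b where "\<forall>p. a p \<in> carrier A \<and> b p \<in> carrier A"
    "\<forall>x\<in>carrier A. standard d (\<sigma>(j := x)) = (\<Oplus>p\<in>perms d. sgn_perm p \<odot> (a p \<otimes> x \<otimes> b p))"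
    by (rule standard_linear[OF \<sigma> j(2)])
  then have ab: "\<And>p. a p \<in> carrier A" "\<And>p. b p \<in> carrier A"
    "\<And>x. x \<in> carrier A \<Longrightarrow> standard d (\<sigma>(j := x)) = (\<Oplus>p\<in>perms d. sgn_perm p \<odot> (a p \<otimes> x \<otimes> b p))"
    by simp_all
  let ?h = "\<lambda>x. \<Oplus>p\<in>perms d. sgn_perm p \<odot> (a p \<otimes> x \<otimes> b p)"
  have sub: "submodule K {x \<in> carrier A. ?h x \<in> Q} A"
  proof (rule submodule_vimage[OF Qs])
    fix x y assume xy: "x \<in> carrier A" "y \<in> carrier A"
    have "?h (x \<oplus> y) = (\<Oplus>p\<in>perms d. sgn_perm p \<odot> (a p \<otimes> x \<otimes> b p) \<oplus> sgn_perm p \<odot> (a p \<otimes> y \<otimes> b p))"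
      using xy ab by (intro finsum_cong') (auto simp: l_distr r_distr smult_r_distr)
    also have "\<dots> = ?h x \<oplus> ?h y" using xy ab by (intro finsum_addf) auto
    finally show "?h (x \<oplus> y) = ?h x \<oplus> ?h y" .
  next
    fix c x assume cx: "c \<in> carrier K" "x \<in> carrier A"
    have "c \<odot> ?h x = (\<Oplus>p\<in>perms d. c \<odot> (sgn_perm p \<odot> (a p \<otimes> x \<otimes> b p)))"
      using cx ab finite_perms by (intro finsum_smult_ldistr) auto
    also have "\<dots> = ?h (c \<odot> x)"
      using cx ab by (intro finsum_cong')
        (auto simp: smult_mult_left smult_mult_right R.m_comm simp flip: smult_assoc1)
    finally show "?h (c \<odot> x) = c \<odot> ?h x" by simp
  qed (use ab in auto)
  have "Q \<union> \<sigma> ` (J - {j}) \<subseteq> {x \<in> carrier A. ?h x \<in> Q}"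
  proof
    fix x assume "x \<in> Q \<union> \<sigma> ` (J - {j})"
    then show "x \<in> {x \<in> carrier A. ?h x \<in> Q}"
    proof
      assume x: "x \<in> Q"
      then have "?h x \<in> Q"
        using ab Qc submodule.smult_closed[OF Qs] by (intro submodule_finsum[OF Qs]) auto
      then show ?thesis using x Qc by blast
    next
      assume "x \<in> \<sigma> ` (J - {j})"
      then obtain i where i: "i \<in> J" "i \<noteq> j" "x = \<sigma> i" by blast
      then have x: "x \<in> carrier A" using \<sigma> by auto
      have "range (\<sigma>(j := x)) \<subseteq> carrier A" using \<sigma> x by (auto simp: image_subset_iff)
      moreover have "i < d" using i J by blast
      moreover have "(\<sigma>(j := x)) i = (\<sigma>(j := x)) j" using i by simp
      ultimately have "standard d (\<sigma>(j := x)) = \<zero>"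
        using standard_alternating j(2) i(2) by blast
      then show ?thesis using ab(3)[OF x] x Qc by simp
    qed
  qed
  then have "span (Q \<union> \<sigma> ` (J - {j})) \<subseteq> {x \<in> carrier A. ?h x \<in> Q}" using sub by (rule span_is_subset)
  then have "?h (\<sigma> j) \<in> Q" "\<sigma> j \<in> carrier A" using J j by auto
  then show ?thesis using ab(3)[of "\<sigma> j"] by simp
qed

text \<open>Because one d bounds all the dimensions, one standard polynomial takes its values in
  every \<open>Q i\<close>, hence in their zero intersection.\<close>

theorem PI_of_finite_quotients:
  assumes Q: "\<And>i. i \<in> S \<Longrightarrow> ideal (Q i) A"
    and W: "\<And>i. i \<in> S \<Longrightarrow> \<exists>W. finite W \<and> W \<subseteq> carrier A \<and> carrier A \<subseteq> span (Q i \<union> W) \<and> card W < d"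
    and inter: "\<And>x. x \<in> carrier A \<Longrightarrow> (\<And>i. i \<in> S \<Longrightarrow> x \<in> Q i) \<Longrightarrow> x = \<zero>"
  shows "PI_algebra K A"
proof -
  define m where "m p = map p [0..<d]" for p :: "nat \<Rightarrow> nat"
  have inj: "inj_on m (perms d)"
  proof (rule inj_onI)
    fix p q assume pq: "p \<in> perms d" "q \<in> perms d" "m p = m q"
    show "p = q"
    proof
      fix i show "p i = q i"
      proof (cases "i < d")
        case True
        then show ?thesis using pq(3) by (simp add: m_def)
      next
        case False
        then show ?thesis using pq by (simp add: permutes_def)
      qed
    qed
  qed
  \<comment> \<open>The standard polynomial as a coefficient function: the sign of p at the word p
    0, ..., p (d - 1), and zero at all other words. Injectivity of \<open>m\<close> allows p to be
    read off.\<close>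
  define f where "f w = (if w \<in> m ` perms d then sgn_perm (the_inv_into (perms d) m w) else \<zero>\<^bsub>K\<^esub>)" for w
  have fm: "f (m p) = sgn_perm p" if "p \<in> perms d" for p
    using that inj by (simp add: f_def the_inv_into_f_f)
  have "\<ominus>\<^bsub>K\<^esub> \<one>\<^bsub>K\<^esub> \<noteq> \<zero>\<^bsub>K\<^esub>"
    using R.add.inv_eq_1_iff[of "\<one>\<^bsub>K\<^esub>"] by (simp add: a_inv_def)
  then have sne: "sgn_perm p \<noteq> \<zero>\<^bsub>K\<^esub>" for p by (simp add: sgn_perm_def)
  have supp: "{w. f w \<noteq> \<zero>\<^bsub>K\<^esub>} = m ` perms d"
    using sne by (auto simp: f_def)
  have val: "(\<Oplus>w\<in>{w. f w \<noteq> \<zero>\<^bsub>K\<^esub>}. f w \<odot> word_value A \<sigma> w) = standard d \<sigma>" if \<sigma>: "range \<sigma> \<subseteq> carrier A" for \<sigma>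
  proof -
    have "(\<Oplus>w\<in>m ` perms d. f w \<odot> word_value A \<sigma> w) = (\<Oplus>p\<in>perms d. f (m p) \<odot> word_value A \<sigma> (m p))"
      using word_value_closed[OF \<sigma>] inj fm by (intro finsum_reindex) auto
    also have "\<dots> = standard d \<sigma>"
      unfolding standard_def using word_value_closed[OF \<sigma>] fm by (intro finsum_cong') (auto simp: m_def)
    finally show ?thesis by (simp only: supp)
  qed
  show ?thesis unfolding PI_algebra_def
  proof (intro exI[of _ f] conjI allI impI)
    show "range f \<subseteq> carrier K" by (auto simp: f_def)
    show "finite {w. f w \<noteq> \<zero>\<^bsub>K\<^esub>}" unfolding supp using finite_perms by simp
    have "id \<in> perms d" by (simp add: permutes_id)
    then show "{w. f w \<noteq> \<zero>\<^bsub>K\<^esub>} \<noteq> {}" unfolding supp by blast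
    fix \<sigma> :: "nat \<Rightarrow> 'c" assume \<sigma>: "range \<sigma> \<subseteq> carrier A"
    have "standard d \<sigma> \<in> carrier A"
      unfolding standard_def using word_value_closed[OF \<sigma>] by (intro finsum_closed) auto
    then have "standard d \<sigma> = \<zero>"
    proof (rule inter)
      fix i assume "i \<in> S"
      then show "standard d \<sigma> \<in> Q i" using W[of i] standard_in_ideal[OF Q _ _ _ _ \<sigma>] by blast
    qed
    then show "(\<Oplus>w\<in>{w. f w \<noteq> \<zero>\<^bsub>K\<^esub>}. f w \<odot> word_value A \<sigma> w) = \<zero>" using val[OF \<sigma>] by simp
  qed
qed

end

section \<open>Quotient algebras, maximal left ideals and primitivity\<close>

context generated_algebra
begin

lemma quot_algebra_quotient:
  assumes I: "ideal I A"
  shows "algebra_quotient K A \<sigma> g (quot_algebra A I) (\<lambda>r. I +> r)"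
    and "\<And>r. r \<in> carrier A \<Longrightarrow> I +> r = \<zero>\<^bsub>quot_algebra A I\<^esub> \<longleftrightarrow> r \<in> I"
proof -
  interpret I: ideal I A by fact
  have kA: "k_algebra K A" ..
  have kQ: "k_algebra K (quot_algebra A I)" by (rule k_algebra_quot_algebra(1)[OF kA I])
  have "algebra_quotient_axioms K A (quot_algebra A I) (\<lambda>r. I +> r)"
  proof
    show "(\<lambda>r. I +> r) ` carrier A = carrier (quot_algebra A I)"
      by (auto simp: quot_algebra_def FactRing_def A_RCOSETS_def')
    show "I +> \<one> = \<one>\<^bsub>quot_algebra A I\<^esub>"
      by (simp add: quot_algebra_def FactRing_def)
  qed (simp_all add: quot_algebra_def FactRing_def I.a_rcos_sum I.rcoset_mult_add
        k_algebra_quot_algebra(2)[OF kA I, unfolded quot_algebra_def, simplified])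
  then show "algebra_quotient K A \<sigma> g (quot_algebra A I) (\<lambda>r. I +> r)"
    using kQ generated_algebra_axioms by (intro algebra_quotient.intro)
  show "I +> r = \<zero>\<^bsub>quot_algebra A I\<^esub> \<longleftrightarrow> r \<in> I" if "r \<in> carrier A" for r
    using that I.a_rcos_const I.a_rcos_self[OF that]
    by (auto simp: quot_algebra_def FactRing_def)
qed

end

text \<open>The span of all words in the generators is a subalgebra containing them, so it contains
  the intersection of all such subalgebras.\<close>

lemma affine_generated:
  fixes K :: "('k, 'c) ring_scheme" and R :: "('k, 'a, 'm) module_scheme"
  assumes "k_algebra K R" "affine_algebra K R"
  obtains \<sigma> g where "generated_algebra K R \<sigma> g"
proof -
  interpret k_algebra K R by fact
  obtain S where S: "finite S" "S \<subseteq> carrier R" "\<Inter>{B. k_subalgebra K B R \<and> S \<subseteq> B} = carrier R"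
    using assms(2) by (auto simp: affine_algebra_def)
  obtain xs where xs: "set xs = S" using finite_list[OF S(1)] by blast
  \<comment> \<open>Beyond the given generators the sequence has the default value
    \<open>\<one>\<close>, which keeps its range in the carrier.\<close>
  define \<sigma> where "\<sigma> i = (if i < length xs then xs ! i else \<one>\<^bsub>R\<^esub>)" for i
  let ?W = "lists {..<length xs}"
  have \<sigma>: "range \<sigma> \<subseteq> carrier R" using xs S by (auto simp: \<sigma>_def)
  have W: "word_value R \<sigma> ` ?W \<subseteq> carrier R" using word_value_closed[OF \<sigma>] by blast
  let ?B = "span (word_value R \<sigma> ` ?W)"
  have Bc: "?B \<subseteq> carrier R" using W by (rule span_is_subset2)
  have mult: "x \<otimes>\<^bsub>R\<^esub> y \<in> ?B" if x: "x \<in> ?B" and y: "y \<in> ?B" for x y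
  proof (rule span_mult_right[OF x W])
    fix s assume "s \<in> word_value R \<sigma> ` ?W"
    then obtain u where u: "u \<in> ?W" "s = word_value R \<sigma> u" by blast
    show "s \<otimes>\<^bsub>R\<^esub> y \<in> ?B"
    proof (rule span_mult_left[OF y W])
      fix t assume "t \<in> word_value R \<sigma> ` ?W"
      then obtain v where v: "v \<in> ?W" "t = word_value R \<sigma> v" by blast
      then have "word_value R \<sigma> (u @ v) \<in> word_value R \<sigma> ` ?W" using u by (intro imageI) simp
      then show "s \<otimes>\<^bsub>R\<^esub> t \<in> ?B" using u v W by (simp add: word_value_append[OF \<sigma>] span_base)
    qed (use u W in auto)
  qed (use y Bc W in auto)
  have "k_subalgebra K ?B R"
    unfolding k_subalgebra_def
  proof (intro conjI ballI subringI)
    have "word_value R \<sigma> [] \<in> word_value R \<sigma> ` ?W" by (intro imageI) simp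
    then show "\<one>\<^bsub>R\<^esub> \<in> ?B" using span_base[OF W] by (simp add: word_value_def)
  qed (use Bc mult span_uminus[OF W] span_add[OF W] span_smult[OF W] in auto)
  moreover have "S \<subseteq> ?B"
  proof
    fix s assume "s \<in> S"
    then obtain i where i: "i < length xs" "s = xs ! i" using xs by (metis in_set_conv_nth)
    have "s \<in> carrier R" using \<open>s \<in> S\<close> S by blast
    then have "s = word_value R \<sigma> [i]" using i by (simp add: word_value_def \<sigma>_def)
    moreover have "[i] \<in> ?W" using i by simp
    ultimately show "s \<in> ?B" using span_base[OF W] by blast
  qed
  ultimately have "carrier R \<subseteq> ?B" using S(3) by blast
  then have "generated_algebra K R \<sigma> (length xs)" using \<sigma> by unfold_locales
  then show ?thesis by (rule that)
qed

section \<open>Cores of left ideals and primitivity\<close>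

context k_algebra
begin

text \<open>The annihilator of the module A/M; its vanishing is faithfulness of that module.\<close>

definition core :: "'c set \<Rightarrow> 'c set" where
  "core M = {a \<in> carrier A. \<forall>e\<in>carrier A. a \<otimes> e \<in> M}"

lemma ideal_core:
  assumes M: "left_ideal M" shows "ideal (core M) A"
proof (rule two_sided_idealI)
  fix a x assume x: "x \<in> core M" and a: "a \<in> carrier A"
  show "a \<otimes> x \<in> core M" using x a left_ideal_mult[OF M a] by (auto simp: core_def m_assoc)
  have "x \<otimes> a \<otimes> e \<in> M" if "e \<in> carrier A" for e
  proof -
    have "x \<otimes> (a \<otimes> e) \<in> M" using x a that by (simp add: core_def)
    then show ?thesis using x a that by (simp add: core_def m_assoc)
  qed
  then show "x \<otimes> a \<in> core M" using x a by (simp add: core_def)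
qed (use left_ideal_add[OF M] left_ideal_zero[OF M] in \<open>auto simp: core_def l_distr\<close>)

lemma core_subset: "core M \<subseteq> M"
proof
  fix a assume a: "a \<in> core M"
  then have "a \<otimes> \<one> \<in> M" unfolding core_def using one_closed by blast
  then show "a \<in> M" using a by (simp add: core_def)
qed

lemma exists_maximal_left_ideal:
  assumes L: "left_ideal L" "\<one> \<notin> L"
  shows "\<exists>M. maximal_left_ideal M \<and> L \<subseteq> M"
proof -
  let ?S = "{M. left_ideal M \<and> L \<subseteq> M \<and> \<one> \<notin> M}"
  have "\<exists>M\<in>?S. \<forall>X\<in>?S. M \<subseteq> X \<longrightarrow> X = M"
  proof (rule subset_Zorn_nonempty)
    show "?S \<noteq> {}" using L by blast
    fix C assume C: "C \<noteq> {}" "subset.chain ?S C"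
    have sub: "C \<subseteq> ?S" using C(2) by (simp add: subset.chain_def)
    have lin: "X \<subseteq> Y \<or> Y \<subseteq> X" if "X \<in> C" "Y \<in> C" for X Y
      using C(2) that by (auto simp: subset.chain_def)
    have "left_ideal (\<Union>C)"
      unfolding left_ideal_def
    proof (intro conjI ballI)
      fix x y assume "x \<in> \<Union>C" "y \<in> \<Union>C"
      then obtain X Y where XY: "X \<in> C" "Y \<in> C" "x \<in> X" "y \<in> Y" by blast
      then obtain Z where "Z \<in> C" "x \<in> Z" "y \<in> Z" using lin by blast
      then show "x \<oplus> y \<in> \<Union>C" using sub left_ideal_add by blast
    next
      fix a x assume "a \<in> carrier A" "x \<in> \<Union>C"
      then show "a \<otimes> x \<in> \<Union>C" using sub left_ideal_mult by blast
    next
      show "\<zero> \<in> \<Union>C" using C(1) sub left_ideal_zero by blast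
      show "\<Union>C \<subseteq> carrier A" using sub left_ideal_carrier by blast
    qed
    moreover have "L \<subseteq> \<Union>C" using C(1) sub by blast
    ultimately show "\<Union>C \<in> ?S" using sub by blast
  qed
  then obtain M where M: "M \<in> ?S" "\<forall>X\<in>?S. M \<subseteq> X \<longrightarrow> X = M" by (rule bexE)
  have "maximal_left_ideal M"
    unfolding maximal_left_ideal_def
  proof (intro conjI allI impI)
    fix X assume X: "left_ideal X \<and> M \<subseteq> X \<and> \<one> \<notin> X"
    then have "X \<in> ?S" using M(1) by blast
    then show "X = M" using M(2) X by blast
  qed (use M(1) in auto)
  then show ?thesis using M(1) by blast
qed

text \<open>The module is A/M: maximality of \<open>M\<close> makes it simple and the vanishing core
  makes it faithful. Its elements are cosets as sets of elements of \<open>A\<close>, the type that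
  \<open>primitive_ring\<close> prescribes.\<close>

lemma primitive_of_core_zero:
  assumes M: "maximal_left_ideal M" and core: "core M = {\<zero>}"
  shows "primitive_ring A"
proof -
  have Ml: "left_ideal M" "\<one> \<notin> M" using M by (auto simp: maximal_left_ideal_def)
  have Mc: "M \<subseteq> carrier A" using Ml by (simp add: left_ideal_def)
  define q where "q r = {s \<in> carrier A. s \<ominus> r \<in> M}" for r
  have q_eq: "q r = q s \<longleftrightarrow> r \<ominus> s \<in> M" if r: "r \<in> carrier A" and s: "s \<in> carrier A" for r s
  proof
    assume eq: "q r = q s"
    have "r \<ominus> r = \<zero>" using r by (simp add: a_minus_def r_neg)
    then have "r \<ominus> r \<in> M" using left_ideal_zero[OF Ml(1)] by (simp only:)
    then have "r \<in> q r" using r by (simp add: q_def)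
    then have "r \<in> q s" by (simp only: eq)
    then show "r \<ominus> s \<in> M" by (simp add: q_def)
  next
    assume rs: "r \<ominus> s \<in> M"
    have 1: "t \<ominus> s = (t \<ominus> r) \<oplus> (r \<ominus> s)" if "t \<in> carrier A" for t
      using that r s by (simp add: a_minus_def a_assoc r_neg1 l_neg)
    have 2: "t \<ominus> r = (t \<ominus> s) \<ominus> (r \<ominus> s)" if "t \<in> carrier A" for t
      using that r s add_minus_cancel[of "r \<ominus> s" "t \<ominus> r"] by (simp add: 1[OF that] a_comm)
    have "t \<ominus> s \<in> M" if "t \<in> carrier A" "t \<ominus> r \<in> M" for t
      unfolding 1[OF that(1)] using left_ideal_add[OF Ml(1) that(2) rs] .
    moreover have "t \<ominus> r \<in> M" if "t \<in> carrier A" "t \<ominus> s \<in> M" for t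
      unfolding 2[OF that(1)] using left_ideal_minus[OF Ml(1) that(2) rs] .
    ultimately show "q r = q s" by (auto simp: q_def)
  qed
  \<comment> \<open>Operations on cosets go through chosen representatives; \<open>q_eq\<close>
    later shows that the choice does not matter.\<close>
  define \<rho> where "\<rho> X = (SOME r. r \<in> carrier A \<and> q r = X)" for X
  have \<rho>: "\<rho> (q r) \<in> carrier A" "q (\<rho> (q r)) = q r" if "r \<in> carrier A" for r
  proof -
    have "\<rho> (q r) \<in> carrier A \<and> q (\<rho> (q r)) = q r"
      unfolding \<rho>_def by (rule someI[of "\<lambda>s. s \<in> carrier A \<and> q s = q r" r]) (simp add: that)
    then show "\<rho> (q r) \<in> carrier A" "q (\<rho> (q r)) = q r" by (simp_all only:)
  qed
  have \<rho>M: "\<rho> (q r) \<ominus> r \<in> M" if "r \<in> carrier A" for r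
    using q_eq[OF \<rho>(1)[OF that] that] \<rho>(2)[OF that] by blast
  define E :: "('c, 'c set) module" where
    "E = \<lparr>carrier = q ` carrier A, mult = undefined, one = undefined, zero = q \<zero>,
      add = (\<lambda>X Y. q (\<rho> X \<oplus> \<rho> Y)), smult = (\<lambda>r X. q (r \<otimes> \<rho> X))\<rparr>"
  have Ecar: "carrier E = q ` carrier A" and Ezero: "\<zero>\<^bsub>E\<^esub> = q \<zero>" by (simp_all add: E_def)
  have Eadd: "q r \<oplus>\<^bsub>E\<^esub> q s = q (r \<oplus> s)" if "r \<in> carrier A" "s \<in> carrier A" for r s
  proof -
    have "(\<rho> (q r) \<ominus> r) \<oplus> (\<rho> (q s) \<ominus> s) \<in> M" 
      using left_ideal_add[OF Ml(1) \<rho>M[OF that(1)] \<rho>M[OF that(2)]] .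
    also have "(\<rho> (q r) \<ominus> r) \<oplus> (\<rho> (q s) \<ominus> s) = (\<rho> (q r) \<oplus> \<rho> (q s)) \<ominus> (r \<oplus> s)"
      using that \<rho> by (simp add: a_minus_def minus_add a_ac)
    finally show ?thesis using q_eq that \<rho> by (simp add: E_def)
  qed
  have Esmult: "r \<odot>\<^bsub>E\<^esub> q s = q (r \<otimes> s)" if "r \<in> carrier A" "s \<in> carrier A" for r s
  proof -
    have "r \<otimes> (\<rho> (q s) \<ominus> s) \<in> M" 
      using left_ideal_mult[OF Ml(1) that(1) \<rho>M[OF that(2)]] .
    also have "r \<otimes> (\<rho> (q s) \<ominus> s) = r \<otimes> \<rho> (q s) \<ominus> r \<otimes> s"
      using that \<rho> by (simp add: a_minus_def r_distr r_minus)
    finally show ?thesis using q_eq that \<rho> by (simp add: E_def)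
  qed
  have qz: "q r = \<zero>\<^bsub>E\<^esub> \<longleftrightarrow> r \<in> M" if "r \<in> carrier A" for r
    using q_eq[OF that zero_closed] that by (simp add: Ezero a_minus_def)
  have ag: "abelian_group E"
  proof (rule abelian_groupI)
    fix X assume "X \<in> carrier E"
    then obtain r where r: "r \<in> carrier A" "X = q r" by (auto simp: Ecar)
    have "q (\<ominus> r) \<oplus>\<^bsub>E\<^esub> q r = \<zero>\<^bsub>E\<^esub>" using r by (simp add: Eadd Ezero l_neg)
    then show "\<exists>Y\<in>carrier E. Y \<oplus>\<^bsub>E\<^esub> X = \<zero>\<^bsub>E\<^esub>" using r by (auto simp: Ecar)
  qed (auto simp: Ecar Ezero Eadd a_ac)
  interpret E: abelian_group E by (rule ag)
  have lm: "left_module A E"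
    by (intro left_module.intro left_module_axioms.intro ring_axioms ag)
      (auto simp: Ecar Eadd Esmult l_distr r_distr m_assoc)
  have "simple_left_module A E"
    unfolding simple_left_module_def
  proof (intro conjI allI impI)
    have "q \<one> \<noteq> \<zero>\<^bsub>E\<^esub>" using qz Ml(2) by blast
    moreover have "q \<one> \<in> carrier E" by (simp add: Ecar)
    ultimately show "carrier E \<noteq> {\<zero>\<^bsub>E\<^esub>}" by blast
    fix N assume N: "left_submodule A N E"
    interpret N: additive_subgroup N E using N by (simp add: left_submodule_def)
    have Ns: "r \<odot>\<^bsub>E\<^esub> n \<in> N" if "r \<in> carrier A" "n \<in> N" for r n using N that by (simp add: left_submodule_def)
    let ?L = "{r \<in> carrier A. q r \<in> N}"
    have L: "left_ideal ?L"
      unfolding left_ideal_def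
    proof (intro conjI ballI)
      show "\<zero> \<in> ?L" using N.zero_closed by (simp add: Ezero)
      fix x y assume "x \<in> ?L" "y \<in> ?L"
      then show "x \<oplus> y \<in> ?L" using N.a_closed[of "q x" "q y"] by (simp add: Eadd)
    next
      fix a x assume "a \<in> carrier A" "x \<in> ?L"
      then show "a \<otimes> x \<in> ?L" using Ns[of a "q x"] by (simp add: Esmult)
    qed auto
    have M_sub: "M \<subseteq> ?L"
    proof
      fix m assume m: "m \<in> M"
      then have mc: "m \<in> carrier A" using Mc by blast
      then have "q m = \<zero>\<^bsub>E\<^esub>" using qz m by blast
      then show "m \<in> ?L" using mc N.zero_closed by simp
    qed
    have NE: "N \<subseteq> carrier E" by (rule N.a_subset)
    show "N = {\<zero>\<^bsub>E\<^esub>} \<or> N = carrier E"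
    proof (cases "\<one> \<in> ?L")
      case True
      then have "?L = carrier A" using left_ideal_eq_carrier[OF L] by blast
      then have "carrier E \<subseteq> N" by (auto simp: Ecar)
      then show ?thesis using NE by blast
    next
      case False
      then have LM: "?L = M" using M L M_sub by (simp add: maximal_left_ideal_def)
      have "N \<subseteq> {\<zero>\<^bsub>E\<^esub>}"
      proof
        fix X assume X: "X \<in> N"
        then obtain r where r: "r \<in> carrier A" "X = q r" using NE by (auto simp: Ecar)
        then have "r \<in> M" using X LM by blast
        then show "X \<in> {\<zero>\<^bsub>E\<^esub>}" using qz r by simp
      qed
      then show ?thesis using N.zero_closed by blast
    qed
  qed (rule lm)
  moreover have "faithful_left_module A E"
    unfolding faithful_left_module_def
  proof (intro conjI ballI impI)
    fix r assume r: "r \<in> carrier A" "\<forall>m\<in>carrier E. r \<odot>\<^bsub>E\<^esub> m = \<zero>\<^bsub>E\<^esub>"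
    have "r \<otimes> e \<in> M" if e: "e \<in> carrier A" for e
    proof -
      have "r \<odot>\<^bsub>E\<^esub> q e = \<zero>\<^bsub>E\<^esub>" using r e by (simp add: Ecar)
      then show ?thesis using qz[of "r \<otimes> e"] r e by (simp add: Esmult)
    qed
    then have "r \<in> core M" using r by (simp add: core_def)
    then show "r = \<zero>" using core by simp
  qed (rule lm)
  ultimately show ?thesis unfolding primitive_ring_def by blast
qed

end

section \<open>Quotients of small growth: finite dimension and dimension one\<close>

context algebra_quotient
begin

text \<open>The image of \<open>M\<close> in the quotient by its core is again maximal, now with
  core zero, so the quotient is finite-dimensional. Lifting the spanning set back to
  \<open>R\<close> lets the quotients for different \<mu> be compared inside one algebra.\<close>

theorem primitive_quotient_finite:
  assumes unc: "uncountable (carrier K)" and gk: "GKdim K R < 3"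
    and M: "R.maximal_left_ideal M" and ker: "\<And>r. r \<in> carrier R \<Longrightarrow> h r = \<zero>\<^bsub>B\<^esub> \<longleftrightarrow> r \<in> R.core M"
    and c: "c \<in> carrier R" "c \<in> R.core M"
    and reg: "\<And>r. r \<in> carrier R \<Longrightarrow> c \<otimes>\<^bsub>R\<^esub> r = \<zero>\<^bsub>R\<^esub> \<Longrightarrow> r = \<zero>\<^bsub>R\<^esub>"
  shows "\<exists>W. finite W \<and> W \<subseteq> carrier R \<and> carrier R \<subseteq> R.span (R.core M \<union> W)"
proof -
  have Ml: "R.left_ideal M" "\<one>\<^bsub>R\<^esub> \<notin> M" using M by (auto simp: R.maximal_left_ideal_def)
  have Mc: "m \<in> carrier R" if "m \<in> M" for m using R.left_ideal_carrier[OF Ml(1) that] .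
  have "h c = \<zero>\<^bsub>B\<^esub>" using ker c by blast
  then obtain n where n: "n \<ge> 1" "card {w. B.normal w \<and> length w = n} \<le> n"
    using few_normal_words[OF gk c(1) _ reg] by blast
  \<comment> \<open>\<open>M\<close> contains the kernel of \<open>h\<close> and is therefore the
    full preimage of its image.\<close>
  have hM: "r \<in> M" if r: "r \<in> carrier R" "h r \<in> h ` M" for r
  proof -
    obtain m where m: "m \<in> M" "h r = h m" using r by blast
    have "h (r \<ominus>\<^bsub>R\<^esub> m) = h m \<ominus>\<^bsub>B\<^esub> h m" using h_minus[OF r(1) Mc[OF m(1)]] m(2) by (simp only:)
    also have "\<dots> = \<zero>\<^bsub>B\<^esub>" using h_closed[OF Mc[OF m(1)]] by (simp add: a_minus_def B.r_neg)
    finally have "h (r \<ominus>\<^bsub>R\<^esub> m) = \<zero>\<^bsub>B\<^esub>" .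
    then have "r \<ominus>\<^bsub>R\<^esub> m \<in> M" using ker[of "r \<ominus>\<^bsub>R\<^esub> m"] r Mc[OF m(1)] R.core_subset by auto
    then have "(r \<ominus>\<^bsub>R\<^esub> m) \<oplus>\<^bsub>R\<^esub> m \<in> M" using R.left_ideal_add[OF Ml(1) _ m(1)] by blast
    then show ?thesis using r Mc[OF m(1)] by (simp add: R.minus_add_self)
  qed
  have lhM: "B.left_ideal (h ` M)"
    unfolding B.left_ideal_def
  proof (intro conjI ballI)
    show "h ` M \<subseteq> carrier B" using Mc h_closed by blast
    show "\<zero>\<^bsub>B\<^esub> \<in> h ` M" using h_zero R.left_ideal_zero[OF Ml(1)] by (metis imageI)
  next
    fix x y assume "x \<in> h ` M" "y \<in> h ` M"
    then obtain m m' where "m \<in> M" "m' \<in> M" "x = h m" "y = h m'" by blast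
    then have "x \<oplus>\<^bsub>B\<^esub> y = h (m \<oplus>\<^bsub>R\<^esub> m')" "m \<oplus>\<^bsub>R\<^esub> m' \<in> M"
      using h_add Mc R.left_ideal_add[OF Ml(1)] by auto
    then show "x \<oplus>\<^bsub>B\<^esub> y \<in> h ` M" by blast
  next
    fix a x assume "a \<in> carrier B" "x \<in> h ` M"
    then obtain r m where "r \<in> carrier R" "m \<in> M" "a = h r" "x = h m" using h_surj by blast
    then have "a \<otimes>\<^bsub>B\<^esub> x = h (r \<otimes>\<^bsub>R\<^esub> m)" "r \<otimes>\<^bsub>R\<^esub> m \<in> M"
      using h_mult Mc R.left_ideal_mult[OF Ml(1)] by auto
    then show "a \<otimes>\<^bsub>B\<^esub> x \<in> h ` M" by blast
  qed
  have maxB: "B.maximal_left_ideal (h ` M)"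
    unfolding B.maximal_left_ideal_def
  proof (intro conjI allI impI)
    show "\<one>\<^bsub>B\<^esub> \<notin> h ` M" using hM[of "\<one>\<^bsub>R\<^esub>"] Ml(2) by (auto simp: h_one)
    fix L assume L: "B.left_ideal L \<and> h ` M \<subseteq> L \<and> \<one>\<^bsub>B\<^esub> \<notin> L"
    let ?L = "{r \<in> carrier R. h r \<in> L}"
    have "R.left_ideal ?L"
      unfolding R.left_ideal_def
      using L B.left_ideal_zero B.left_ideal_add B.left_ideal_mult h_closed
      by (auto simp: h_zero h_add h_mult)
    moreover have "M \<subseteq> ?L" using L Mc by blast
    moreover have "\<one>\<^bsub>R\<^esub> \<notin> ?L" using L by (simp add: h_one)
    ultimately have eq: "?L = M" using M by (simp add: R.maximal_left_ideal_def)
    have "L \<subseteq> h ` M"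
    proof
      fix y assume y: "y \<in> L"
      then have "y \<in> carrier B" using L B.left_ideal_carrier by blast
      then obtain r where r: "r \<in> carrier R" "y = h r" using h_surj by blast
      then have "r \<in> M" using y eq by blast
      then show "y \<in> h ` M" using r by blast
    qed
    then show "L = h ` M" using L by blast
  qed (rule lhM)
  have coreB: "a = \<zero>\<^bsub>B\<^esub>" if a: "a \<in> carrier B" "\<And>e. e \<in> carrier B \<Longrightarrow> a \<otimes>\<^bsub>B\<^esub> e \<in> h ` M" for a
  proof -
    obtain r where r: "r \<in> carrier R" "a = h r" using a h_surj by blast
    have "r \<otimes>\<^bsub>R\<^esub> e \<in> M" if e: "e \<in> carrier R" for e
      using a(2)[OF h_closed[OF e]] r e by (intro hM) (auto simp: h_mult)
    then have "r \<in> R.core M" using r by (simp add: R.core_def)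
    then show ?thesis using ker r by simp
  qed
  have "\<exists>W. finite W \<and> W \<subseteq> carrier B \<and> carrier B \<subseteq> B.span W"
    by (rule B.maximal_left_ideal_core_zero_finite[OF unc n maxB]) (rule coreB)
  then obtain W where W: "finite W" "W \<subseteq> carrier B" "carrier B \<subseteq> B.span W"
    by (elim exE conjE)
  have "\<forall>w\<in>W. \<exists>r. r \<in> carrier R \<and> h r = w"
  proof
    fix w assume "w \<in> W"
    then have "w \<in> h ` carrier R" using W(2) unfolding h_surj by (rule subsetD[rotated])
    then show "\<exists>r. r \<in> carrier R \<and> h r = w" by auto
  qed
  then obtain f where f: "\<forall>w\<in>W. f w \<in> carrier R \<and> h (f w) = w" by (rule bchoice[THEN exE])
  let ?W = "f ` W"
  have Wc: "?W \<subseteq> carrier R" using f by blast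
  have hW: "h ` ?W = W" using f by (auto simp: image_image)
  have cc: "R.core M \<union> ?W \<subseteq> carrier R" using Wc by (auto simp: R.core_def)
  have "carrier R \<subseteq> R.span (R.core M \<union> ?W)"
  proof
    fix r assume r: "r \<in> carrier R"
    then have "h r \<in> B.span (h ` ?W)" using W h_closed hW by auto
    then obtain s where s: "s \<in> R.span ?W" "h s = h r" using h_span_lift[OF _ Wc] by blast
    have sc: "s \<in> carrier R" using R.span_in_carrier[OF Wc s(1)] .
    have "h (r \<ominus>\<^bsub>R\<^esub> s) = h r \<ominus>\<^bsub>B\<^esub> h r" using h_minus[OF r sc] s(2) by (simp only:)
    also have "\<dots> = \<zero>\<^bsub>B\<^esub>" using h_closed[OF r] by (simp add: a_minus_def B.r_neg)
    finally have "h (r \<ominus>\<^bsub>R\<^esub> s) = \<zero>\<^bsub>B\<^esub>" .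
    then have "r \<ominus>\<^bsub>R\<^esub> s \<in> R.core M" using ker[of "r \<ominus>\<^bsub>R\<^esub> s"] r sc by simp
    then have "r \<ominus>\<^bsub>R\<^esub> s \<in> R.span (R.core M \<union> ?W)" by (intro R.span_base[OF cc]) simp
    moreover have "s \<in> R.span (R.core M \<union> ?W)"
      using s R.span_is_monotone[of ?W "R.core M \<union> ?W"] by blast
    ultimately have "(r \<ominus>\<^bsub>R\<^esub> s) \<oplus>\<^bsub>R\<^esub> s \<in> R.span (R.core M \<union> ?W)" by (rule R.span_add[OF cc])
    then show "r \<in> R.span (R.core M \<union> ?W)" using r sc by (simp add: R.minus_add_self)
  qed
  then show ?thesis using W Wc by (intro exI[of _ ?W]) auto
qed

text \<open>The powers of a non-algebraic element are independent, which forces infinitely many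
  normal words, while the gap argument bounds their number in each length.\<close>

lemma GKdim_eq_1_of_not_algebraic:
  assumes gk: "GKdim K R < 3" and c: "c \<in> carrier R" "h c = \<zero>\<^bsub>B\<^esub>"
    and reg: "\<And>r. r \<in> carrier R \<Longrightarrow> c \<otimes>\<^bsub>R\<^esub> r = \<zero>\<^bsub>R\<^esub> \<Longrightarrow> r = \<zero>\<^bsub>R\<^esub>"
    and y: "y \<in> carrier B" "\<not> B.algebraic_over y"
  shows "GKdim K B = 1"
proof -
  obtain n where n: "n \<ge> 1" "card {w. B.normal w \<and> length w = n} \<le> n"
    using few_normal_words[OF gk c reg] by blast
  obtain C where C: "\<And>m. card {w. B.normal w \<and> length w = m} \<le> C" using B.normal_bounded[OF n] by blast
  have "infinite {w. B.normal w}"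
  proof
    assume fin: "finite {w. B.normal w}"
    have "B.indep_over {} (\<lambda>i::nat. y [^]\<^bsub>B\<^esub> i) UNIV"
      unfolding B.indep_over_def
    proof (intro allI impI, elim conjE)
      fix J :: "nat set" assume J: "finite J" "J \<noteq> {}"
      have "B.span ({} \<union> (\<lambda>i. y [^]\<^bsub>B\<^esub> i) ` (J - {Max J})) \<subseteq> B.span (B.powers y (Max J))"
        unfolding B.powers_def using J by (intro B.span_is_monotone) (auto simp: order.strict_iff_order)
      moreover have "y [^]\<^bsub>B\<^esub> Max J \<notin> B.span (B.powers y (Max J))"
        using y(2) by (auto simp: B.algebraic_over_def)
      ultimately show "\<exists>j\<in>J. y [^]\<^bsub>B\<^esub> j \<notin> B.span ({} \<union> (\<lambda>i. y [^]\<^bsub>B\<^esub> i) ` (J - {j}))"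
        using J by (intro bexI[of _ "Max J"]) auto
    qed
    moreover have "(\<lambda>i::nat. y [^]\<^bsub>B\<^esub> i) ` UNIV \<subseteq> B.span ({} \<union> B.wv ` {w. B.normal w})"
      using B.carrier_normal_span y(1) by auto
    ultimately have "finite (UNIV :: nat set)"
      using B.steinitz_card_le[OF finite_imageI[OF fin] B.wv_image_closed empty_subsetI] by blast
    then show False by simp
  qed
  then show ?thesis using C by (rule B.GKdim_eq_1)
qed

end

section \<open>The main theorem\<close>

context generated_algebra
begin

text \<open>
  An ideal maximal among those containing \<open>I\<close> and no monic polynomial in \<open>x\<close> is prime, because
  products of monic polynomials are monic.
\<close>

lemma monic_in_ideal:
  assumes gk: "GKdim K A < 3" and x: "x \<in> carrier A" and I: "ideal I A" and c: "c \<in> I"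
    and reg: "\<And>r. r \<in> carrier A \<Longrightarrow> c \<otimes> r = \<zero> \<Longrightarrow> r = \<zero>"
    and alg: "\<And>P. prime_ideal P A \<Longrightarrow> GKdim K (quot_algebra A P) = 1 \<Longrightarrow>
      algebraic_element K (quot_algebra A P) (P +> x)"
  shows "\<exists>n. \<exists>p\<in>monic x n. p \<in> I"
proof (rule ccontr)
  assume none: "\<not> ?thesis"
  let ?S = "{J. ideal J A \<and> I \<subseteq> J \<and> (\<forall>n. J \<inter> monic x n = {})}"
  have "\<exists>M\<in>?S. \<forall>X\<in>?S. M \<subseteq> X \<longrightarrow> X = M"
  proof (rule subset_Zorn_nonempty)
    show "?S \<noteq> {}" using I none by blast
    fix C assume C: "C \<noteq> {}" "subset.chain ?S C"
    have sub: "C \<subseteq> ?S" using C(2) by (simp add: subset.chain_def)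
    have lin: "X \<subseteq> Y \<or> Y \<subseteq> X" if "X \<in> C" "Y \<in> C" for X Y
      using C(2) that unfolding subset_chain_def by blast
    have id: "ideal X A" if "X \<in> C" for X using sub that by blast
    have "ideal (\<Union>C) A"
    proof (rule two_sided_idealI)
      fix u v assume "u \<in> \<Union>C" "v \<in> \<Union>C"
      then obtain X Y where XY: "X \<in> C" "Y \<in> C" "u \<in> X" "v \<in> Y" by blast
      then obtain Z where Z: "Z \<in> C" "u \<in> Z" "v \<in> Z" using lin by blast
      then show "u \<oplus> v \<in> \<Union>C" using ideal_closed(3)[OF id[OF Z(1)] Z(2,3)] by blast
    next
      fix a u assume a: "a \<in> carrier A" "u \<in> \<Union>C"
      then obtain X where X: "X \<in> C" "u \<in> X" by blast
      show "a \<otimes> u \<in> \<Union>C" using ideal_closed(4)[OF id[OF X(1)] X(2) a(1)] X(1) by blast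
      show "u \<otimes> a \<in> \<Union>C" using ideal_closed(5)[OF id[OF X(1)] X(2) a(1)] X(1) by blast
    next
      obtain X where X: "X \<in> C" using C(1) by blast
      then show "\<zero> \<in> \<Union>C" using ideal_closed(2)[OF id[OF X]] by blast
      show "\<Union>C \<subseteq> carrier A" using ideal_closed(1)[OF id] by blast
    qed
    moreover have "I \<subseteq> \<Union>C" using C(1) sub by blast
    moreover have "\<Union>C \<inter> monic x n = {}" for n using sub by blast
    ultimately show "\<Union>C \<in> ?S" by blast
  qed
  then obtain N where N: "N \<in> ?S" and max: "\<forall>X\<in>?S. N \<subseteq> X \<longrightarrow> X = N" by (rule bexE)
  have Ni: "ideal N A" and IN: "I \<subseteq> N" and Nm: "\<And>n. N \<inter> monic x n = {}" using N by simp_all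
  note Nc = ideal_closed[OF Ni]
  \<comment> \<open>An ideal not inside \<open>N\<close> strictly enlarges it, so by maximality the
    sum with \<open>N\<close> contains a monic value.\<close>
  have meet: "\<exists>n. \<exists>a\<in>N. \<exists>j\<in>J. a \<oplus> j \<in> monic x n" if J: "ideal J A" "\<not> J \<subseteq> N" for J
  proof -
    have sI: "ideal (N <+>\<^bsub>A\<^esub> J) A" by (rule add_ideals[OF Ni J(1)])
    have mem: "z \<in> N <+>\<^bsub>A\<^esub> J \<longleftrightarrow> (\<exists>a\<in>N. \<exists>j\<in>J. z = a \<oplus> j)" for z
      by (auto simp: set_add_def')
    have NS: "N \<subseteq> N <+>\<^bsub>A\<^esub> J"
    proof
      fix a assume a: "a \<in> N"
      then have "a = a \<oplus> \<zero>" using Nc(1) by auto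
      then show "a \<in> N <+>\<^bsub>A\<^esub> J" unfolding mem using a ideal_closed(2)[OF J(1)] by blast
    qed
    obtain j where j: "j \<in> J" "j \<notin> N" using J(2) by blast
    have "j = \<zero> \<oplus> j" using j ideal_closed(1)[OF J(1)] by auto
    then have "j \<in> N <+>\<^bsub>A\<^esub> J" unfolding mem using j Nc(2) by blast
    then have "N <+>\<^bsub>A\<^esub> J \<noteq> N" using j by blast
    then have "N <+>\<^bsub>A\<^esub> J \<notin> ?S" using max NS by blast
    then obtain n where "(N <+>\<^bsub>A\<^esub> J) \<inter> monic x n \<noteq> {}" using sI IN NS by blast
    then obtain z where z: "z \<in> N <+>\<^bsub>A\<^esub> J" "z \<in> monic x n" by blast
    obtain a j where "a \<in> N" "j \<in> J" "z = a \<oplus> j" using z(1) unfolding mem by (elim bexE)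
    then show ?thesis using z(2) by blast
  qed
  have "prime_ideal N A"
    unfolding prime_ideal_def
  proof (intro conjI allI impI)
    show "N \<noteq> carrier A" using Nm[of 0] by (auto simp: monic_0)
    fix J J' assume J: "ideal J A" "ideal J' A" "J <#> J' \<subseteq> N"
    show "J \<subseteq> N \<or> J' \<subseteq> N"
    proof (rule ccontr)
      assume "\<not> ?thesis"
      then obtain m n a b j j' where *: "a \<in> N" "j \<in> J" "a \<oplus> j \<in> monic x m" "b \<in> N" "j' \<in> J'" "b \<oplus> j' \<in> monic x n"
        using meet[OF J(1)] meet[OF J(2)] by blast
      have cc: "a \<in> carrier A" "b \<in> carrier A" "j \<in> carrier A" "j' \<in> carrier A"
        using * Nc(1) ideal_closed(1)[OF J(1)] ideal_closed(1)[OF J(2)] by auto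
      have "j \<otimes> j' \<in> N" using J(3) * by (auto simp: set_mult_def)
      \<comment> \<open>In the product of the two monic values every term except j j' has a factor
        from \<open>N\<close>.\<close>
      then have "a \<otimes> (b \<oplus> j') \<oplus> (j \<otimes> b \<oplus> j \<otimes> j') \<in> N"
        using * cc by (intro Nc(3) Nc(5)[OF *(1)] Nc(4)[OF *(4)]) auto
      moreover have "a \<otimes> (b \<oplus> j') \<oplus> (j \<otimes> b \<oplus> j \<otimes> j') = (a \<oplus> j) \<otimes> (b \<oplus> j')"
        using cc by (simp add: l_distr r_distr a_ac)
      ultimately show False using monic_mult[OF x *(3,6)] Nm by auto
    qed
  qed (rule Ni)
  interpret Q: algebra_quotient K A \<sigma> g "quot_algebra A N" "\<lambda>r. N +> r"
    by (rule quot_algebra_quotient(1)[OF Ni])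
  note ker = quot_algebra_quotient(2)[OF Ni]
  have nalg: "\<not> Q.B.algebraic_over (N +> x)"
  proof
    assume "Q.B.algebraic_over (N +> x)"
    then obtain n p where "p \<in> monic x n" "N +> p = \<zero>\<^bsub>quot_algebra A N\<^esub>"
      using Q.algebraic_over_h[OF x] by blast
    then show False using ker[of p] Nm[of n] monic_closed[OF x, of n] by blast
  qed
  have xq: "N +> x \<in> carrier (quot_algebra A N)" by (rule Q.h_closed[OF x])
  \<comment> \<open>The given \<open>c\<close> lies in \<open>I\<close>, hence in \<open>N\<close>;
    it is the regular element that lowers the growth of the quotient by \<open>N\<close>.\<close>
  have cc: "c \<in> carrier A" "N +> c = \<zero>\<^bsub>quot_algebra A N\<^esub>" using c IN ker[of c] Nc(1) by auto
  have "GKdim K (quot_algebra A N) = 1"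
    by (rule Q.GKdim_eq_1_of_not_algebraic[OF gk cc reg xq nalg])
  then have "algebraic_element K (quot_algebra A N) (N +> x)" using alg \<open>prime_ideal N A\<close> by blast
  then show False using nalg Q.B.algebraic_element_iff[OF xq] by blast
qed

theorem primitive_of_algebraic_quotients:
  assumes unc: "uncountable (carrier K)" and prime: "prime_ring A" and Goldie: "right_Goldie A"
    and PI: "\<not> PI_algebra K A" and gk: "GKdim K A < 3"
    and x: "x \<in> carrier A" "\<not> algebraic_over x"
    and alg: "\<And>P. prime_ideal P A \<Longrightarrow> GKdim K (quot_algebra A P) = 1 \<Longrightarrow>
      algebraic_element K (quot_algebra A P) (P +> x)"
  shows "primitive_ring A"
proof (rule ccontr)
  assume np: "\<not> primitive_ring A"
  have regular: "\<exists>c\<in>I. \<forall>r\<in>carrier A. c \<otimes> r = \<zero> \<longrightarrow> r = \<zero>" if "ideal I A" "I \<noteq> {\<zero>}" for I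
    using prime_Goldie_regular[OF prime Goldie that] .
  define \<Lambda> where "\<Lambda> = {\<mu> \<in> carrier K. \<not> (\<exists>b\<in>carrier A. b \<otimes> shift x \<mu> = \<one>)}"
  have good: "\<not> uncountable {\<mu> \<in> carrier K. \<exists>b\<in>carrier A. b \<otimes> shift x \<mu> = \<one>}"
  proof
    assume u: "uncountable {\<mu> \<in> carrier K. \<exists>b\<in>carrier A. b \<otimes> shift x \<mu> = \<one>}"
    have "algebraic_over x"
    proof (rule amitsur[OF x(1), of "\<lambda>n. wv ` {w \<in> wds. length w \<le> n}"])
      show "uncountable {\<mu> \<in> carrier K. \<exists>b\<in>carrier A. b \<otimes> shift x \<mu> = \<one>}" by (rule u)
    qed (use finite_words_length carrier_words_length in auto)
    with x(2) show False ..
  qed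
  have split: "carrier K = {\<mu> \<in> carrier K. \<exists>b\<in>carrier A. b \<otimes> shift x \<mu> = \<one>} \<union> \<Lambda>"
    by (auto simp: \<Lambda>_def)
  have \<Lambda>: "uncountable \<Lambda>"
  proof
    assume "countable \<Lambda>"
    then have "countable (carrier K)" using good by (subst split) simp
    with unc show False ..
  qed
  have "\<exists>M. maximal_left_ideal M \<and> shift x \<mu> \<in> M" if \<mu>: "\<mu> \<in> \<Lambda>" for \<mu>
  proof -
    have s: "shift x \<mu> \<in> carrier A" using x \<mu> by (simp add: \<Lambda>_def)
    have "\<one> \<notin> {b \<otimes> shift x \<mu> |b. b \<in> carrier A}" using \<mu> by (force simp: \<Lambda>_def)
    then obtain M where M: "maximal_left_ideal M" "{b \<otimes> shift x \<mu> |b. b \<in> carrier A} \<subseteq> M"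
      using exists_maximal_left_ideal[OF left_ideal_principal[OF s]] by blast
    have "shift x \<mu> = \<one> \<otimes> shift x \<mu>" using s by simp
    then have "shift x \<mu> \<in> M" using M(2) one_closed by blast
    with M(1) show ?thesis by blast
  qed
  then have "\<forall>\<mu>\<in>\<Lambda>. \<exists>M. maximal_left_ideal M \<and> shift x \<mu> \<in> M" by blast
  then obtain M where "\<forall>\<mu>\<in>\<Lambda>. maximal_left_ideal (M \<mu>) \<and> shift x \<mu> \<in> M \<mu>" by (rule bchoice[THEN exE])
  then have M: "maximal_left_ideal (M \<mu>)" "shift x \<mu> \<in> M \<mu>" if "\<mu> \<in> \<Lambda>" for \<mu> using that by auto
  have Ml: "left_ideal (M \<mu>)" "\<one> \<notin> M \<mu>" if "\<mu> \<in> \<Lambda>" for \<mu>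
    using M(1)[OF that] by (auto simp: maximal_left_ideal_def)
  have core_ideal: "ideal (core (M \<mu>)) A" if "\<mu> \<in> \<Lambda>" for \<mu> using ideal_core[OF Ml(1)[OF that]] .
  have "\<exists>W. finite W \<and> W \<subseteq> carrier A \<and> carrier A \<subseteq> span (core (M \<mu>) \<union> W)" if \<mu>: "\<mu> \<in> \<Lambda>" for \<mu>
  proof -
    \<comment> \<open>Here the assumption that the algebra is not primitive enters; a nonzero core
      then supplies a regular element.\<close>
    have "core (M \<mu>) \<noteq> {\<zero>}" using np primitive_of_core_zero[OF M(1)[OF \<mu>]] by blast
    then obtain c where c: "c \<in> core (M \<mu>)" "\<forall>r\<in>carrier A. c \<otimes> r = \<zero> \<longrightarrow> r = \<zero>"
      using regular[OF core_ideal[OF \<mu>]] by blast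
    have cc: "c \<in> carrier A" using c(1) by (simp add: core_def)
    interpret Q: algebra_quotient K A \<sigma> g "quot_algebra A (core (M \<mu>))" "\<lambda>r. core (M \<mu>) +> r"
      by (rule quot_algebra_quotient(1)[OF core_ideal[OF \<mu>]])
    show ?thesis
      using Q.primitive_quotient_finite[OF unc gk M(1)[OF \<mu>]
          quot_algebra_quotient(2)[OF core_ideal[OF \<mu>]] cc c(1)] c(2) by blast
  qed
  then have "\<forall>\<mu>\<in>\<Lambda>. \<exists>W. finite W \<and> W \<subseteq> carrier A \<and> carrier A \<subseteq> span (core (M \<mu>) \<union> W)" by blast
  then obtain W where W: "\<forall>\<mu>\<in>\<Lambda>. finite (W \<mu>) \<and> W \<mu> \<subseteq> carrier A \<and> carrier A \<subseteq> span (core (M \<mu>) \<union> W \<mu>)"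
    by (rule bchoice[THEN exE])
  have "\<Lambda> \<subseteq> (\<Union>d. {\<mu>. card (W \<mu>) = d})" by blast
  then have "\<exists>d. uncountable (\<Lambda> \<inter> {\<mu>. card (W \<mu>) = d})" by (rule uncountable_piece[OF \<Lambda>])
  then obtain d where d: "uncountable (\<Lambda> \<inter> {\<mu>. card (W \<mu>) = d})" (is "uncountable ?D") by (rule exE)
  have infD: "infinite ?D" using d countable_finite by blast
  then obtain \<mu>0 where \<mu>0: "\<mu>0 \<in> ?D" by (metis ex_in_conv finite.emptyI)
  define I where "I = (\<Inter>\<mu>\<in>?D. core (M \<mu>))"
  have I_sub: "I \<subseteq> core (M \<mu>)" if "\<mu> \<in> ?D" for \<mu> using that by (auto simp: I_def)
  have mem: "a \<in> I \<longleftrightarrow> (\<forall>\<mu>\<in>?D. a \<in> core (M \<mu>))" for a by (simp add: I_def)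
  have cid: "ideal (core (M \<mu>)) A" if "\<mu> \<in> ?D" for \<mu> using core_ideal that by blast
  have I: "ideal I A"
  proof (rule two_sided_idealI)
    show "I \<subseteq> carrier A" using I_sub[OF \<mu>0] by (auto simp: core_def)
    show "\<zero> \<in> I" unfolding mem using ideal_closed(2)[OF cid] by blast
    fix u v assume "u \<in> I" "v \<in> I"
    then show "u \<oplus> v \<in> I" unfolding mem using ideal_closed(3)[OF cid] by blast
  next
    fix a u assume "u \<in> I" "a \<in> carrier A"
    then show "a \<otimes> u \<in> I" "u \<otimes> a \<in> I"
      unfolding mem using ideal_closed(4)[OF cid] ideal_closed(5)[OF cid] by blast+
  qed
  have "I \<noteq> {\<zero>}"
  proof
    assume I0: "I = {\<zero>}"
    have "PI_algebra K A"
    \<comment> \<open>\<open>Suc d\<close> because the degree of the standard polynomial has to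
      exceed the dimension bound.\<close>
    proof (rule PI_of_finite_quotients[of ?D "\<lambda>\<mu>. core (M \<mu>)" "Suc d"])
      show "ideal (core (M \<mu>)) A" if "\<mu> \<in> ?D" for \<mu> by (rule cid[OF that])
      show "\<exists>W. finite W \<and> W \<subseteq> carrier A \<and> carrier A \<subseteq> span (core (M \<mu>) \<union> W) \<and> card W < Suc d"
        if "\<mu> \<in> ?D" for \<mu>
        using W that by (intro exI[of _ "W \<mu>"]) auto
      show "a = \<zero>" if "a \<in> carrier A" "\<And>\<mu>. \<mu> \<in> ?D \<Longrightarrow> a \<in> core (M \<mu>)" for a
        using that(2) I0 mem[of a] by blast
    qed
    with PI show False by blast
  qed
  then obtain c where c: "c \<in> I" "\<forall>r\<in>carrier A. c \<otimes> r = \<zero> \<longrightarrow> r = \<zero>" using regular[OF I] by blast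
  have "\<exists>n. \<exists>p\<in>monic x n. p \<in> I"
    using monic_in_ideal[OF gk x(1) I c(1) _ alg] c(2) by blast
  then obtain n p where p: "p \<in> monic x n" "p \<in> I" by blast
  \<comment> \<open>One scalar more than the degree of \<open>p\<close> is enough for the
    contradiction with the root count.\<close>
  from infinite_arbitrarily_large[OF infD, of "Suc n"]
  obtain F where F: "finite F" "card F = Suc n" "F \<subseteq> ?D" by (elim exE conjE)
  have "card F \<le> n"
  proof (rule monic_roots_le[OF x(1) p(1) F(1), of M])
    show "F \<subseteq> carrier K" using F(3) by (auto simp: \<Lambda>_def)
    fix \<mu> assume "\<mu> \<in> F"
    then have \<mu>: "\<mu> \<in> ?D" using F(3) by blast
    then have "p \<in> M \<mu>" using p(2) I_sub core_subset by blast
    then show "left_ideal (M \<mu>) \<and> \<one> \<notin> M \<mu> \<and> shift x \<mu> \<in> M \<mu> \<and> p \<in> M \<mu>"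
      using M Ml \<mu> by blast
  qed
  then show False using F(2) by simp
qed

end

theorem theorem2p10:
  fixes K :: "('k, 'c) ring_scheme" and R :: "('k, 'a, 'm) module_scheme" and x :: 'a
  assumes "field K" and "uncountable (carrier K)"
    and "k_algebra K R" and "affine_algebra K R" and "prime_ring R" and "Goldie R"
    and "\<not> simple_ring R" and "\<not> PI_algebra K R" and "GKdim K R < 3"
    and "x \<in> carrier R" and "\<not> algebraic_element K R x"
    and "\<And>P. \<lbrakk>prime_ideal P R; GKdim K (quot_algebra R P) = 1\<rbrakk> \<Longrightarrow>
           algebraic_element K (quot_algebra R P) (P +>\<^bsub>R\<^esub> x)"
    and "\<And>P. \<lbrakk>prime_ideal P R; GKdim K (quot_algebra R P) = 1\<rbrakk> \<Longrightarrow>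
           k_algebra_isomorphic K
             (center_algebra (classical_quotient K (quot_algebra R P))) (rational_functions K)"
  shows "primitive_ring R"
proof -
  obtain \<sigma> g where "generated_algebra K R \<sigma> g"
    using affine_generated[OF \<open>k_algebra K R\<close> \<open>affine_algebra K R\<close>] .
  then interpret generated_algebra K R \<sigma> g .
  show ?thesis
  proof (rule primitive_of_algebraic_quotients)
    show "right_Goldie R" using \<open>Goldie R\<close> by (simp add: Goldie_def)
    show "\<not> algebraic_over x"
      using \<open>\<not> algebraic_element K R x\<close> algebraic_element_iff[OF \<open>x \<in> carrier R\<close>] by simp
  qed (use assms in blast)+
qed

end
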